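(* Assume that the underlying IMEX RK method has $p$-th order accuracy with $p\ge2$. Let $(u,r)$ be the exact solution of the scalar-auxiliary-variable system $u_t=L(u)+N(u,r)$, $r_t=\tilde N(u,r)$, and let $(u_\gamma^{n+1},r_\gamma^{n+1})$ be the result of one step of the IMEX RRK method with stepsize $\tau$ and relaxation coefficient $\gamma_n$ (as defined in the context), starting from the exact values $u_\gamma^n=u(\hat t_n)$, $r_\gamma^n=r(\hat t_n)$. Then, for sufficiently small $\tau$: (i) (Incremental direction technique, IDT) If $u_\gamma^{n+1}$ and $r_\gamma^{n+1}$ are interpreted as approximations of $u$ and $r$ at $\hat t_{n+1}=\hat t_n+\tau$, then the IMEX RRK method is of $(p-1)$-th order accuracy, namely $$u(\hat t_{n+1})=u_\gamma^{n+1}+\mathcal O(\tau^{p}),\qquad r(\hat t_{n+1})=r_\gamma^{n+1}+\mathcal O(\tau^{p}).$$ (ii) (Relaxation technique, RT) If $u_\gamma^{n+1}$ and $r_\gamma^{n+1}$ are interpreted as approximations of $u$ and $r$ at $\hat t_{n+1}=\hat t_n+\gamma_n\tau$, then the IMEX RRK method is of $p$-th order accuracy, namely $$u(\hat t_{n+1})=u_\gamma^{n+1}+\mathcal O(\tau^{p+1}),\qquad r(\hat t_{n+1})=r_\gamma^{n+1}+\mathcal O(\tau^{p+1}).$$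
   Context: Setting. $\Omega$ is a bounded rectangular domain with periodic boundary conditions; $\langle\cdot,\cdot\rangle$ and $\|\cdot\|$ are the $L^2(\Omega)$ inner product and norm; $\epsilon>0$; $F:\mathbb R\to\mathbb R$ is a smooth potential; $\mathcal G$ is the non-positive operator $\mathcal G=-\mathcal I$ (Allen-Cahn) or $\mathcal G=\Delta$ (Cahn-Hilliard); $C_0\ge 0$ is a constant such that $\int_\Omega F(u)\,\mathrm d x+C_0>0$ for all functions $u$ where this expression occurs. All functions are periodic and sufficiently smooth; $\mathcal O(\cdot)$ refers to $\tau\to0$ with constants independent of $\tau$. The scalar auxiliary variable (SAV) system for $u=u(x,t)$ and a scalar $r=r(t)$ is $u_t=L(u)+N(u,r)$, $r_t=\tilde N(u,r)$, where $$L(u)=\mathcal G(-\epsilon^2\Delta u),\qquad N(u,r)=\mathcal G\Big(\tfrac{r}{\sqrt{\int_\Omega F(u)\,\mathrm d x+C_0}}F'(u)\Big),$$ $$\tilde N(u,r)=\tfrac{1}{2\sqrt{\int_\Omega F(u)\,\mathrm d x+C_0}}\big\langle F'(u),\,L(u)+N(u,r)\big\rangle .$$ Coefficients. Real matrices $A=(a_{ij})_{s\times s}$ with $a_{ij}=0$ for $j>i$, $\bar A=(\bar a_{ij})_{s\times s}$ with $\bar a_{ij}=0$ for $j\ge i$, and real weights $b_i,\bar b_i$ with $\sum_i b_i=\sum_i\bar b_i=1$. IMEX RRK method. Given $(u_\gamma^n,r_\gamma^n)$ at time $\hat t_n$ and $\tau>0$, the stages $U_{ni},R_{ni}$, $i=1,\dots,s$,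 satisfy $$U_{ni}=u_\gamma^n+\tau\sum_{j=1}^{i}a_{ij}L_{nj}+\tau\sum_{j=1}^{i-1}\bar a_{ij}N_{nj},\qquad R_{ni}=r_\gamma^n+\tau\sum_{j=1}^{i-1}\bar a_{ij}\tilde N_{nj},$$ with $L_{nj}=L(U_{nj})$, $N_{nj}=N(U_{nj},R_{nj})$, $\tilde N_{nj}=\tilde N(U_{nj},R_{nj})$, and the update is $$u_\gamma^{n+1}=u_\gamma^n+\gamma_n\tau\sum_{i=1}^s(b_iL_{ni}+\bar b_iN_{ni}),\qquad r_\gamma^{n+1}=r_\gamma^n+\gamma_n\tau\sum_{i=1}^s\bar b_i\tilde N_{ni}.$$ The (underlying) IMEX RK method is the same scheme with $\gamma_n$ replaced by $1$. Relaxation coefficient. Let $$D_n=\frac{\epsilon^2}{2}\Big\|\nabla\Big(\sum_{i=1}^s b_iL_{ni}+\sum_{i=1}^s\bar b_iN_{ni}\Big)\Big\|^2+\Big(\sum_{i=1}^s\bar b_i\tilde N_{ni}\Big)^2 .$$ If $D_n\neq0$, then $$\gamma_n=\frac{\sum_{i=1}^s\big[\epsilon^2\langle u_\gamma^n-U_{ni},\Delta(b_iL_{ni}+\bar b_iN_{ni})\rangle-2(r_\gamma^n-R_{ni})\bar b_i\tilde N_{ni}\big]}{\tau D_n};$$ if $D_n=0$, then $\gamma_n=1$. Order of the IMEX RK method. The IMEX RK method with coefficients $(A,b;\bar A,\bar b)$ has $p$-th order accuracy if, applied to a smooth additively split initial value problem $y_t=f(y)+g(y)$ ($f$ treated with $(A,b)$,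 $g$ with $(\bar A,\bar b)$), one step of size $\tau$ from exact data produces the exact solution up to an error $\mathcal O(\tau^{p+1})$. For the SAV system, $y=(u,r)$, $f=(L,0)$, $g=(N,\tilde N)$.
   Formalization: Added: u_t is not identically zero at the start time, or D_n=0 for all small τ (at an equilibrium with D_n≠0, γ_n can blow up and the claim fails); "sufficiently smooth" is read as C^∞ with the stages' spatial derivatives bounded uniformly in τ. *)

theory Defs
  imports "HOL-Analysis.Analysis" "HOL-Library.Landau_Symbols"
begin

section \<open>Smooth functions\<close>

text \<open>Derivatives are taken within \<open>S\<close>, so that \<open>S\<close> may be a closed time slab such as
  \<open>{t0..T} \<times> UNIV\<close>; on such a set the derivative within \<open>S\<close> is unique.\<close>

definition partial_deriv :: "'a::euclidean_space set \<Rightarrow> 'a \<Rightarrow> ('a \<Rightarrow> real) \<Rightarrow> 'a \<Rightarrow> real" where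
  "partial_deriv S e v x = frechet_derivative v (at x within S) e"

definition iter_partial :: "'a::euclidean_space set \<Rightarrow> 'a list \<Rightarrow> ('a \<Rightarrow> real) \<Rightarrow> 'a \<Rightarrow> real" where
  "iter_partial S es v = foldr (partial_deriv S) es v"

text \<open>\<open>C\<^sup>\<infinity>\<close>: every iterated partial derivative is again (totally) differentiable on \<open>S\<close>.\<close>

definition smooth_on :: "'a::euclidean_space set \<Rightarrow> ('a \<Rightarrow> real) \<Rightarrow> bool" where
  "smooth_on S v \<longleftrightarrow> (\<forall>es. set es \<subseteq> Basis \<longrightarrow> iter_partial S es v differentiable_on S)"


section \<open>Periodic functions on a rectangular box\<close>

text \<open>Functions on \<open>\<Omega> = box a b\<close> with periodic boundary conditions are represented by their
  periodic extensions to the whole space.\<close>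

definition box_periodic :: "'a::euclidean_space \<Rightarrow> 'a \<Rightarrow> ('a \<Rightarrow> real) \<Rightarrow> bool" where
  "box_periodic a b v \<longleftrightarrow> (\<forall>e\<in>Basis. \<forall>x. v (x + ((b - a) \<bullet> e) *\<^sub>R e) = v x)"

definition l2_inner ::
    "'a::euclidean_space \<Rightarrow> 'a \<Rightarrow> ('a \<Rightarrow> 'b::real_inner) \<Rightarrow> ('a \<Rightarrow> 'b) \<Rightarrow> real" where
  "l2_inner a b v w = integral (cbox a b) (\<lambda>x. v x \<bullet> w x)"

definition l2_norm :: "'a::euclidean_space \<Rightarrow> 'a \<Rightarrow> ('a \<Rightarrow> 'b::real_inner) \<Rightarrow> real" where
  "l2_norm a b v = sqrt (l2_inner a b v v)"

definition grad :: "('a::euclidean_space \<Rightarrow> real) \<Rightarrow> 'a \<Rightarrow> 'a" where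
  "grad v x = (\<Sum>e\<in>Basis. partial_deriv UNIV e v x *\<^sub>R e)"

definition laplacian :: "('a::euclidean_space \<Rightarrow> real) \<Rightarrow> 'a \<Rightarrow> real" where
  "laplacian v x = (\<Sum>e\<in>Basis. partial_deriv UNIV e (partial_deriv UNIV e v) x)"


section \<open>The scalar auxiliary variable system\<close>

text \<open>The domain is \<open>box lo hi\<close>.\<close>

record 'a sav =
  lo :: 'a
  hi :: 'a
  eps :: real
  C0 :: real
  pot :: "real \<Rightarrow> real"
  mob :: "('a \<Rightarrow> real) \<Rightarrow> 'a \<Rightarrow> real"

text \<open>The quantity under the square root, \<open>\<integral>\<^sub>\<Omega> F(u) dx + C\<^sub>0\<close>.\<close>

definition sav_Q :: "'a::euclidean_space sav \<Rightarrow> ('a \<Rightarrow> real) \<Rightarrow> real" where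
  "sav_Q P u = integral (cbox (lo P) (hi P)) (\<lambda>x. pot P (u x)) + C0 P"

definition sav_L :: "'a::euclidean_space sav \<Rightarrow> ('a \<Rightarrow> real) \<Rightarrow> 'a \<Rightarrow> real" where
  "sav_L P u = mob P (\<lambda>x. - (eps P)\<^sup>2 * laplacian u x)"

definition sav_N :: "'a::euclidean_space sav \<Rightarrow> ('a \<Rightarrow> real) \<Rightarrow> real \<Rightarrow> 'a \<Rightarrow> real" where
  "sav_N P u r = mob P (\<lambda>x. r / sqrt (sav_Q P u) * deriv (pot P) (u x))"

definition sav_Nt :: "'a::euclidean_space sav \<Rightarrow> ('a \<Rightarrow> real) \<Rightarrow> real \<Rightarrow> real" where
  "sav_Nt P u r = 1 / (2 * sqrt (sav_Q P u)) *
     l2_inner (lo P) (hi P) (\<lambda>x. deriv (pot P) (u x)) (\<lambda>x. sav_L P u x + sav_N P u r x)"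

definition sav_solution ::
    "'a::euclidean_space sav \<Rightarrow> real \<Rightarrow> real \<Rightarrow> (real \<Rightarrow> 'a \<Rightarrow> real) \<Rightarrow> (real \<Rightarrow> real) \<Rightarrow> bool" where
  "sav_solution P t0 T u r \<longleftrightarrow>
     smooth_on ({t0..T} \<times> UNIV) (\<lambda>(t, x). u t x) \<and> smooth_on {t0..T} r \<and>
     (\<forall>t\<in>{t0..T}.
        box_periodic (lo P) (hi P) (u t) \<and> sav_Q P (u t) > 0 \<and>
        (\<forall>x. ((\<lambda>s. u s x) has_real_derivative sav_L P (u t) x + sav_N P (u t) (r t) x)
               (at t within {t0..T})) \<and>
        (r has_real_derivative sav_Nt P (u t) (r t)) (at t within {t0..T}))"


section \<open>IMEX Runge--Kutta tableaux and their order\<close>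

text \<open>Indices run from \<open>1\<close> to \<open>stages M\<close>; \<open>cA\<close>, \<open>cb\<close> are the coefficients of the implicit part and
  \<open>cA'\<close>, \<open>cb'\<close> (the barred coefficients) those of the explicit part.\<close>

record imex =
  stages :: nat
  cA :: "nat \<Rightarrow> nat \<Rightarrow> real"
  cb :: "nat \<Rightarrow> real"
  cA' :: "nat \<Rightarrow> nat \<Rightarrow> real"
  cb' :: "nat \<Rightarrow> real"

definition imex_tableau :: "imex \<Rightarrow> bool" where
  "imex_tableau M \<longleftrightarrow>
     (\<forall>i\<in>{1..stages M}. \<forall>j\<in>{1..stages M}. (j > i \<longrightarrow> cA M i j = 0) \<and> (j \<ge> i \<longrightarrow> cA' M i j = 0)) \<and>
     (\<Sum>i=1..stages M. cb M i) = 1 \<and> (\<Sum>i=1..stages M. cb' M i) = 1"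

text \<open>The order of a method quantifies over systems of every dimension \<open>m\<close>, so \<open>\<real>\<^sup>m\<close> is the library's
  \<^const>\<open>Euclidean_space\<close>: sequences of reals vanishing from index \<open>m\<close> on. A function is smooth on an
  open subset if all its iterated partial derivatives exist and are continuous there.\<close>

definition coord_deriv :: "nat \<Rightarrow> ((nat \<Rightarrow> real) \<Rightarrow> real) \<Rightarrow> (nat \<Rightarrow> real) \<Rightarrow> real" where
  "coord_deriv k h x = deriv (\<lambda>s. h (x(k := s))) (x k)"

definition smooth_coord :: "nat \<Rightarrow> (nat \<Rightarrow> real) set \<Rightarrow> ((nat \<Rightarrow> real) \<Rightarrow> real) \<Rightarrow> bool" where
  "smooth_coord m D h \<longleftrightarrow>
     (\<forall>ks. set ks \<subseteq> {..<m} \<longrightarrow>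
        continuous_map (subtopology (Euclidean_space m) D) euclideanreal (foldr coord_deriv ks h) \<and>
        (\<forall>x\<in>D. \<forall>k<m. (\<lambda>s. foldr coord_deriv ks h (x(k := s))) differentiable at (x k)))"

text \<open>Order \<open>p\<close>: for every smooth split system \<open>y' = f y + g y\<close> on an open subset \<open>D\<close> of some \<open>\<real>\<^sup>m\<close> and
  every exact solution \<open>y\<close>, one step from \<open>y t0\<close> has error \<open>O(\<tau>\<^sup>p\<^sup>+\<^sup>1)\<close>. Since the implicit stage
  equations of a nonlinear \<open>f\<close> can have spurious solutions that blow up as \<open>\<tau> \<rightarrow> 0\<close>, the stages are
  required to be those that converge to the initial value.\<close>

definition imex_order :: "imex \<Rightarrow> nat \<Rightarrow> bool" where
  "imex_order M p \<longleftrightarrow>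
     (\<forall>m D f g t0 T y \<tau>0 Y.
        openin (Euclidean_space m) D \<and>
        (\<forall>k<m. smooth_coord m D (\<lambda>x. f x k) \<and> smooth_coord m D (\<lambda>x. g x k)) \<and>
        t0 < T \<and>
        (\<forall>t\<in>{t0..T}. y t \<in> D \<and>
           (\<forall>k<m. ((\<lambda>s. y s k) has_real_derivative f (y t) k + g (y t) k) (at t within {t0..T}))) \<and>
        0 < \<tau>0 \<and>
        (\<forall>\<tau>\<in>{0<..\<tau>0}. \<forall>i\<in>{1..stages M}. Y \<tau> i \<in> D \<and>
           (\<forall>k<m. Y \<tau> i k = y t0 k + \<tau> * (\<Sum>j=1..i. cA M i j * f (Y \<tau> j) k)
                                    + \<tau> * (\<Sum>j=1..<i. cA' M i j * g (Y \<tau> j) k))) \<and>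
        (\<forall>i\<in>{1..stages M}. \<forall>k<m. ((\<lambda>\<tau>. Y \<tau> i k) \<longlongrightarrow> y t0 k) (at_right 0))
        \<longrightarrow>
        (\<forall>k<m. (\<lambda>\<tau>. y (t0 + \<tau>) k -
                   (y t0 k + \<tau> * (\<Sum>i=1..stages M. cb M i * f (Y \<tau> i) k + cb' M i * g (Y \<tau> i) k)))
               \<in> O[at_right 0](\<lambda>\<tau>. \<tau> ^ (p + 1))))"


section \<open>The relaxation method\<close>

text \<open>In the following \<open>u0\<close>, \<open>r0\<close> are the values at the beginning of the step and \<open>U i\<close>, \<open>R i\<close> the
  stages.\<close>

definition rrk_stages ::
    "'a::euclidean_space sav \<Rightarrow> imex \<Rightarrow> real \<Rightarrow> ('a \<Rightarrow> real) \<Rightarrow> real \<Rightarrow>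
     (nat \<Rightarrow> 'a \<Rightarrow> real) \<Rightarrow> (nat \<Rightarrow> real) \<Rightarrow> bool" where
  "rrk_stages P M \<tau> u0 r0 U R \<longleftrightarrow>
     (\<forall>i\<in>{1..stages M}.
        (\<forall>x. U i x = u0 x + \<tau> * (\<Sum>j=1..i. cA M i j * sav_L P (U j) x)
                          + \<tau> * (\<Sum>j=1..<i. cA' M i j * sav_N P (U j) (R j) x)) \<and>
        R i = r0 + \<tau> * (\<Sum>j=1..<i. cA' M i j * sav_Nt P (U j) (R j)))"

definition rrk_incr_u ::
    "'a::euclidean_space sav \<Rightarrow> imex \<Rightarrow> (nat \<Rightarrow> 'a \<Rightarrow> real) \<Rightarrow> (nat \<Rightarrow> real) \<Rightarrow> 'a \<Rightarrow> real" where
  "rrk_incr_u P M U R x =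
     (\<Sum>i=1..stages M. cb M i * sav_L P (U i) x + cb' M i * sav_N P (U i) (R i) x)"

definition rrk_incr_r ::
    "'a::euclidean_space sav \<Rightarrow> imex \<Rightarrow> (nat \<Rightarrow> 'a \<Rightarrow> real) \<Rightarrow> (nat \<Rightarrow> real) \<Rightarrow> real" where
  "rrk_incr_r P M U R = (\<Sum>i=1..stages M. cb' M i * sav_Nt P (U i) (R i))"

definition rrk_D ::
    "'a::euclidean_space sav \<Rightarrow> imex \<Rightarrow> (nat \<Rightarrow> 'a \<Rightarrow> real) \<Rightarrow> (nat \<Rightarrow> real) \<Rightarrow> real" where
  "rrk_D P M U R =
     (eps P)\<^sup>2 / 2 * (l2_norm (lo P) (hi P) (grad (rrk_incr_u P M U R)))\<^sup>2 + (rrk_incr_r P M U R)\<^sup>2"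

definition rrk_gamma ::
    "'a::euclidean_space sav \<Rightarrow> imex \<Rightarrow> real \<Rightarrow> ('a \<Rightarrow> real) \<Rightarrow> real \<Rightarrow>
     (nat \<Rightarrow> 'a \<Rightarrow> real) \<Rightarrow> (nat \<Rightarrow> real) \<Rightarrow> real" where
  "rrk_gamma P M \<tau> u0 r0 U R =
     (if rrk_D P M U R = 0 then 1
      else (\<Sum>i=1..stages M.
              (eps P)\<^sup>2 * l2_inner (lo P) (hi P) (\<lambda>x. u0 x - U i x)
                 (laplacian (\<lambda>x. cb M i * sav_L P (U i) x + cb' M i * sav_N P (U i) (R i) x))
              - 2 * (r0 - R i) * cb' M i * sav_Nt P (U i) (R i))
           / (\<tau> * rrk_D P M U R))"

definition rrk_step_u ::
    "'a::euclidean_space sav \<Rightarrow> imex \<Rightarrow> real \<Rightarrow> ('a \<Rightarrow> real) \<Rightarrow> real \<Rightarrow>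
     (nat \<Rightarrow> 'a \<Rightarrow> real) \<Rightarrow> (nat \<Rightarrow> real) \<Rightarrow> 'a \<Rightarrow> real" where
  "rrk_step_u P M \<tau> u0 r0 U R x = u0 x + rrk_gamma P M \<tau> u0 r0 U R * \<tau> * rrk_incr_u P M U R x"

definition rrk_step_r ::
    "'a::euclidean_space sav \<Rightarrow> imex \<Rightarrow> real \<Rightarrow> ('a \<Rightarrow> real) \<Rightarrow> real \<Rightarrow>
     (nat \<Rightarrow> 'a \<Rightarrow> real) \<Rightarrow> (nat \<Rightarrow> real) \<Rightarrow> real" where
  "rrk_step_r P M \<tau> u0 r0 U R = r0 + rrk_gamma P M \<tau> u0 r0 U R * \<tau> * rrk_incr_r P M U R"

text \<open>A family of stages, one for each step size \<open>\<tau> \<le> \<tau>0\<close>, that is periodic and smooth uniformly in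
  \<open>\<tau>\<close>. Uniformity is not automatic: for a negative diagonal coefficient of the implicit part the linear
  stage equations are singular for step sizes accumulating at \<open>0\<close>, and solutions are
  then neither unique nor bounded.\<close>

definition smooth_stage_family ::
    "'a::euclidean_space sav \<Rightarrow> imex \<Rightarrow> real \<Rightarrow> (real \<Rightarrow> nat \<Rightarrow> 'a \<Rightarrow> real) \<Rightarrow> bool" where
  "smooth_stage_family P M \<tau>0 U \<longleftrightarrow>
     (\<forall>i\<in>{1..stages M}.
        (\<forall>\<tau>\<in>{0<..\<tau>0}. box_periodic (lo P) (hi P) (U \<tau> i) \<and> smooth_on UNIV (U \<tau> i) \<and>
           sav_Q P (U \<tau> i) > 0) \<and>
        (\<forall>es. set es \<subseteq> Basis \<longrightarrow>
           (\<exists>B. \<forall>\<tau>\<in>{0<..\<tau>0}. \<forall>x. \<bar>iter_partial UNIV es (U \<tau> i) x\<bar> \<le> B)))"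

end

theory Submission
  imports Defs "HOL-Library.Countable"
begin

text \<open>
  Order \<open>p\<close> is only assumed for finite-dimensional systems, and it enters through its order
  conditions: the iterated integrals generated by \<open>1\<close>, products and the two integration operators of
  the method (exact integral on the one hand, \<open>A\<close> or \<open>A'\<close> acting on the stages on the other) are the
  coordinates of a triangular polynomial system, for which exact solution and stages are monomials
  in \<open>\<tau>\<close>.

  For the SAV system put the exact solution at \<open>t0 + \<tau>\<close> (index \<open>0\<close>) and the stages (indices
  \<open>1, \<dots>, s\<close>) into one vector. Bootstrapping the integral equation and the stage equations yields
  expansions in powers of \<open>\<tau>\<close>, uniformly in space and for all spatial derivatives, whose \<open>n\<close>-th
  coefficient vectors satisfy, pointwise in \<open>x\<close>, every linear relation valid for the weights of order
  \<open>n\<close>. This property is stable under sums, products, composition with smooth functions,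
  differentiation and integration over the domain, so no elementary differentials are needed. The
  order conditions then give the one-step error \<open>O(\<tau>\<^sup>p\<^sup>+\<^sup>1)\<close>, for \<open>u\<close>, \<open>r\<close>, the gradient of \<open>u\<close>, and
  also for the energy \<open>\<epsilon>\<^sup>2/2 \<parallel>\<nabla>u\<parallel>\<^sup>2 + r\<^sup>2\<close> integrated by the quadrature \<open>b\<close>, \<open>b'\<close>. Comparing the
  latter with the energy of the Runge--Kutta update, a quadratic polynomial with leading coefficient
  \<open>D\<close>, shows \<open>\<gamma> - 1 = O(\<tau>\<^sup>p\<^sup>-\<^sup>1)\<close>, from which both claims follow.
\<close>

section \<open>Order conditions\<close>

text \<open>The operators are unbounded: \<open>sav_L\<close> costs two or four spatial derivatives,
  so no Lipschitz argument in a fixed norm is available. Treating every number of derivatives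
  simultaneously removes this obstacle, since each bootstrap step gains a power of
  \<open>\<tau>\<close> and may consume as many derivatives as it likes. Before the bootstrap, the
  stages have to be shown close to the initial value, as otherwise the square root in the
  denominators could degenerate. The comparison of energies bounds
  \<open>\<tau> * (\<tau> * D - numerator)\<close>, and dividing by \<open>\<tau>^2 * D\<close> is
  safe only if \<open>D\<close> stays away from 0. Its limit \<open>D0\<close> is \<open>D\<close>
  formed with the exact time derivatives. If it vanished, \<open>u_t\<close> would be constant in
  space and \<open>r_t\<close> zero, and periodicity forces that constant to be 0, against a nonzero
  right-hand side. The relaxed step deviates from the unrelaxed one by
  \<open>(\<gamma> - 1) * \<tau>\<close> times the increment, which is of size
  \<open>\<tau>^p\<close>. At the time \<open>t0 + \<gamma> * \<tau>\<close> the exact solution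
  moves by the same amount up to \<open>\<tau>^(p+1)\<close>, because the increment and
  \<open>u_t\<close> agree to first order.\<close>

datatype rk_term = Unit | Mul rk_term rk_term | IntF rk_term | IntG rk_term

instance rk_term :: countable
  by countable_datatype

text \<open>The degree in \<open>\<tau>\<close> of the monomial belonging to a term.\<close>

primrec weight :: "rk_term \<Rightarrow> nat" where
  "weight Unit = 0"
| "weight (Mul t u) = weight t + weight u"
| "weight (IntF t) = Suc (weight t)"
| "weight (IntG t) = Suc (weight t)"

text \<open>At index \<open>0\<close> the weight belongs to the exact solution, at index \<open>i > 0\<close> to the \<open>i\<close>-th stage.\<close>

primrec wt :: "imex \<Rightarrow> rk_term \<Rightarrow> nat \<Rightarrow> real" where
  "wt M Unit = (\<lambda>_. 1)"
| "wt M (Mul t u) = (\<lambda>\<mu>. wt M t \<mu> * wt M u \<mu>)"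
| "wt M (IntF t) = (\<lambda>\<mu>. if \<mu> = 0 then wt M t 0 / real (Suc (weight t))
     else (\<Sum>j=1..\<mu>. cA M \<mu> j * wt M t j))"
| "wt M (IntG t) = (\<lambda>\<mu>. if \<mu> = 0 then wt M t 0 / real (Suc (weight t))
     else (\<Sum>j=1..<\<mu>. cA' M \<mu> j * wt M t j))"

text \<open>A single term needs only finitely many others to form a closed system, which keeps the
  test system finite-dimensional.\<close>

primrec subterms :: "rk_term \<Rightarrow> rk_term set" where
  "subterms Unit = {Unit}"
| "subterms (Mul t u) = insert (Mul t u) (subterms t \<union> subterms u)"
| "subterms (IntF t) = insert (IntF t) (subterms t)"
| "subterms (IntG t) = insert (IntG t) (subterms t)"

lemma finite_subterms: "finite (subterms t)"
  by (induction t) auto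

lemma self_subterms: "t \<in> subterms t"
  by (cases t) auto

lemma subterms_trans: "u \<in> subterms t \<Longrightarrow> subterms u \<subseteq> subterms t"
  by (induction t) auto

text \<open>The coordinates of the test system are the terms that are integrals.\<close>

primrec tval :: "rk_term \<Rightarrow> (nat \<Rightarrow> real) \<Rightarrow> real" where
  "tval Unit = (\<lambda>_. 1)"
| "tval (Mul t u) = (\<lambda>x. tval t x * tval u x)"
| "tval (IntF t) = (\<lambda>x. x (to_nat (IntF t)))"
| "tval (IntG t) = (\<lambda>x. x (to_nat (IntG t)))"

text \<open>A class closed under \<open>coord_deriv\<close>, so that smoothness of the test system
  needs no formula for iterated derivatives.\<close>

inductive coord_poly :: "((nat \<Rightarrow> real) \<Rightarrow> real) \<Rightarrow> bool" where
  const: "coord_poly (\<lambda>_. c)"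
| coord: "coord_poly (\<lambda>x. x k)"
| add: "coord_poly f \<Longrightarrow> coord_poly g \<Longrightarrow> coord_poly (\<lambda>x. f x + g x)"
| mult: "coord_poly f \<Longrightarrow> coord_poly g \<Longrightarrow> coord_poly (\<lambda>x. f x * g x)"

lemma coord_poly_tval: "coord_poly (tval t)"
  by (induction t) (auto intro: coord_poly.intros)

lemma coord_poly_has_deriv:
  assumes "coord_poly h"
  shows "\<exists>h'. coord_poly h' \<and> (\<forall>x. ((\<lambda>s. h (x(k := s))) has_real_derivative h' x) (at (x k)))"
  using assms
proof induction
  case (const c)
  show ?case by (rule exI[of _ "\<lambda>_. 0"]) (auto intro: coord_poly.intros)
next
  case (coord j)
  show ?case
    by (rule exI[of _ "\<lambda>_. if j = k then 1 else 0"]) (auto intro!: coord_poly.intros derivative_eq_intros)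
next
  case (add f g)
  then obtain f' g' where "coord_poly f'" "coord_poly g'"
    and d: "\<And>x. ((\<lambda>s. f (x(k := s))) has_real_derivative f' x) (at (x k))"
      "\<And>x. ((\<lambda>s. g (x(k := s))) has_real_derivative g' x) (at (x k))" by blast
  then show ?case
    by (intro exI[of _ "\<lambda>x. f' x + g' x"]) (simp add: coord_poly.intros DERIV_add del: fun_upd_apply)
next
  case (mult f g)
  then obtain f' g' where p: "coord_poly f'" "coord_poly g'"
    and d: "\<And>x. ((\<lambda>s. f (x(k := s))) has_real_derivative f' x) (at (x k))"
      "\<And>x. ((\<lambda>s. g (x(k := s))) has_real_derivative g' x) (at (x k))" by blast
  have "((\<lambda>s. f (x(k := s)) * g (x(k := s))) has_real_derivative f' x * g x + g' x * f x) (at (x k))" for x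
    using DERIV_mult[OF d(1)[of x] d(2)[of x]] by simp
  with p mult.hyps show ?case
    by (intro exI[of _ "\<lambda>x. f' x * g x + g' x * f x"]) (simp add: coord_poly.intros del: fun_upd_apply)
qed

lemma coord_poly_coord_deriv: "coord_poly h \<Longrightarrow> coord_poly (coord_deriv k h)"
proof -
  assume "coord_poly h"
  then obtain h' where h': "coord_poly h'"
    "\<And>x. ((\<lambda>s. h (x(k := s))) has_real_derivative h' x) (at (x k))"
    using coord_poly_has_deriv by blast
  have "coord_deriv k h = h'"
    unfolding coord_deriv_def by (intro ext DERIV_imp_deriv h'(2))
  with h' show ?thesis by simp
qed

lemma coord_poly_continuous: "coord_poly h \<Longrightarrow> continuous_map (subtopology (Euclidean_space m) D) euclideanreal h"
proof (induction rule: coord_poly.induct)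
  case (coord k)
  then show ?case unfolding Euclidean_space_def
    by (intro continuous_map_from_subtopology continuous_map_product_projection) auto
qed (auto intro: continuous_map_add continuous_map_real_mult)

lemma smooth_coord_poly:
  assumes "coord_poly h"
  shows "smooth_coord m D h"
proof -
  have p: "coord_poly (foldr coord_deriv ks h)" for ks
    using assms by (induction ks) (auto intro: coord_poly_coord_deriv)
  have "(\<lambda>s. foldr coord_deriv ks h (x(k := s))) differentiable at (x k)" for ks x k
    using coord_poly_has_deriv[OF p[of ks], of k] real_differentiable_def by blast
  with p show ?thesis unfolding smooth_coord_def by (auto intro: coord_poly_continuous)
qed

text \<open>Turns an asymptotic order into an algebraic identity: the error on the test system is a
  single monomial of too low a degree, so its coefficient must vanish.\<close>

lemma monomial_bigo_imp_zero:
  fixes c :: real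
  assumes "(\<lambda>\<tau>. c * \<tau> ^ n) \<in> O[at_right 0](\<lambda>\<tau>. \<tau> ^ N)" "n < N"
  shows "c = 0"
proof (rule ccontr)
  assume c: "c \<noteq> 0"
  from assms(1) obtain B where B: "eventually (\<lambda>\<tau>. norm (c * \<tau> ^ n) \<le> B * norm (\<tau> ^ N)) (at_right (0::real))"
    by (elim landau_o.bigE)
  have "((\<lambda>\<tau>. B * \<tau> ^ (N - n)) \<longlongrightarrow> B * 0 ^ (N - n)) (at_right (0::real))"
    by (intro tendsto_intros)
  hence "((\<lambda>\<tau>. B * \<tau> ^ (N - n)) \<longlongrightarrow> 0) (at_right (0::real))" using assms(2) by (simp add: power_0_left)
  moreover have "0 < \<bar>c\<bar>" using c by simp
  ultimately have ev: "eventually (\<lambda>\<tau>. B * \<tau> ^ (N - n) < \<bar>c\<bar>) (at_right (0::real))"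
    using order_tendstoD(2) by blast
  have "eventually (\<lambda>\<tau>. \<tau> > (0::real)) (at_right 0)" by (simp add: eventually_at_right_less)
  with B ev have "eventually (\<lambda>\<tau>::real. False) (at_right 0)"
  proof eventually_elim
    case (elim \<tau>)
    have "\<bar>c\<bar> * \<tau> ^ n \<le> (B * \<tau> ^ (N - n)) * \<tau> ^ n"
      using elim assms(2) by (simp add: abs_mult mult.assoc flip: power_add)
    moreover have "(B * \<tau> ^ (N - n)) * \<tau> ^ n < \<bar>c\<bar> * \<tau> ^ n"
      using elim by (intro mult_strict_right_mono) auto
    ultimately show ?case by simp
  qed
  thus False by simp
qed

text \<open>The test system contains the subterms of \<open>t\<close> that are integrals, and in
  addition \<open>IntF t\<close> and \<open>IntG t\<close>. These two extra coordinates make the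
  error of the update with \<open>cb\<close> and with \<open>cb'\<close>, applied to the weight of
  \<open>t\<close>, visible as a one-step error.\<close>

lemma order_conditions:
  assumes order: "imex_order M p" and n: "weight t < p"
  shows "(\<Sum>i=1..stages M. cb M i * wt M t i) = wt M t 0 / real (Suc (weight t))" (is ?F)
    and "(\<Sum>i=1..stages M. cb' M i * wt M t i) = wt M t 0 / real (Suc (weight t))" (is ?G)
proof -
  define X where "X = insert (IntF t) (insert (IntG t) (subterms t))"
  have finX: "finite X" unfolding X_def by (simp add: finite_subterms)
  have subX: "subterms u \<subseteq> X" if "u \<in> X" for u
    using that subterms_trans unfolding X_def by (auto simp: self_subterms)
  define m where "m = Suc (Max (to_nat ` X))"
  have codeX: "to_nat u < m" if "u \<in> X" for u
    unfolding m_def using that finX by (simp add: less_Suc_eq_le)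
  \<comment> \<open>\<open>Z 0\<close> is the exact solution and \<open>Z i\<close> the i-th stage,
    all starting from the origin; coordinates that code no integral in \<open>X\<close> stay
    0.\<close>
  define Z where "Z = (\<lambda>\<mu> (\<tau>::real) k. if k < m \<and> from_nat k \<in> X then
      (case from_nat k of IntF u \<Rightarrow> wt M (IntF u) \<mu> * \<tau> ^ Suc (weight u)
       | IntG u \<Rightarrow> wt M (IntG u) \<mu> * \<tau> ^ Suc (weight u) | _ \<Rightarrow> 0) else 0)"
  have tval_Z: "subterms u \<subseteq> X \<Longrightarrow> tval u (Z \<mu> \<tau>) = wt M u \<mu> * \<tau> ^ weight u" for u \<mu> \<tau>
    by (induction u) (use codeX in \<open>auto simp: Z_def power_add simp del: wt.simps(3,4)\<close>)
  define D where "D = topspace (Euclidean_space m)"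
  have D_iff: "x \<in> D \<longleftrightarrow> (\<forall>i\<ge>m. x i = 0)" for x
    unfolding D_def by (auto simp: topspace_Euclidean_space)
  \<comment> \<open>The splitting records which tableau performs an integration: \<open>f\<close>
    drives the coordinates \<open>IntF u\<close>, \<open>g\<close> drives the coordinates
    \<open>IntG u\<close>.\<close>
  define f where "f = (\<lambda>(x::nat \<Rightarrow> real) k. if from_nat k \<in> X then (case from_nat k of IntF u \<Rightarrow> tval u x | _ \<Rightarrow> 0) else 0)"
  define g where "g = (\<lambda>(x::nat \<Rightarrow> real) k. if from_nat k \<in> X then (case from_nat k of IntG u \<Rightarrow> tval u x | _ \<Rightarrow> 0) else 0)"
  have fp: "coord_poly (\<lambda>x. f x k)" for k
    unfolding f_def by (cases "from_nat k :: rk_term"; cases "from_nat k \<in> X") (simp_all add: coord_poly_tval coord_poly.const)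
  have gp: "coord_poly (\<lambda>x. g x k)" for k
    unfolding g_def by (cases "from_nat k :: rk_term"; cases "from_nat k \<in> X") (simp_all add: coord_poly_tval coord_poly.const)
  have c1: "openin (Euclidean_space m) D" by (simp add: D_def)
  have c2: "\<forall>k<m. smooth_coord m D (\<lambda>x. f x k) \<and> smooth_coord m D (\<lambda>x. g x k)"
    by (simp add: fp gp smooth_coord_poly)
  have ZD: "Z \<mu> \<tau> \<in> D" for \<mu> \<tau> unfolding D_iff by (simp add: Z_def)
  have subF: "subterms u \<subseteq> X" if "IntF u \<in> X \<or> IntG u \<in> X" for u
    using that subX by fastforce
  have c3: "((\<lambda>s. Z 0 s k) has_real_derivative f (Z 0 \<tau>) k + g (Z 0 \<tau>) k) (at \<tau> within {0..1})" if "k < m" for \<tau> k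
  proof (cases "from_nat k \<in> X")
    case True
    have "((\<lambda>s::real. c / real (Suc l) * s ^ Suc l) has_real_derivative c * \<tau> ^ l) (at \<tau> within {0..1})" for c l
      by (rule derivative_eq_intros refl)+ (simp add: field_simps)
    with True that subF show ?thesis
      by (cases "from_nat k :: rk_term") (auto simp: Z_def f_def g_def tval_Z[unfolded Z_def] simp del: power_Suc of_nat_Suc)
  next
    case False
    thus ?thesis by (simp add: Z_def f_def g_def)
  qed
  have z0: "Z 0 0 k = 0" for k unfolding Z_def by (auto split: rk_term.splits)
  have c4: "Z i \<tau> k = Z 0 0 k + \<tau> * (\<Sum>j=1..i. cA M i j * f (Z j \<tau>) k) + \<tau> * (\<Sum>j=1..<i. cA' M i j * g (Z j \<tau>) k)"
    if "k < m" "i \<ge> 1" for k i \<tau>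
  proof (cases "from_nat k \<in> X")
    case True
    with that subF show ?thesis unfolding z0
      by (cases "from_nat k :: rk_term")
        (auto simp: Z_def f_def g_def tval_Z[unfolded Z_def] sum_distrib_left sum_distrib_right algebra_simps)
  next
    case False
    thus ?thesis by (simp add: Z_def f_def g_def)
  qed
  have c5: "((\<lambda>\<tau>. Z i \<tau> k) \<longlongrightarrow> Z 0 0 k) (at_right 0)" for i k
  proof -
    have "isCont (\<lambda>\<tau>. Z i \<tau> k) 0"
      unfolding Z_def by (cases "k < m \<and> from_nat k \<in> X"; cases "from_nat k :: rk_term") (auto intro!: continuous_intros)
    moreover have "Z i 0 k = 0" unfolding Z_def by (auto split: rk_term.splits)
    ultimately have "((\<lambda>\<tau>. Z i \<tau> k) \<longlongrightarrow> 0) (at 0)" by (simp add: isCont_def)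
    thus ?thesis unfolding z0 by (rule filterlim_mono) (auto simp: at_le)
  qed
  \<comment> \<open>The formulas hold for every step size, so the initial time 0, the final time 1
    and the bound 1 on the step are arbitrary choices.\<close>
  have main: "\<forall>k<m. (\<lambda>\<tau>. Z 0 (0 + \<tau>) k -
       (Z 0 0 k + \<tau> * (\<Sum>i=1..stages M. cb M i * f (Z i \<tau>) k + cb' M i * g (Z i \<tau>) k)))
       \<in> O[at_right 0](\<lambda>\<tau>. \<tau> ^ (p + 1))"
    by (rule order[unfolded imex_order_def, THEN spec[of _ m], THEN spec[of _ D], THEN spec[of _ f],
        THEN spec[of _ g], THEN spec[of _ 0], THEN spec[of _ 1], THEN spec[of _ "Z 0"],
        THEN spec[of _ 1], THEN spec[of _ "\<lambda>\<tau> i. Z i \<tau>"], THEN mp], intro conjI ballI allI impI)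
      (rule c1 | erule c2[rule_format, THEN conjunct1] c2[rule_format, THEN conjunct2] c3 | rule c5 ZD zero_less_one | rule c4; simp)+
  have tX: "IntF t \<in> X" "IntG t \<in> X" by (auto simp: X_def)
  have st: "subterms t \<subseteq> X" by (auto simp: X_def)
  let ?n = "weight t"
  have "(\<lambda>\<tau>. (wt M t 0 / real (Suc ?n) - (\<Sum>i=1..stages M. cb M i * wt M t i)) * \<tau> ^ Suc ?n)
      \<in> O[at_right 0](\<lambda>\<tau>. \<tau> ^ (p + 1))"
  proof -
    have "(\<lambda>\<tau>. Z 0 (0 + \<tau>) (to_nat (IntF t)) - (Z 0 0 (to_nat (IntF t)) + \<tau> *
          (\<Sum>i=1..stages M. cb M i * f (Z i \<tau>) (to_nat (IntF t)) + cb' M i * g (Z i \<tau>) (to_nat (IntF t)))))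
       = (\<lambda>\<tau>. (wt M t 0 / real (Suc ?n) - (\<Sum>i=1..stages M. cb M i * wt M t i)) * \<tau> ^ Suc ?n)"
      unfolding z0 f_def g_def using tX codeX
      by (auto simp: tval_Z[OF st] sum_distrib_left sum_distrib_right algebra_simps fun_eq_iff)
         (simp add: Z_def)
    with main[rule_format, OF codeX[OF tX(1)]] show ?thesis by simp
  qed
  from monomial_bigo_imp_zero[OF this] n show ?F by simp
  have "(\<lambda>\<tau>. (wt M t 0 / real (Suc ?n) - (\<Sum>i=1..stages M. cb' M i * wt M t i)) * \<tau> ^ Suc ?n)
      \<in> O[at_right 0](\<lambda>\<tau>. \<tau> ^ (p + 1))"
  proof -
    have "(\<lambda>\<tau>. Z 0 (0 + \<tau>) (to_nat (IntG t)) - (Z 0 0 (to_nat (IntG t)) + \<tau> *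
          (\<Sum>i=1..stages M. cb M i * f (Z i \<tau>) (to_nat (IntG t)) + cb' M i * g (Z i \<tau>) (to_nat (IntG t)))))
       = (\<lambda>\<tau>. (wt M t 0 / real (Suc ?n) - (\<Sum>i=1..stages M. cb' M i * wt M t i)) * \<tau> ^ Suc ?n)"
      unfolding z0 f_def g_def using tX codeX
      by (auto simp: tval_Z[OF st] sum_distrib_left sum_distrib_right algebra_simps fun_eq_iff)
         (simp add: Z_def)
    with main[rule_format, OF codeX[OF tX(2)]] show ?thesis by simp
  qed
  from monomial_bigo_imp_zero[OF this] n show ?G by simp
qed

section \<open>Uniform expansions in the step size\<close>

lemma wt_weight_0: "weight t = 0 \<Longrightarrow> wt M t \<mu> = 1"
  by (induction t) auto

locale expansion =
  fixes M :: imex and a b :: "'a::euclidean_space"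
begin

abbreviation K :: "'a set" where "K \<equiv> cbox a b"

text \<open>The span of the weights of order \<open>n\<close> is described by its annihilator, which makes its stability
  under integration with respect to a parameter immediate.\<close>

definition annih :: "nat \<Rightarrow> (nat \<Rightarrow> real) \<Rightarrow> bool" where
  "annih n l \<longleftrightarrow> (\<forall>t. weight t = n \<longrightarrow> (\<Sum>\<mu>\<le>stages M. l \<mu> * wt M t \<mu>) = 0)"

definition wt_span :: "nat \<Rightarrow> (nat \<Rightarrow> real) \<Rightarrow> bool" where
  "wt_span n \<xi> \<longleftrightarrow> (\<forall>l. annih n l \<longrightarrow> (\<Sum>\<mu>\<le>stages M. l \<mu> * \<xi> \<mu>) = 0)"

lemma wt_span_zero: "wt_span n (\<lambda>_. 0)"
  by (simp add: wt_span_def)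

lemma wt_span_add: "wt_span n \<xi> \<Longrightarrow> wt_span n \<eta> \<Longrightarrow> wt_span n (\<lambda>\<mu>. \<xi> \<mu> + \<eta> \<mu>)"
  by (simp add: wt_span_def distrib_left sum.distrib)

lemma wt_span_const: "wt_span 0 (\<lambda>_. c)"
  unfolding wt_span_def
proof (intro allI impI)
  fix l assume "annih 0 l"
  hence "(\<Sum>\<mu>\<le>stages M. l \<mu> * wt M Unit \<mu>) = 0"
    unfolding annih_def by (metis weight.simps(1))
  thus "(\<Sum>\<mu>\<le>stages M. l \<mu> * c) = 0" by (simp flip: sum_distrib_right)
qed

text \<open>All weights of order 0 equal 1, so the difference of two evaluations annihilates them.
  Hence the exact solution and all stages share their leading coefficient.\<close>

lemma wt_span_0_const:
  assumes "wt_span 0 \<xi>" "\<mu> \<le> stages M"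
  shows "\<xi> \<mu> = \<xi> 0"
proof -
  define l where "l = (\<lambda>j. (if j = \<mu> then 1 else 0) - (if j = 0 then 1 else (0::real)))"
  have *: "(\<Sum>j\<le>stages M. l j * x j) = x \<mu> - x 0" for x
    using assms(2) by (simp add: l_def left_diff_distrib sum_subtractf if_distrib[of "\<lambda>c. c * _"] cong: if_cong)
  have "annih 0 l" unfolding annih_def * by (simp add: wt_weight_0)
  with assms(1) have "(\<Sum>j\<le>stages M. l j * \<xi> j) = 0" by (simp add: wt_span_def)
  thus ?thesis by (simp add: *)
qed

text \<open>The factors are replaced one at a time. If \<open>l\<close> annihilates the weights of
  order \<open>m + n\<close>, then \<open>l\<close> times a weight of order \<open>m\<close>
  annihilates order \<open>n\<close> by \<open>Mul\<close>, and therefore also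
  \<open>\<eta>\<close>; this says that \<open>l\<close> times \<open>\<eta>\<close> annihilates
  order \<open>m\<close>, and therefore also \<open>\<xi>\<close>.\<close>

lemma wt_span_mult:
  assumes "wt_span m \<xi>" "wt_span n \<eta>"
  shows "wt_span (m + n) (\<lambda>\<mu>. \<xi> \<mu> * \<eta> \<mu>)"
  unfolding wt_span_def
proof (intro allI impI)
  fix l assume l: "annih (m + n) l"
  have "annih n (\<lambda>\<mu>. l \<mu> * wt M t \<mu>)" if "weight t = m" for t
    unfolding annih_def
  proof (intro allI impI)
    fix u assume "weight u = n"
    with l that have "(\<Sum>\<mu>\<le>stages M. l \<mu> * wt M (Mul t u) \<mu>) = 0"
      unfolding annih_def by (metis weight.simps(2))
    thus "(\<Sum>\<mu>\<le>stages M. l \<mu> * wt M t \<mu> * wt M u \<mu>) = 0" by (simp add: mult.assoc)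
  qed
  hence "annih m (\<lambda>\<mu>. l \<mu> * \<eta> \<mu>)"
    unfolding annih_def[of m]
  proof (intro allI impI)
    fix t assume "weight t = m"
    assume "\<And>t. weight t = m \<Longrightarrow> annih n (\<lambda>\<mu>. l \<mu> * wt M t \<mu>)"
    with assms(2) \<open>weight t = m\<close> have "(\<Sum>\<mu>\<le>stages M. l \<mu> * wt M t \<mu> * \<eta> \<mu>) = 0" unfolding wt_span_def by blast
    thus "(\<Sum>\<mu>\<le>stages M. l \<mu> * \<eta> \<mu> * wt M t \<mu>) = 0" by (simp add: mult_ac)
  qed
  thus "(\<Sum>\<mu>\<le>stages M. l \<mu> * (\<xi> \<mu> * \<eta> \<mu>)) = 0"
    using assms(1)[unfolded wt_span_def, THEN spec[of _ "\<lambda>\<mu>. l \<mu> * \<eta> \<mu>"]] by (simp add: mult_ac)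
qed

text \<open>By transposition: if the matrix \<open>c\<close> sends weight vectors of order
  \<open>n\<close> to weight vectors of order \<open>m\<close>, then a functional annihilating order
  \<open>m\<close>, pulled back along \<open>c\<close>, annihilates order \<open>n\<close>.\<close>

lemma wt_span_linear:
  assumes "wt_span n \<xi>"
    and "\<And>t. weight t = n \<Longrightarrow> \<exists>t'. weight t' = m \<and> (\<forall>\<mu>\<le>stages M. wt M t' \<mu> = (\<Sum>j\<le>stages M. c \<mu> j * wt M t j))"
  shows "wt_span m (\<lambda>\<mu>. \<Sum>j\<le>stages M. c \<mu> j * \<xi> j)"
  unfolding wt_span_def
proof (intro allI impI)
  fix l assume l: "annih m l"
  define l' where "l' j = (\<Sum>\<mu>\<le>stages M. l \<mu> * c \<mu> j)" for j
  have *: "(\<Sum>\<mu>\<le>stages M. l \<mu> * (\<Sum>j\<le>stages M. c \<mu> j * x j)) = (\<Sum>j\<le>stages M. l' j * x j)" for x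
    unfolding l'_def sum_distrib_left sum_distrib_right by (subst sum.swap) (simp add: mult.assoc)
  have "annih n l'"
    unfolding annih_def
  proof (intro allI impI)
    fix t assume "weight t = n"
    with assms(2) obtain t' where t': "weight t' = m"
      "\<forall>\<mu>\<le>stages M. wt M t' \<mu> = (\<Sum>j\<le>stages M. c \<mu> j * wt M t j)" by blast
    with l have "(\<Sum>\<mu>\<le>stages M. l \<mu> * wt M t' \<mu>) = 0" unfolding annih_def by blast
    with t'(2) show "(\<Sum>\<mu>\<le>stages M. l' \<mu> * wt M t \<mu>) = 0" by (simp flip: *)
  qed
  with assms(1) show "(\<Sum>\<mu>\<le>stages M. l \<mu> * (\<Sum>j\<le>stages M. c \<mu> j * \<xi> j)) = 0"
    unfolding * wt_span_def by blast
qed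

lemma wt_span_cong: "(\<And>\<mu>. \<mu> \<le> stages M \<Longrightarrow> \<xi> \<mu> = \<eta> \<mu>) \<Longrightarrow> wt_span n \<xi> \<longleftrightarrow> wt_span n \<eta>"
  unfolding wt_span_def by simp

text \<open>A row of the matrix of one integration. Row 0 integrates a monomial of degree
  \<open>n\<close> exactly, whence \<open>1 / (n + 1)\<close>; the other rows are those of a
  tableau, cut off to \<open>J\<close>.\<close>

definition step_row :: "(nat \<Rightarrow> real) \<Rightarrow> nat set \<Rightarrow> nat \<Rightarrow> nat \<Rightarrow> nat \<Rightarrow> real" where
  "step_row c J n \<mu> j = (if \<mu> = 0 then if j = 0 then 1 / real (Suc n) else 0 else if j \<in> J then c j else 0)"

lemma sum_step_row:
  assumes "\<mu> \<le> stages M" "J \<subseteq> {1..\<mu>}"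
  shows "(\<Sum>j\<le>stages M. step_row c J n \<mu> j * x j) = (if \<mu> = 0 then x 0 / real (Suc n) else (\<Sum>j\<in>J. c j * x j))"
proof (cases "\<mu> = 0")
  case True
  then show ?thesis by (simp add: step_row_def if_distrib[of "\<lambda>c. c * _"] cong: if_cong)
next
  case False
  have "{..stages M} \<inter> J = J" using assms by auto
  with False show ?thesis
    by (simp add: step_row_def if_distrib[of "\<lambda>c. c * _"] sum.inter_restrict[symmetric] cong: if_cong)
qed

lemma wt_span_step:
  assumes "wt_span n \<xi>" "wt_span n \<eta>"
  shows "wt_span (Suc n) (\<lambda>\<mu>. if \<mu> = 0 then (\<xi> 0 + \<eta> 0) / real (Suc n)
     else (\<Sum>j=1..\<mu>. cA M \<mu> j * \<xi> j) + (\<Sum>j=1..<\<mu>. cA' M \<mu> j * \<eta> j))" (is "wt_span _ ?\<zeta>")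
proof -
  have F: "wt_span (Suc n) (\<lambda>\<mu>. \<Sum>j\<le>stages M. step_row (cA M \<mu>) {1..\<mu>} n \<mu> j * \<xi> j)"
  proof (rule wt_span_linear[OF assms(1)])
    fix t assume "weight t = n"
    thus "\<exists>t'. weight t' = Suc n \<and> (\<forall>\<mu>\<le>stages M. wt M t' \<mu> = (\<Sum>j\<le>stages M. step_row (cA M \<mu>) {1..\<mu>} n \<mu> j * wt M t j))"
      by (intro exI[of _ "IntF t"]) (auto simp: sum_step_row)
  qed
  have G: "wt_span (Suc n) (\<lambda>\<mu>. \<Sum>j\<le>stages M. step_row (cA' M \<mu>) {1..<\<mu>} n \<mu> j * \<eta> j)"
  proof (rule wt_span_linear[OF assms(2)])
    fix t assume "weight t = n"
    thus "\<exists>t'. weight t' = Suc n \<and> (\<forall>\<mu>\<le>stages M. wt M t' \<mu> = (\<Sum>j\<le>stages M. step_row (cA' M \<mu>) {1..<\<mu>} n \<mu> j * wt M t j))"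
      by (intro exI[of _ "IntG t"]) (auto simp: sum_step_row subset_iff)
  qed
  have "wt_span (Suc n) ?\<zeta> \<longleftrightarrow> wt_span (Suc n) (\<lambda>\<mu>. (\<Sum>j\<le>stages M. step_row (cA M \<mu>) {1..\<mu>} n \<mu> j * \<xi> j)
     + (\<Sum>j\<le>stages M. step_row (cA' M \<mu>) {1..<\<mu>} n \<mu> j * \<eta> j))"
    by (rule wt_span_cong) (auto simp: sum_step_row subset_iff add_divide_distrib)
  with wt_span_add[OF F G] show ?thesis by simp
qed

text \<open>An order condition says that a certain functional, with the value
  \<open>- 1 / (n + 1)\<close> at index 0, annihilates the weights of order \<open>n\<close>. It
  therefore holds for every vector in their span, whether or not this vector is itself a
  weight.\<close>

lemma wt_span_final:
  assumes "imex_order M p" "n < p" "wt_span n \<xi>"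
  shows "(\<Sum>i=1..stages M. cb M i * \<xi> i) = \<xi> 0 / real (Suc n)"
    and "(\<Sum>i=1..stages M. cb' M i * \<xi> i) = \<xi> 0 / real (Suc n)"
proof -
  have *: "(\<Sum>\<mu>\<le>stages M. (if \<mu> = 0 then - 1 / real (Suc n) else c \<mu>) * x \<mu>) =
    (\<Sum>i=1..stages M. c i * x i) - x 0 / real (Suc n)" for c x
  proof -
    have "{..stages M} = insert 0 {1..stages M}" by auto
    thus ?thesis by (simp del: of_nat_Suc)
  qed
  have "annih n (\<lambda>\<mu>. if \<mu> = 0 then - 1 / real (Suc n) else cb M \<mu>)"
    using order_conditions(1)[OF assms(1)] assms(2) unfolding annih_def * by auto
  with assms(3) show "(\<Sum>i=1..stages M. cb M i * \<xi> i) = \<xi> 0 / real (Suc n)"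
    unfolding wt_span_def using * by force
  have "annih n (\<lambda>\<mu>. if \<mu> = 0 then - 1 / real (Suc n) else cb' M \<mu>)"
    using order_conditions(2)[OF assms(1)] assms(2) unfolding annih_def * by auto
  with assms(3) show "(\<Sum>i=1..stages M. cb' M i * \<xi> i) = \<xi> 0 / real (Suc n)"
    unfolding wt_span_def using * by force
qed

lemma wt_span_integral:
  assumes "\<And>x. x \<in> K \<Longrightarrow> wt_span n (\<lambda>\<mu>. C \<mu> x)" "\<And>\<mu>. \<mu> \<le> stages M \<Longrightarrow> continuous_on K (C \<mu>)"
  shows "wt_span n (\<lambda>\<mu>. integral K (C \<mu>))"
  unfolding wt_span_def
proof (intro allI impI)
  fix l assume l: "annih n l"
  have "(\<Sum>\<mu>\<le>stages M. l \<mu> * integral K (C \<mu>)) = integral K (\<lambda>x. \<Sum>\<mu>\<le>stages M. l \<mu> * C \<mu> x)"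
    using assms(2) by (subst integral_sum) (auto intro!: integrable_continuous continuous_intros)
  also have "\<dots> = integral K (\<lambda>x. 0)"
    using assms(1) l unfolding wt_span_def by (intro integral_cong) blast
  finally show "(\<Sum>\<mu>\<le>stages M. l \<mu> * integral K (C \<mu>)) = 0" by simp
qed

text \<open>The bound is uniform on the box. Scalars are regarded as functions constant in
  \<open>x\<close>, so that one calculus serves both \<open>u\<close> and \<open>r\<close>.\<close>

definition bigO :: "nat \<Rightarrow> (real \<Rightarrow> 'a \<Rightarrow> real) \<Rightarrow> bool" where
  "bigO q g \<longleftrightarrow> (\<exists>B. \<forall>\<^sub>F \<tau> in at_right 0. \<forall>x\<in>K. \<bar>g \<tau> x\<bar> \<le> B * \<tau> ^ q)"

lemma eventually_tau: "\<forall>\<^sub>F \<tau> in at_right (0::real). 0 < \<tau> \<and> \<tau> < 1"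
  using eventually_at_right_real[of 0 1] by simp

lemma ObdE:
  assumes "bigO q g"
  obtains B where "B \<ge> 0" "\<forall>\<^sub>F \<tau> in at_right 0. \<forall>x\<in>K. \<bar>g \<tau> x\<bar> \<le> B * \<tau> ^ q"
proof -
  from assms obtain B where B: "\<forall>\<^sub>F \<tau> in at_right 0. \<forall>x\<in>K. \<bar>g \<tau> x\<bar> \<le> B * \<tau> ^ q"
    unfolding bigO_def by blast
  show ?thesis
  proof (rule that[of "\<bar>B\<bar>"])
    show "\<forall>\<^sub>F \<tau> in at_right 0. \<forall>x\<in>K. \<bar>g \<tau> x\<bar> \<le> \<bar>B\<bar> * \<tau> ^ q"
      using B eventually_tau
    proof eventually_elim
      case (elim \<tau>)
      have "B * \<tau> ^ q \<le> \<bar>B\<bar> * \<tau> ^ q" using elim by (intro mult_right_mono) auto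
      with elim show ?case by (meson order_trans)
    qed
  qed simp
qed

lemma bigO_cong:
  assumes "\<forall>\<^sub>F \<tau> in at_right 0. \<forall>x\<in>K. g \<tau> x = h \<tau> x"
  shows "bigO q g \<longleftrightarrow> bigO q h"
proof -
  have "bigO q g" if "bigO q h" "\<forall>\<^sub>F \<tau> in at_right 0. \<forall>x\<in>K. g \<tau> x = h \<tau> x" for g h
  proof -
    from that(1) obtain B where B: "\<forall>\<^sub>F \<tau> in at_right 0. \<forall>x\<in>K. \<bar>h \<tau> x\<bar> \<le> B * \<tau> ^ q"
      unfolding bigO_def by blast
    from B that(2) have "\<forall>\<^sub>F \<tau> in at_right 0. \<forall>x\<in>K. \<bar>g \<tau> x\<bar> \<le> B * \<tau> ^ q"
      by eventually_elim auto
    thus ?thesis unfolding bigO_def by blast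
  qed
  from this[of h g] this[of g h] assms show ?thesis by (auto simp: eq_commute)
qed

lemma bigO_zero: "bigO q (\<lambda>_ _. 0)"
  unfolding bigO_def by (rule exI[of _ 0]) simp

lemma bigO_add:
  assumes "bigO q g" "bigO q h"
  shows "bigO q (\<lambda>\<tau> x. g \<tau> x + h \<tau> x)"
proof -
  from assms obtain B C where
    "\<forall>\<^sub>F \<tau> in at_right 0. \<forall>x\<in>K. \<bar>g \<tau> x\<bar> \<le> B * \<tau> ^ q"
    "\<forall>\<^sub>F \<tau> in at_right 0. \<forall>x\<in>K. \<bar>h \<tau> x\<bar> \<le> C * \<tau> ^ q" unfolding bigO_def by blast
  hence "\<forall>\<^sub>F \<tau> in at_right 0. \<forall>x\<in>K. \<bar>g \<tau> x + h \<tau> x\<bar> \<le> (B + C) * \<tau> ^ q"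
    by eventually_elim (force simp: distrib_right intro: order_trans[OF abs_triangle_ineq add_mono])
  thus ?thesis unfolding bigO_def by blast
qed

lemma bigO_mult:
  assumes "bigO q g" "bigO r h"
  shows "bigO (q + r) (\<lambda>\<tau> x. g \<tau> x * h \<tau> x)"
proof -
  from ObdE[OF assms(1)] obtain B where B: "B \<ge> 0" "\<forall>\<^sub>F \<tau> in at_right 0. \<forall>x\<in>K. \<bar>g \<tau> x\<bar> \<le> B * \<tau> ^ q" .
  from assms(2) obtain C where C: "\<forall>\<^sub>F \<tau> in at_right 0. \<forall>x\<in>K. \<bar>h \<tau> x\<bar> \<le> C * \<tau> ^ r" unfolding bigO_def by blast
  from B(2) C eventually_tau have "\<forall>\<^sub>F \<tau> in at_right 0. \<forall>x\<in>K. \<bar>g \<tau> x * h \<tau> x\<bar> \<le> (B * C) * \<tau> ^ (q + r)"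
  proof eventually_elim
    case (elim \<tau>)
    have "\<bar>g \<tau> x * h \<tau> x\<bar> \<le> (B * \<tau> ^ q) * (C * \<tau> ^ r)" if "x \<in> K" for x
      unfolding abs_mult using elim that B(1) by (intro mult_mono) auto
    thus ?case by (simp add: power_add mult_ac)
  qed
  thus ?thesis unfolding bigO_def by blast
qed

lemma bigO_power: "bigO q (\<lambda>\<tau> x. \<tau> ^ q)"
  unfolding bigO_def using eventually_tau by (intro exI[of _ 1]) (auto elim!: eventually_mono)

lemma bigO_mono:
  assumes "bigO q g" "r \<le> q"
  shows "bigO r g"
proof -
  from ObdE[OF assms(1)] obtain B where B: "B \<ge> 0" "\<forall>\<^sub>F \<tau> in at_right 0. \<forall>x\<in>K. \<bar>g \<tau> x\<bar> \<le> B * \<tau> ^ q" .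
  from B(2) eventually_tau have "\<forall>\<^sub>F \<tau> in at_right 0. \<forall>x\<in>K. \<bar>g \<tau> x\<bar> \<le> B * \<tau> ^ r"
  proof eventually_elim
    case (elim \<tau>)
    have "B * \<tau> ^ q \<le> B * \<tau> ^ r" using elim B(1) assms(2) by (intro mult_left_mono power_decreasing) auto
    with elim show ?case by force
  qed
  thus ?thesis unfolding bigO_def by blast
qed

lemma bigO_continuous:
  assumes "continuous_on K c"
  shows "bigO 0 (\<lambda>_. c)"
proof -
  have "compact (c ` K)" using assms by (intro compact_continuous_image compact_cbox)
  then obtain B where "\<forall>x\<in>c ` K. norm x \<le> B" using compact_imp_bounded bounded_iff by metis
  thus ?thesis unfolding bigO_def by (intro exI[of _ B]) (auto simp: always_eventually)
qed

lemma bigO_const: "bigO 0 (\<lambda>_ _. c)"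
  by (rule bigO_continuous) simp

lemma bigO_cmult: "bigO q g \<Longrightarrow> bigO q (\<lambda>\<tau> x. c * g \<tau> x)"
  using bigO_mult[OF bigO_const] by simp

lemma bigO_diff: "bigO q g \<Longrightarrow> bigO q h \<Longrightarrow> bigO q (\<lambda>\<tau> x. g \<tau> x - h \<tau> x)"
  using bigO_add[of q g "\<lambda>\<tau> x. - 1 * h \<tau> x"] bigO_cmult[of q h "-1"] by simp

lemma bigO_sum: "(\<And>i. i \<in> I \<Longrightarrow> bigO q (g i)) \<Longrightarrow> bigO q (\<lambda>\<tau> x. \<Sum>i\<in>I. g i \<tau> x)"
  by (induction I rule: infinite_finite_induct) (auto intro: bigO_zero bigO_add)

text \<open>A non-integrable function has integral 0 and satisfies the bound trivially, which spares
  \<open>bigO_integral\<close> a premise on integrability.\<close>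

lemma integral_abs_bound:
  fixes g :: "'a \<Rightarrow> real"
  assumes "\<And>x. x \<in> K \<Longrightarrow> \<bar>g x\<bar> \<le> B" "B \<ge> 0"
  shows "\<bar>integral K g\<bar> \<le> B * measure lborel K"
proof (cases "g integrable_on K")
  case True
  thus ?thesis using has_integral_bound[OF assms(2) integrable_integral[OF True]] assms(1) by simp
next
  case False
  thus ?thesis using assms(2) by (simp add: not_integrable_integral)
qed

lemma bigO_integral:
  assumes "bigO q g"
  shows "bigO q (\<lambda>\<tau> _. integral K (g \<tau>))"
proof -
  from ObdE[OF assms(1)] obtain B where B: "B \<ge> 0" "\<forall>\<^sub>F \<tau> in at_right 0. \<forall>x\<in>K. \<bar>g \<tau> x\<bar> \<le> B * \<tau> ^ q" .
  from B(2) eventually_tau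
  have "\<forall>\<^sub>F \<tau> in at_right 0. \<forall>x\<in>K. \<bar>integral K (g \<tau>)\<bar> \<le> (B * measure lborel K) * \<tau> ^ q"
  proof eventually_elim
    case (elim \<tau>)
    thus ?case using integral_abs_bound[of "g \<tau>" "B * \<tau> ^ q"] B(1) by (auto simp: mult_ac)
  qed
  thus ?thesis unfolding bigO_def by blast
qed

text \<open>\<open>w \<mu> \<tau> x\<close> has an expansion in powers of \<open>\<tau>\<close> whose \<open>n\<close>-th coefficients, as a vector indexed by \<open>\<mu>\<close>,
  satisfy all linear relations valid for the weights of the terms of order \<open>n\<close>.\<close>

definition coeffs :: "nat \<Rightarrow> (nat \<Rightarrow> real \<Rightarrow> 'a \<Rightarrow> real) \<Rightarrow> (nat \<Rightarrow> nat \<Rightarrow> 'a \<Rightarrow> real) \<Rightarrow> bool" where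
  "coeffs q w C \<longleftrightarrow> (\<forall>n. \<forall>x\<in>K. wt_span n (\<lambda>\<mu>. C n \<mu> x)) \<and>
     (\<forall>n. \<forall>\<mu>\<le>stages M. continuous_on K (C n \<mu>)) \<and>
     (\<forall>\<mu>\<le>stages M. bigO q (\<lambda>\<tau> x. w \<mu> \<tau> x - (\<Sum>n<q. \<tau> ^ n * C n \<mu> x)))"

definition expands :: "nat \<Rightarrow> (nat \<Rightarrow> real \<Rightarrow> 'a \<Rightarrow> real) \<Rightarrow> bool" where
  "expands q w \<longleftrightarrow> (\<exists>C. coeffs q w C)"

lemma coeffsD:
  assumes "coeffs q w C"
  shows "x \<in> K \<Longrightarrow> wt_span n (\<lambda>\<mu>. C n \<mu> x)"
    and "\<mu> \<le> stages M \<Longrightarrow> continuous_on K (C n \<mu>)"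
    and "\<mu> \<le> stages M \<Longrightarrow> bigO q (\<lambda>\<tau> x. w \<mu> \<tau> x - (\<Sum>n<q. \<tau> ^ n * C n \<mu> x))"
  using assms unfolding coeffs_def by blast+

lemma expands_cong:
  assumes "\<And>\<mu>. \<mu> \<le> stages M \<Longrightarrow> \<forall>\<^sub>F \<tau> in at_right 0. \<forall>x\<in>K. v \<mu> \<tau> x = w \<mu> \<tau> x" "expands q v"
  shows "expands q w"
proof -
  obtain C where "coeffs q v C" using assms(2) unfolding expands_def by blast
  note C = coeffsD[OF this]
  have "bigO q (\<lambda>\<tau> x. w \<mu> \<tau> x - (\<Sum>n<q. \<tau> ^ n * C n \<mu> x))" if "\<mu> \<le> stages M" for \<mu>
  proof -
    have "\<forall>\<^sub>F \<tau> in at_right 0. \<forall>x\<in>K. v \<mu> \<tau> x - (\<Sum>n<q. \<tau> ^ n * C n \<mu> x) = w \<mu> \<tau> x - (\<Sum>n<q. \<tau> ^ n * C n \<mu> x)"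
      using assms(1)[OF that] by eventually_elim simp
    from bigO_cong[OF this] C(3)[OF that] show ?thesis by simp
  qed
  with C(1,2) show ?thesis unfolding expands_def coeffs_def by blast
qed

lemma expands_bigO: "(\<And>\<mu>. \<mu> \<le> stages M \<Longrightarrow> bigO q (w \<mu>)) \<Longrightarrow> expands q w"
  unfolding expands_def coeffs_def by (rule exI[of _ "\<lambda>_ _ _. 0"]) (auto intro: wt_span_zero)

lemma expands_add:
  assumes "expands q v" "expands q w"
  shows "expands q (\<lambda>\<mu> \<tau> x. v \<mu> \<tau> x + w \<mu> \<tau> x)"
proof -
  obtain C where "coeffs q v C" using assms(1) unfolding expands_def by blast
  note C = coeffsD[OF this]
  obtain D where "coeffs q w D" using assms(2) unfolding expands_def by blast
  note D = coeffsD[OF this]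
  have "bigO q (\<lambda>\<tau> x. v \<mu> \<tau> x + w \<mu> \<tau> x - (\<Sum>n<q. \<tau> ^ n * (C n \<mu> x + D n \<mu> x)))" if "\<mu> \<le> stages M" for \<mu>
    using bigO_add[OF C(3)[OF that] D(3)[OF that]]
    by (simp add: distrib_left sum.distrib algebra_simps)
  thus ?thesis unfolding expands_def coeffs_def using C D
    by (intro exI[of _ "\<lambda>n \<mu> x. C n \<mu> x + D n \<mu> x"]) (auto intro: wt_span_add continuous_intros)
qed

lemma expands_sum: "(\<And>i. i \<in> I \<Longrightarrow> expands q (w i)) \<Longrightarrow> expands q (\<lambda>\<mu> \<tau> x. \<Sum>i\<in>I. w i \<mu> \<tau> x)"
  by (induction I rule: infinite_finite_induct) (auto intro: expands_add expands_bigO bigO_zero)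

text \<open>A monomial of degree at least \<open>q\<close> is absorbed by the remainder, so that
  products of truncated expansions need no sorting by degree.\<close>

lemma expands_monom:
  assumes "\<And>x. x \<in> K \<Longrightarrow> wt_span n (\<lambda>\<mu>. C \<mu> x)" "\<And>\<mu>. \<mu> \<le> stages M \<Longrightarrow> continuous_on K (C \<mu>)"
  shows "expands q (\<lambda>\<mu> \<tau> x. \<tau> ^ n * C \<mu> x)"
proof (cases "n < q")
  case True
  have "(\<Sum>m<q. \<tau> ^ m * (if m = n then C else (\<lambda>_ _. 0)) \<mu> x) = \<tau> ^ n * C \<mu> x" for \<mu> \<tau> x
    using True by (simp add: if_distrib[of "\<lambda>c. _ * c _ _"] cong: if_cong)
  thus ?thesis unfolding expands_def coeffs_def
    by (intro exI[of _ "\<lambda>m. if m = n then C else (\<lambda>_ _. 0)"]) (use assms in \<open>auto intro!: wt_span_zero bigO_zero\<close>)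
next
  case False
  have "bigO q (\<lambda>\<tau> x. \<tau> ^ n * C \<mu> x)" if "\<mu> \<le> stages M" for \<mu>
    using bigO_mono[OF bigO_mult[OF bigO_power bigO_continuous[OF assms(2)[OF that]]], of q n] False by simp
  thus ?thesis by (rule expands_bigO)
qed

lemma expands_const_fun:
  assumes "continuous_on K c"
  shows "expands q (\<lambda>\<mu> \<tau>. c)"
  using expands_monom[of 0 "\<lambda>_. c" q] assms by (simp add: wt_span_const)

lemma expands_poly_part:
  assumes "\<And>n x. x \<in> K \<Longrightarrow> wt_span n (\<lambda>\<mu>. C n \<mu> x)"
    "\<And>n \<mu>. \<mu> \<le> stages M \<Longrightarrow> continuous_on K (C n \<mu>)"
  shows "expands q (\<lambda>\<mu> \<tau> x. \<Sum>n<r. \<tau> ^ n * C n \<mu> x)"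
  using assms by (intro expands_sum expands_monom) auto

lemma expands_mono:
  assumes "expands q w" "r \<le> q"
  shows "expands r w"
proof -
  obtain C where "coeffs q w C" using assms(1) unfolding expands_def by blast
  note C = coeffsD[OF this]
  have "expands r (\<lambda>\<mu> \<tau> x. (w \<mu> \<tau> x - (\<Sum>n<q. \<tau> ^ n * C n \<mu> x)) + (\<Sum>n<q. \<tau> ^ n * C n \<mu> x))"
    using C assms(2) by (intro expands_add expands_poly_part expands_bigO) (blast intro: bigO_mono)+
  thus ?thesis by simp
qed

lemma bigO_poly_part:
  assumes "\<And>n. continuous_on K (C n)"
  shows "bigO 0 (\<lambda>\<tau> x. \<Sum>n<r. \<tau> ^ n * C n x)"
  using assms
  by (intro bigO_sum bigO_mono[OF bigO_mult[OF bigO_power bigO_continuous]]) auto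

lemma expands_bounded:
  assumes "expands q w" "\<mu> \<le> stages M"
  shows "bigO 0 (w \<mu>)"
proof -
  from expands_mono[OF assms(1), of 0] obtain C where "bigO 0 (\<lambda>\<tau> x. w \<mu> \<tau> x - (\<Sum>n<0. \<tau> ^ n * C n \<mu> x))"
    using assms(2) unfolding expands_def coeffs_def by blast
  thus ?thesis by simp
qed

text \<open>With truncations \<open>P\<close> of \<open>v\<close> and \<open>Q\<close> of
  \<open>w\<close>, the product is \<open>P * Q + P * (w - Q) + (v - P) * w\<close>. The last two
  terms are remainders, since \<open>P\<close> and \<open>w\<close> are bounded.\<close>

lemma expands_mult:
  assumes "expands q v" "expands q w"
  shows "expands q (\<lambda>\<mu> \<tau> x. v \<mu> \<tau> x * w \<mu> \<tau> x)"
proof -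
  obtain C where "coeffs q v C" using assms(1) unfolding expands_def by blast
  note C = coeffsD[OF this]
  obtain D where "coeffs q w D" using assms(2) unfolding expands_def by blast
  note D = coeffsD[OF this]
  let ?P = "\<lambda>\<mu> \<tau> x. \<Sum>n<q. \<tau> ^ n * C n \<mu> x" and ?Q = "\<lambda>\<mu> \<tau> x. \<Sum>n<q. \<tau> ^ n * D n \<mu> x"
  have 1: "expands q (\<lambda>\<mu> \<tau> x. \<Sum>m<q. \<Sum>n<q. \<tau> ^ (m + n) * (C m \<mu> x * D n \<mu> x))"
    using C D by (intro expands_sum expands_monom wt_span_mult) (auto intro: continuous_intros)
  have 2: "expands q (\<lambda>\<mu> \<tau> x. ?P \<mu> \<tau> x * (w \<mu> \<tau> x - ?Q \<mu> \<tau> x))"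
    by (rule expands_bigO, rule bigO_mult[where q = 0, simplified])
      (use C D in \<open>auto intro: bigO_poly_part\<close>)
  have 3: "expands q (\<lambda>\<mu> \<tau> x. (v \<mu> \<tau> x - ?P \<mu> \<tau> x) * w \<mu> \<tau> x)"
    by (rule expands_bigO, rule bigO_mult[where r = 0, simplified])
      (use C D assms in \<open>auto intro: expands_bounded\<close>)
  have "(\<Sum>m<q. \<Sum>n<q. \<tau> ^ (m + n) * (C m \<mu> x * D n \<mu> x)) = ?P \<mu> \<tau> x * ?Q \<mu> \<tau> x" for \<mu> \<tau> x
    unfolding sum_product by (simp add: power_add mult_ac)
  with expands_add[OF expands_add[OF 1 2] 3] show ?thesis by (simp add: algebra_simps)
qed

lemma expands_power: "expands q w \<Longrightarrow> expands q (\<lambda>\<mu> \<tau> x. w \<mu> \<tau> x ^ m)"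
  by (induction m) (auto intro: expands_mult expands_const_fun)

lemma expands_cmult: "expands q w \<Longrightarrow> expands q (\<lambda>\<mu> \<tau> x. c * w \<mu> \<tau> x)"
  by (intro expands_mult expands_const_fun) auto

lemma expands_diff: "expands q v \<Longrightarrow> expands q w \<Longrightarrow> expands q (\<lambda>\<mu> \<tau> x. v \<mu> \<tau> x - w \<mu> \<tau> x)"
  using expands_add[of q v "\<lambda>\<mu> \<tau> x. - 1 * w \<mu> \<tau> x"] expands_cmult[of q w "-1"] by simp

text \<open>The remainder can be integrated as it stands, but separating it from the integral of
  \<open>w\<close> requires integrability; hence the continuity premise.\<close>

lemma expands_integral:
  assumes "expands q w" "\<And>\<mu>. \<mu> \<le> stages M \<Longrightarrow> \<forall>\<^sub>F \<tau> in at_right 0. continuous_on K (w \<mu> \<tau>)"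
  shows "expands q (\<lambda>\<mu> \<tau> _. integral K (w \<mu> \<tau>))"
proof -
  obtain C where "coeffs q w C" using assms(1) unfolding expands_def by blast
  note C = coeffsD[OF this]
  have "bigO q (\<lambda>\<tau> _. integral K (w \<mu> \<tau>) - (\<Sum>n<q. \<tau> ^ n * integral K (C n \<mu>)))"
    if \<mu>: "\<mu> \<le> stages M" for \<mu>
  proof -
    have "\<forall>\<^sub>F \<tau> in at_right 0. \<forall>x\<in>K. integral K (\<lambda>x. w \<mu> \<tau> x - (\<Sum>n<q. \<tau> ^ n * C n \<mu> x))
      = integral K (w \<mu> \<tau>) - (\<Sum>n<q. \<tau> ^ n * integral K (C n \<mu>))"
      using assms(2)[OF \<mu>]
    proof eventually_elim
      case (elim \<tau>)
      have "integral K (\<lambda>x. w \<mu> \<tau> x - (\<Sum>n<q. \<tau> ^ n * C n \<mu> x)) =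
        integral K (w \<mu> \<tau>) - integral K (\<lambda>x. \<Sum>n<q. \<tau> ^ n * C n \<mu> x)"
        using elim C(2)[OF \<mu>] by (intro integral_diff integrable_continuous continuous_intros) auto
      also have "integral K (\<lambda>x. \<Sum>n<q. \<tau> ^ n * C n \<mu> x) = (\<Sum>n<q. integral K (\<lambda>x. \<tau> ^ n * C n \<mu> x))"
        using C(2)[OF \<mu>] by (intro integral_sum integrable_continuous continuous_intros) auto
      finally show ?case by simp
    qed
    from bigO_cong[OF this] bigO_integral[OF C(3)[OF \<mu>]] show ?thesis by simp
  qed
  with C show ?thesis unfolding expands_def coeffs_def
    by (intro exI[of _ "\<lambda>n \<mu> _. integral K (C n \<mu>)"]) (auto intro: wt_span_integral)
qed

end

section \<open>Calculus of partial derivatives\<close>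

abbreviation pd :: "'a::euclidean_space \<Rightarrow> ('a \<Rightarrow> real) \<Rightarrow> 'a \<Rightarrow> real" where
  "pd \<equiv> partial_deriv UNIV"

abbreviation iter_pd :: "'a::euclidean_space list \<Rightarrow> ('a \<Rightarrow> real) \<Rightarrow> 'a \<Rightarrow> real" where
  "iter_pd \<equiv> iter_partial UNIV"

lemma partial_deriv_eq:
  assumes "(v has_derivative v') (at x)"
  shows "pd e v x = v' e"
  unfolding partial_deriv_def using frechet_derivative_at[OF assms] by simp

lemma has_derivative_partial:
  assumes "v differentiable at x"
  obtains v' where "(v has_derivative v') (at x)" "\<And>e. pd e v x = v' e"
  using assms partial_deriv_eq unfolding differentiable_def by blast

lemma partial_deriv_const: "pd e (\<lambda>_. c) = (\<lambda>_. 0)"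
  by (rule ext, rule partial_deriv_eq) (auto intro: derivative_intros)

lemma partial_deriv_add:
  assumes "v differentiable at x" "w differentiable at x"
  shows "pd e (\<lambda>x. v x + w x) x = pd e v x + pd e w x"
  by (rule has_derivative_partial[OF assms(1)], rule has_derivative_partial[OF assms(2)])
    (auto intro!: partial_deriv_eq has_derivative_add)

lemma partial_deriv_mult:
  assumes "v differentiable at x" "w differentiable at x"
  shows "pd e (\<lambda>x. v x * w x) x = pd e v x * w x + v x * pd e w x"
proof -
  from assms obtain v' w' where d: "(v has_derivative v') (at x)" "(w has_derivative w') (at x)"
    unfolding differentiable_def by blast
  show ?thesis
    using partial_deriv_eq[OF has_derivative_mult[OF d]] by (simp add: partial_deriv_eq[OF d(1)] partial_deriv_eq[OF d(2)])
qed

lemma partial_deriv_cmult: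
  assumes "w differentiable at x"
  shows "pd e (\<lambda>x. c * w x) x = c * pd e w x"
  using partial_deriv_mult[OF differentiable_const assms] by (simp add: partial_deriv_const)

lemma partial_deriv_sum:
  assumes "\<And>i. i \<in> I \<Longrightarrow> v i differentiable at x"
  shows "pd e (\<lambda>x. \<Sum>i\<in>I. v i x) x = (\<Sum>i\<in>I. pd e (v i) x)"
proof (rule partial_deriv_eq)
  have "(v i has_derivative (\<lambda>h. frechet_derivative (v i) (at x) h)) (at x)" if "i \<in> I" for i
    using assms[OF that] frechet_derivative_works by blast
  thus "((\<lambda>x. \<Sum>i\<in>I. v i x) has_derivative (\<lambda>e. \<Sum>i\<in>I. pd e (v i) x)) (at x)"
    unfolding partial_deriv_def by (auto intro: has_derivative_sum)
qed

lemma partial_deriv_compose: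
  assumes "w differentiable at x" "(f has_real_derivative f') (at (w x))"
  shows "pd e (\<lambda>x. f (w x)) x = f' * pd e w x"
proof -
  from assms(1) obtain w' where w: "(w has_derivative w') (at x)"
    unfolding differentiable_def by blast
  from has_derivative_compose[OF w assms(2)[unfolded has_field_derivative_def]]
  show ?thesis by (simp add: partial_deriv_eq[OF w] partial_deriv_eq)
qed

lemma differentiable_compose_real:
  fixes f :: "real \<Rightarrow> real"
  assumes "w differentiable at x" "(f has_real_derivative f') (at (w x))"
  shows "(\<lambda>x. f (w x)) differentiable at x"
  using assms has_derivative_compose[of w _ x UNIV f "(*) f'"]
  unfolding differentiable_def has_field_derivative_def by blast

section \<open>Composition with smooth functions, and one step of the method\<close>

context expansion
begin

lemma bigO_le:
  assumes "bigO q h" "\<forall>\<^sub>F \<tau> in at_right 0. \<forall>x\<in>K. \<bar>g \<tau> x\<bar> \<le> B * \<bar>h \<tau> x\<bar>"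
  shows "bigO q g"
proof -
  from ObdE[OF assms(1)] obtain C where C: "C \<ge> 0" "\<forall>\<^sub>F \<tau> in at_right 0. \<forall>x\<in>K. \<bar>h \<tau> x\<bar> \<le> C * \<tau> ^ q" .
  from C(2) assms(2) have "\<forall>\<^sub>F \<tau> in at_right 0. \<forall>x\<in>K. \<bar>g \<tau> x\<bar> \<le> (\<bar>B\<bar> * C) * \<tau> ^ q"
  proof eventually_elim
    case (elim \<tau>)
    show ?case
    proof
      fix x assume x: "x \<in> K"
      have "\<bar>g \<tau> x\<bar> \<le> \<bar>B\<bar> * \<bar>h \<tau> x\<bar>"
        using elim(2) x mult_right_mono[of B "\<bar>B\<bar>" "\<bar>h \<tau> x\<bar>"] by force
      also have "\<dots> \<le> \<bar>B\<bar> * (C * \<tau> ^ q)" using elim(1) x by (intro mult_left_mono) auto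
      finally show "\<bar>g \<tau> x\<bar> \<le> (\<bar>B\<bar> * C) * \<tau> ^ q" by (simp add: mult_ac)
    qed
  qed
  thus ?thesis unfolding bigO_def by blast
qed

lemma bigO_power_of: "bigO 1 v \<Longrightarrow> bigO m (\<lambda>\<tau> x. v \<tau> x ^ m)"
  by (induction m) (use bigO_const bigO_mult[of 1 v] in \<open>auto\<close>)

lemma bigO_tau_times: "bigO q g \<Longrightarrow> bigO (Suc q) (\<lambda>\<tau> x. \<tau> * g \<tau> x)"
  using bigO_mult[OF bigO_power[of 1]] by simp

lemma bigO_1_tendsto:
  assumes "bigO 1 (\<lambda>\<tau> x. w \<tau> x - c x)" "x \<in> K"
  shows "((\<lambda>\<tau>. w \<tau> x) \<longlongrightarrow> c x) (at_right 0)"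
proof -
  from assms obtain B where B: "\<forall>\<^sub>F \<tau> in at_right 0. \<forall>x\<in>K. \<bar>w \<tau> x - c x\<bar> \<le> B * \<tau> ^ 1"
    unfolding bigO_def by blast
  have "((\<lambda>\<tau>. B * \<tau>) \<longlongrightarrow> B * 0) (at_right (0::real))" by (intro tendsto_intros)
  hence 0: "((\<lambda>\<tau>. B * \<tau>) \<longlongrightarrow> 0) (at_right (0::real))" by simp
  have "((\<lambda>\<tau>. w \<tau> x - c x) \<longlongrightarrow> 0) (at_right 0)"
    by (rule tendsto_rabs_zero_cancel, rule real_tendsto_sandwich[OF _ _ tendsto_const 0])
      (use B assms(2) in \<open>auto elim: eventually_mono\<close>)
  from tendsto_add[OF this tendsto_const[of "c x"]] show ?thesis by simp
qed

text \<open>The limit \<open>c\<close> does not depend on \<open>\<mu>\<close>: the exact solution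
  and all stages have one common base point for Taylor expansion.\<close>

lemma expands_1_limit:
  assumes "expands 1 w"
  shows "\<exists>c. continuous_on K c \<and> (\<forall>\<mu>\<le>stages M. bigO 1 (\<lambda>\<tau> x. w \<mu> \<tau> x - c x))"
proof -
  obtain C where "coeffs 1 w C" using assms(1) unfolding expands_def by blast
  note C = coeffsD[OF this]
  show ?thesis
  proof (intro exI[of _ "C 0 0"] conjI allI impI)
    show "continuous_on K (C 0 0)" using C(2) by simp
    fix \<mu> assume \<mu>: "\<mu> \<le> stages M"
    have "C 0 \<mu> x = C 0 0 x" if "x \<in> K" for x
      using wt_span_0_const[OF C(1)[OF that] \<mu>] .
    hence "\<forall>\<^sub>F \<tau> in at_right 0. \<forall>x\<in>K. w \<mu> \<tau> x - (\<Sum>n<1. \<tau> ^ n * C n \<mu> x) = w \<mu> \<tau> x - C 0 0 x"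
      by (intro always_eventually) simp
    from iffD1[OF bigO_cong[OF this] C(3)[OF \<mu>]] show "bigO 1 (\<lambda>\<tau> x. w \<mu> \<tau> x - C 0 0 x)" .
  qed
qed

text \<open>Taylor expansion about the common limit \<open>c\<close>. As \<open>w - c\<close> is
  \<open>O(\<tau>)\<close>, the remainder of degree \<open>q\<close> is \<open>O(\<tau>^q)\<close>,
  and the polynomial part is built from sums and products. Its coefficients are independent of
  \<open>\<mu>\<close> and so have expansions of order 0.\<close>

lemma expands_compose:
  assumes D: "\<And>k y. l \<le> y \<Longrightarrow> y \<le> h \<Longrightarrow> (D k has_real_derivative D (Suc k) y) (at y)"
    and w: "expands q w"
    and lh: "\<And>\<mu>. \<mu> \<le> stages M \<Longrightarrow> \<forall>\<^sub>F \<tau> in at_right 0. \<forall>x\<in>K. l \<le> w \<mu> \<tau> x \<and> w \<mu> \<tau> x \<le> h"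
  shows "expands q (\<lambda>\<mu> \<tau> x. D 0 (w \<mu> \<tau> x))"
proof -
  have cont: "continuous_on {l..h} (D k)" for k
    using D by (intro continuous_at_imp_continuous_on ballI DERIV_isCont) auto
  have "\<exists>B. \<forall>y\<in>{l..h}. \<bar>D k y\<bar> \<le> B" for k
    using compact_imp_bounded[OF compact_continuous_image[OF cont compact_Icc]]
    by (auto simp: bounded_iff)
  then obtain B where B: "\<And>k y. l \<le> y \<Longrightarrow> y \<le> h \<Longrightarrow> \<bar>D k y\<bar> \<le> B k"
    using atLeastAtMost_iff by metis
  show ?thesis
  proof (cases "q = 0")
    case True
    \<comment> \<open>At order 0 no limit of \<open>w\<close> is available, but only boundedness is
      claimed.\<close>
    have "bigO 0 (\<lambda>\<tau> x. D 0 (w \<mu> \<tau> x))" if "\<mu> \<le> stages M" for \<mu>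
      unfolding bigO_def using lh[OF that] by (intro exI[of _ "B 0"]) (auto elim!: eventually_mono intro: B)
    thus ?thesis by (simp add: True expands_bigO)
  next
    case False
    with w have "expands 1 w" by (auto intro: expands_mono)
    then obtain c where cc: "continuous_on K c"
      and v1: "\<And>\<mu>. \<mu> \<le> stages M \<Longrightarrow> bigO 1 (\<lambda>\<tau> x. w \<mu> \<tau> x - c x)"
      using expands_1_limit[of w] by auto
    \<comment> \<open>The limit stays in the closed interval on which the derivatives are
      controlled.\<close>
    have c: "l \<le> c x" "c x \<le> h" if "x \<in> K" for x
    proof -
      have t: "((\<lambda>\<tau>. w 0 \<tau> x) \<longlongrightarrow> c x) (at_right 0)" using v1[of 0] that by (intro bigO_1_tendsto) auto
      show "l \<le> c x" using lh[of 0] that by (intro tendsto_lowerbound[OF t]) (auto elim: eventually_mono)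
      show "c x \<le> h" using lh[of 0] that by (intro tendsto_upperbound[OF t]) (auto elim: eventually_mono)
    qed
    let ?v = "\<lambda>\<mu> \<tau> x. w \<mu> \<tau> x - c x"
    have Dc: "continuous_on K (\<lambda>x. D m (c x) / fact m)" for m
      by (intro continuous_intros continuous_on_compose2[OF cont cc]) (auto simp: c)
    have "expands q (\<lambda>\<mu> \<tau> x. \<Sum>m<q. (D m (c x) / fact m) * ?v \<mu> \<tau> x ^ m)"
      by (intro expands_sum expands_mult expands_power expands_diff w expands_const_fun Dc cc)
    moreover have "expands q (\<lambda>\<mu> \<tau> x. D 0 (w \<mu> \<tau> x) - (\<Sum>m<q. (D m (c x) / fact m) * ?v \<mu> \<tau> x ^ m))"
    proof (rule expands_bigO, rule bigO_le[OF bigO_power_of[OF v1]])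
      fix \<mu> assume \<mu>: "\<mu> \<le> stages M"
      show "\<forall>\<^sub>F \<tau> in at_right 0. \<forall>x\<in>K. \<bar>D 0 (w \<mu> \<tau> x) - (\<Sum>m<q. (D m (c x) / fact m) * ?v \<mu> \<tau> x ^ m)\<bar>
         \<le> B q / fact q * \<bar>?v \<mu> \<tau> x ^ q\<bar>"
        using lh[OF \<mu>]
      proof eventually_elim
        case (elim \<tau>)
        show ?case
        proof
          fix x assume x: "x \<in> K"
          show "\<bar>D 0 (w \<mu> \<tau> x) - (\<Sum>m<q. (D m (c x) / fact m) * ?v \<mu> \<tau> x ^ m)\<bar> \<le> B q / fact q * \<bar>?v \<mu> \<tau> x ^ q\<bar>"
          proof (cases "w \<mu> \<tau> x = c x")
            case True
            have "(\<Sum>m<q. (D m (c x) / fact m) * 0 ^ m) = D 0 (c x)"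
              using False by (simp add: power_0_left if_distrib[of "\<lambda>z. _ * z"] cong: if_cong)
            thus ?thesis unfolding True using False by (simp add: power_0_left)
          next
            case neq: False
            \<comment> \<open>\<open>Taylor\<close> requires two distinct points; the intermediate
              point lies in the interval, where \<open>D q\<close> is bounded by
              \<open>B q\<close>.\<close>
            have "\<exists>t. (if w \<mu> \<tau> x < c x then w \<mu> \<tau> x < t \<and> t < c x else c x < t \<and> t < w \<mu> \<tau> x) \<and>
              D 0 (w \<mu> \<tau> x) = (\<Sum>m<q. (D m (c x) / fact m) * ?v \<mu> \<tau> x ^ m) + (D q t / fact q) * ?v \<mu> \<tau> x ^ q"
              using Taylor[of q D "D 0" l h "c x" "w \<mu> \<tau> x"] D neq c[OF x] elim[rule_format, OF x] False by simp
            then obtain t where t: "if w \<mu> \<tau> x < c x then w \<mu> \<tau> x < t \<and> t < c x else c x < t \<and> t < w \<mu> \<tau> x"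
              "D 0 (w \<mu> \<tau> x) - (\<Sum>m<q. (D m (c x) / fact m) * ?v \<mu> \<tau> x ^ m) = (D q t / fact q) * ?v \<mu> \<tau> x ^ q"
              by auto
            have "l \<le> t" "t \<le> h" using t(1) c[OF x] elim[rule_format, OF x] by (simp_all split: if_splits)
            hence "\<bar>D q t\<bar> \<le> B q" by (rule B)
            thus ?thesis unfolding t(2) abs_mult by (intro mult_right_mono) (auto simp: divide_right_mono)
          qed
        qed
      qed
    qed auto
    ultimately have "expands q (\<lambda>\<mu> \<tau> x. (\<Sum>m<q. (D m (c x) / fact m) * ?v \<mu> \<tau> x ^ m) +
      (D 0 (w \<mu> \<tau> x) - (\<Sum>m<q. (D m (c x) / fact m) * ?v \<mu> \<tau> x ^ m)))" by (rule expands_add)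
    thus ?thesis by simp
  qed
qed

text \<open>The range \<open>d\<close> of step sizes is common to all \<open>x\<close> in the box.
  Continuity up to 0 and derivatives in the interior are what the mean value theorem asks
  for.\<close>

definition evolves :: "(real \<Rightarrow> 'a \<Rightarrow> real) \<Rightarrow> (real \<Rightarrow> 'a \<Rightarrow> real) \<Rightarrow> bool" where
  "evolves z G \<longleftrightarrow> (\<exists>d>0. \<forall>x\<in>K. continuous_on {0..d} (\<lambda>\<tau>. z \<tau> x) \<and>
      (\<forall>\<tau>\<in>{0<..<d}. ((\<lambda>\<tau>. z \<tau> x) has_real_derivative G \<tau> x) (at \<tau>)))"

text \<open>The mean value theorem is applied to \<open>z\<close> minus the integrated polynomial.
  Its derivative is the remainder of \<open>G\<close>, and the length of the interval contributes
  the additional factor \<open>\<tau>\<close>.\<close>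

lemma evolves_bigO:
  assumes z: "evolves z G" and G: "bigO q (\<lambda>\<tau> x. G \<tau> x - (\<Sum>n<q. \<tau> ^ n * C n x))"
  shows "bigO (Suc q) (\<lambda>\<tau> x. z \<tau> x - z 0 x - (\<Sum>n<q. \<tau> ^ Suc n * (C n x / real (Suc n))))"
proof -
  from ObdE[OF G] obtain B where B: "B \<ge> 0"
    "\<forall>\<^sub>F \<tau> in at_right 0. \<forall>x\<in>K. \<bar>G \<tau> x - (\<Sum>n<q. \<tau> ^ n * C n x)\<bar> \<le> B * \<tau> ^ q" .
  then obtain d1 where d1: "d1 > 0"
    "\<And>\<tau> x. 0 < \<tau> \<Longrightarrow> \<tau> < d1 \<Longrightarrow> x \<in> K \<Longrightarrow> \<bar>G \<tau> x - (\<Sum>n<q. \<tau> ^ n * C n x)\<bar> \<le> B * \<tau> ^ q"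
    unfolding eventually_at_right_field by auto
  from z obtain d2 where d2: "d2 > 0" "\<And>x. x \<in> K \<Longrightarrow> continuous_on {0..d2} (\<lambda>\<tau>. z \<tau> x)"
    "\<And>x \<tau>. x \<in> K \<Longrightarrow> 0 < \<tau> \<Longrightarrow> \<tau> < d2 \<Longrightarrow> ((\<lambda>\<tau>. z \<tau> x) has_real_derivative G \<tau> x) (at \<tau>)"
    unfolding evolves_def by auto
  have "\<bar>z \<tau> x - z 0 x - (\<Sum>n<q. \<tau> ^ Suc n * (C n x / real (Suc n)))\<bar> \<le> B * \<tau> ^ Suc q"
    if \<tau>: "0 < \<tau>" "\<tau> < min d1 d2" and x: "x \<in> K" for \<tau> x
  proof -
    define g where "g \<sigma> = z \<sigma> x - (\<Sum>n<q. \<sigma> ^ Suc n * (C n x / real (Suc n)))" for \<sigma>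
    have cont: "continuous_on {0..\<tau>} g"
      unfolding g_def using \<tau> by (intro continuous_intros continuous_on_subset[OF d2(2)[OF x]]) auto
    have der: "(g has_real_derivative G \<sigma> x - (\<Sum>n<q. \<sigma> ^ n * C n x)) (at \<sigma>)" if "0 < \<sigma>" "\<sigma> < \<tau>" for \<sigma>
    proof -
      have "((\<lambda>\<sigma>. \<sigma> ^ Suc n * (C n x / real (Suc n))) has_real_derivative \<sigma> ^ n * C n x) (at \<sigma>)" for n
        by (rule derivative_eq_intros refl)+ (simp add: field_simps)
      thus ?thesis unfolding g_def using d2(3)[OF x, of \<sigma>] that \<tau>
        by (intro DERIV_diff DERIV_sum) auto
    qed
    obtain \<xi> where \<xi>: "0 < \<xi>" "\<xi> < \<tau>" "g \<tau> - g 0 = (\<tau> - 0) * (G \<xi> x - (\<Sum>n<q. \<xi> ^ n * C n x))"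
    proof -
      obtain l' \<xi> where l: "0 < \<xi>" "\<xi> < \<tau>" "DERIV g \<xi> :> l'" "g \<tau> - g 0 = (\<tau> - 0) * l'"
        using MVT[OF \<tau>(1) cont] der real_differentiable_def by blast
      moreover have "l' = G \<xi> x - (\<Sum>n<q. \<xi> ^ n * C n x)" using DERIV_unique[OF l(3) der] l by simp
      ultimately show ?thesis using that by blast
    qed
    have "\<bar>G \<xi> x - (\<Sum>n<q. \<xi> ^ n * C n x)\<bar> \<le> B * \<xi> ^ q" using d1(2) \<xi> \<tau> x by simp
    also have "\<dots> \<le> B * \<tau> ^ q" using \<xi> B(1) by (intro mult_left_mono power_mono) auto
    finally have "\<bar>g \<tau> - g 0\<bar> \<le> \<tau> * (B * \<tau> ^ q)"
      unfolding \<xi>(3) abs_mult using \<tau> by simp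
    moreover have "g \<tau> - g 0 = z \<tau> x - z 0 x - (\<Sum>n<q. \<tau> ^ Suc n * (C n x / real (Suc n)))"
      by (simp add: g_def)
    ultimately show ?thesis by (simp add: mult_ac)
  qed
  thus ?thesis unfolding bigO_def eventually_at_right_field
    using d1(1) d2(1) by (intro exI[of _ B] exI[of _ "min d1 d2"]) auto
qed

text \<open>One power is gained: by integration at index 0 and by the factor \<open>\<tau>\<close>
  at the stages. The implicit occurrence of stage \<open>i\<close> in its own equation is harmless,
  because only the expansion of order \<open>q\<close> of the right-hand side is used.\<close>

lemma expands_step:
  assumes vF: "expands q vF" and vG: "expands q vG"
    and z: "evolves (z 0) (\<lambda>\<tau> x. vF 0 \<tau> x + vG 0 \<tau> x)"
    and cont: "continuous_on K (z 0 0)"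
    and stage: "\<And>i. i \<in> {1..stages M} \<Longrightarrow> \<forall>\<^sub>F \<tau> in at_right 0. \<forall>x\<in>K. z i \<tau> x =
       z 0 0 x + \<tau> * (\<Sum>j=1..i. cA M i j * vF j \<tau> x) + \<tau> * (\<Sum>j=1..<i. cA' M i j * vG j \<tau> x)"
  shows "expands (Suc q) z"
proof -
  obtain C where "coeffs q vF C" using vF unfolding expands_def by blast
  note C = coeffsD[OF this]
  obtain D where "coeffs q vG D" using vG unfolding expands_def by blast
  note D = coeffsD[OF this]
  \<comment> \<open>Coefficient \<open>n + 1\<close> arises from coefficients \<open>n\<close> of
    both right-hand sides by \<open>wt_span_step\<close>; coefficient 0 is the initial value in
    every component.\<close>
  define A where "A n \<mu> x = (case n of 0 \<Rightarrow> z 0 0 x | Suc n \<Rightarrow>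
     if \<mu> = 0 then (C n 0 x + D n 0 x) / real (Suc n)
     else (\<Sum>j=1..\<mu>. cA M \<mu> j * C n j x) + (\<Sum>j=1..<\<mu>. cA' M \<mu> j * D n j x))" for n \<mu> x
  have A_sum: "(\<Sum>n<Suc q. \<tau> ^ n * A n \<mu> x) = z 0 0 x + (\<Sum>n<q. \<tau> ^ Suc n * A (Suc n) \<mu> x)" for \<tau> \<mu> x
    unfolding sum.lessThan_Suc_shift by (simp add: A_def)
  have SA: "wt_span n (\<lambda>\<mu>. A n \<mu> x)" if "x \<in> K" for n x
  proof (cases n)
    case 0
    thus ?thesis by (simp add: A_def wt_span_const)
  next
    case (Suc m)
    thus ?thesis using wt_span_step[OF C(1)[OF that] D(1)[OF that]] by (simp add: A_def)
  qed
  have cA: "continuous_on K (A n \<mu>)" if "\<mu> \<le> stages M" for n \<mu>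
  proof (cases n)
    case 0
    thus ?thesis by (simp add: A_def[abs_def] cont)
  next
    case (Suc m)
    thus ?thesis using that
      by (cases "\<mu> = 0") (auto simp: A_def[abs_def] intro!: continuous_intros C(2) D(2))
  qed
  have OA: "bigO (Suc q) (\<lambda>\<tau> x. z \<mu> \<tau> x - (\<Sum>n<Suc q. \<tau> ^ n * A n \<mu> x))" if \<mu>: "\<mu> \<le> stages M" for \<mu>
  proof (cases "\<mu> = 0")
    case True
    have "bigO q (\<lambda>\<tau> x. vF 0 \<tau> x + vG 0 \<tau> x - (\<Sum>n<q. \<tau> ^ n * (C n 0 x + D n 0 x)))"
      using bigO_add[OF C(3) D(3), of 0] by (simp add: algebra_simps sum.distrib)
    from evolves_bigO[OF z this] show ?thesis
      unfolding A_sum True by (simp add: A_def algebra_simps)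
  next
    case False
    let ?X = "\<lambda>\<tau> x. \<tau> * ((\<Sum>j=1..\<mu>. cA M \<mu> j * (vF j \<tau> x - (\<Sum>n<q. \<tau> ^ n * C n j x)))
       + (\<Sum>j=1..<\<mu>. cA' M \<mu> j * (vG j \<tau> x - (\<Sum>n<q. \<tau> ^ n * D n j x))))"
    have "bigO (Suc q) ?X"
      using \<mu> by (intro bigO_tau_times bigO_add bigO_sum bigO_cmult C D) auto
    moreover have "\<forall>\<^sub>F \<tau> in at_right 0. \<forall>x\<in>K. ?X \<tau> x = z \<mu> \<tau> x - (\<Sum>n<Suc q. \<tau> ^ n * A n \<mu> x)"
      using stage[of \<mu>]
    proof (rule eventually_mono)
      show "\<mu> \<in> {1..stages M}" using \<mu> False by simp
      fix \<tau> assume st: "\<forall>x\<in>K. z \<mu> \<tau> x =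
         z 0 0 x + \<tau> * (\<Sum>j=1..\<mu>. cA M \<mu> j * vF j \<tau> x) + \<tau> * (\<Sum>j=1..<\<mu>. cA' M \<mu> j * vG j \<tau> x)"
      have sw: "(\<Sum>j\<in>J. c j * (\<Sum>n<q. \<tau> ^ n * X n j)) = (\<Sum>n<q. \<tau> ^ n * (\<Sum>j\<in>J. c j * X n j))"
        for J and c :: "nat \<Rightarrow> real" and X :: "nat \<Rightarrow> nat \<Rightarrow> real"
        unfolding sum_distrib_left by (subst sum.swap) (simp add: mult.left_commute)
      have "(\<Sum>n<q. \<tau> ^ Suc n * A (Suc n) \<mu> x) = \<tau> * ((\<Sum>j=1..\<mu>. cA M \<mu> j * (\<Sum>n<q. \<tau> ^ n * C n j x))
         + (\<Sum>j=1..<\<mu>. cA' M \<mu> j * (\<Sum>n<q. \<tau> ^ n * D n j x)))" for x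
        unfolding sw using False
        by (simp add: A_def distrib_left sum.distrib sum_distrib_left mult.assoc)
      thus "\<forall>x\<in>K. ?X \<tau> x = z \<mu> \<tau> x - (\<Sum>n<Suc q. \<tau> ^ n * A n \<mu> x)"
        using st unfolding A_sum by (simp add: right_diff_distrib sum_subtractf distrib_left)
    qed
    ultimately show ?thesis by (rule iffD1[OF bigO_cong, rotated])
  qed
  show ?thesis unfolding expands_def coeffs_def using SA cA OA by blast
qed

text \<open>The update is expanded like a stage, with the weights in place of a row of the tableau.
  The order conditions make its polynomial part coincide with that of the exact evolution, so only
  the two remainders are left.\<close>

lemma expands_final:
  assumes order: "imex_order M p"
    and vF: "expands p vF" and vG: "expands p vG"
    and z: "evolves z (\<lambda>\<tau> x. vF 0 \<tau> x + vG 0 \<tau> x)"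
  shows "bigO (Suc p) (\<lambda>\<tau> x. z \<tau> x - (z 0 x + \<tau> * (\<Sum>i=1..stages M. cb M i * vF i \<tau> x + cb' M i * vG i \<tau> x)))"
proof -
  obtain C where "coeffs p vF C" using vF unfolding expands_def by blast
  note C = coeffsD[OF this]
  obtain D where "coeffs p vG D" using vG unfolding expands_def by blast
  note D = coeffsD[OF this]
  have "bigO p (\<lambda>\<tau> x. vF 0 \<tau> x + vG 0 \<tau> x - (\<Sum>n<p. \<tau> ^ n * (C n 0 x + D n 0 x)))"
    using bigO_add[OF C(3) D(3), of 0] by (simp add: algebra_simps sum.distrib)
  from evolves_bigO[OF z this]
  have 1: "bigO (Suc p) (\<lambda>\<tau> x. z \<tau> x - z 0 x - (\<Sum>n<p. \<tau> ^ Suc n * ((C n 0 x + D n 0 x) / real (Suc n))))" .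
  let ?Y = "\<lambda>\<tau> x. \<tau> * (\<Sum>i=1..stages M. cb M i * (vF i \<tau> x - (\<Sum>n<p. \<tau> ^ n * C n i x))
       + cb' M i * (vG i \<tau> x - (\<Sum>n<p. \<tau> ^ n * D n i x)))"
  have 2: "bigO (Suc p) ?Y"
    by (intro bigO_tau_times bigO_add bigO_sum bigO_cmult C D) auto
  have "\<forall>\<^sub>F \<tau> in at_right 0. \<forall>x\<in>K. z \<tau> x - z 0 x - (\<Sum>n<p. \<tau> ^ Suc n * ((C n 0 x + D n 0 x) / real (Suc n)))
     - ?Y \<tau> x
     = z \<tau> x - (z 0 x + \<tau> * (\<Sum>i=1..stages M. cb M i * vF i \<tau> x + cb' M i * vG i \<tau> x))"
  proof (intro always_eventually allI ballI)
    fix \<tau> x assume x: "x \<in> K"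
    have sw: "(\<Sum>j\<in>J. c j * (\<Sum>n<p. \<tau> ^ n * X n j)) = (\<Sum>n<p. \<tau> ^ n * (\<Sum>j\<in>J. c j * X n j))"
      for J and c :: "nat \<Rightarrow> real" and X :: "nat \<Rightarrow> nat \<Rightarrow> real"
      unfolding sum_distrib_left by (subst sum.swap) (simp add: mult.left_commute)
    \<comment> \<open>Here the order conditions enter; they are available for the degrees
      \<open>n < p\<close> that occur.\<close>
    have sc: "(\<Sum>i=1..stages M. cb M i * C n i x) + (\<Sum>i=1..stages M. cb' M i * D n i x) = (C n 0 x + D n 0 x) / real (Suc n)"
      if "n < p" for n
      using wt_span_final(1)[OF order that C(1)[OF x]] wt_span_final(2)[OF order that D(1)[OF x]] by (simp add: add_divide_distrib)
    have pq: "\<tau> * ((\<Sum>n<p. \<tau> ^ n * P n) + (\<Sum>n<p. \<tau> ^ n * Q n)) = (\<Sum>n<p. \<tau> ^ Suc n * (P n + Q n))" for P Q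
      by (simp add: sum_distrib_left distrib_left sum.distrib mult.assoc)
    have e: "(\<Sum>n<p. \<tau> ^ Suc n * ((C n 0 x + D n 0 x) / real (Suc n))) =
       \<tau> * ((\<Sum>i=1..stages M. cb M i * (\<Sum>n<p. \<tau> ^ n * C n i x)) + (\<Sum>i=1..stages M. cb' M i * (\<Sum>n<p. \<tau> ^ n * D n i x)))"
      unfolding sw pq by (intro sum.cong refl) (simp only: sc lessThan_iff)
    show "z \<tau> x - z 0 x - (\<Sum>n<p. \<tau> ^ Suc n * ((C n 0 x + D n 0 x) / real (Suc n)))
     - ?Y \<tau> x
     = z \<tau> x - (z 0 x + \<tau> * (\<Sum>i=1..stages M. cb M i * vF i \<tau> x + cb' M i * vG i \<tau> x))"
      unfolding e by (simp add: right_diff_distrib sum_subtractf sum.distrib distrib_left)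
  qed
  from iffD1[OF bigO_cong[OF this] bigO_diff[OF 1 2]] show ?thesis .
qed

section \<open>Expansions of all spatial derivatives\<close>

definition diffbl :: "(nat \<Rightarrow> real \<Rightarrow> 'a \<Rightarrow> real) \<Rightarrow> bool" where
  "diffbl w \<longleftrightarrow> (\<forall>\<mu>\<le>stages M. \<forall>\<^sub>F \<tau> in at_right 0. \<forall>x. w \<mu> \<tau> differentiable at x)"

text \<open>Differentiability is demanded on the whole space and not only on \<open>K\<close>,
  because the sum, product and chain rules must hold as identities of functions in order to be
  differentiated again.\<close>

primrec Ck_expands :: "nat \<Rightarrow> nat \<Rightarrow> (nat \<Rightarrow> real \<Rightarrow> 'a \<Rightarrow> real) \<Rightarrow> bool" where
  "Ck_expands 0 q w \<longleftrightarrow> expands q w"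
| "Ck_expands (Suc k) q w \<longleftrightarrow> expands q w \<and> diffbl w \<and> (\<forall>e\<in>Basis. Ck_expands k q (\<lambda>\<mu> \<tau>. pd e (w \<mu> \<tau>)))"

lemma Ck_expands_imp_E: "Ck_expands k q w \<Longrightarrow> expands q w"
  by (cases k) auto

lemma Ck_expands_Suc: "Ck_expands (Suc k) q w \<Longrightarrow> Ck_expands k q w"
  by (induction k arbitrary: w) auto

lemma expands_cong_fun:
  assumes "\<And>\<mu>. \<mu> \<le> stages M \<Longrightarrow> \<forall>\<^sub>F \<tau> in at_right 0. v \<mu> \<tau> = w \<mu> \<tau>" "expands q v"
  shows "expands q w"
proof (rule expands_cong[OF _ assms(2)])
  fix \<mu> assume "\<mu> \<le> stages M"
  from assms(1)[OF this] show "\<forall>\<^sub>F \<tau> in at_right 0. \<forall>x\<in>K. v \<mu> \<tau> x = w \<mu> \<tau> x"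
    by (rule eventually_mono) simp
qed

lemma Ck_expands_cong:
  assumes "\<And>\<mu>. \<mu> \<le> stages M \<Longrightarrow> \<forall>\<^sub>F \<tau> in at_right 0. v \<mu> \<tau> = w \<mu> \<tau>" "Ck_expands k q v"
  shows "Ck_expands k q w"
  using assms
proof (induction k arbitrary: v w)
  case 0
  have "expands q w" using expands_cong_fun[OF 0(1)] 0(2) by simp
  thus ?case by simp
next
  case (Suc k)
  have 1: "expands q w" using expands_cong_fun[OF Suc.prems(1)] Suc.prems(2) by simp
  have 2: "diffbl w"
    unfolding diffbl_def
  proof (intro allI impI)
    fix \<mu> assume \<mu>: "\<mu> \<le> stages M"
    with Suc.prems(2) have "\<forall>\<^sub>F \<tau> in at_right 0. \<forall>x. v \<mu> \<tau> differentiable at x" by (simp add: diffbl_def)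
    with Suc.prems(1)[OF \<mu>] show "\<forall>\<^sub>F \<tau> in at_right 0. \<forall>x. w \<mu> \<tau> differentiable at x"
      by eventually_elim simp
  qed
  have "Ck_expands k q (\<lambda>\<mu> \<tau>. pd e (w \<mu> \<tau>))" if e: "e \<in> Basis" for e
  proof (rule Suc.IH)
    show "Ck_expands k q (\<lambda>\<mu> \<tau>. pd e (v \<mu> \<tau>))" using Suc.prems(2) e by simp
    fix \<mu> assume "\<mu> \<le> stages M"
    from Suc.prems(1)[OF this]
    show "\<forall>\<^sub>F \<tau> in at_right 0. pd e (v \<mu> \<tau>) = pd e (w \<mu> \<tau>)"
      by eventually_elim simp
  qed
  with 1 2 show ?case by simp
qed

lemma diffbl_add:
  assumes "diffbl v" "diffbl w"
  shows "diffbl (\<lambda>\<mu> \<tau> x. v \<mu> \<tau> x + w \<mu> \<tau> x)"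
  unfolding diffbl_def
proof (intro allI impI)
  fix \<mu> assume "\<mu> \<le> stages M"
  with assms have "\<forall>\<^sub>F \<tau> in at_right 0. \<forall>x. v \<mu> \<tau> differentiable at x" "\<forall>\<^sub>F \<tau> in at_right 0. \<forall>x. w \<mu> \<tau> differentiable at x"
    by (simp_all add: diffbl_def)
  thus "\<forall>\<^sub>F \<tau> in at_right 0. \<forall>x. (\<lambda>x. v \<mu> \<tau> x + w \<mu> \<tau> x) differentiable at x"
    by eventually_elim (auto intro: differentiable_add)
qed

lemma diffbl_mult:
  assumes "diffbl v" "diffbl w"
  shows "diffbl (\<lambda>\<mu> \<tau> x. v \<mu> \<tau> x * w \<mu> \<tau> x)"
  unfolding diffbl_def
proof (intro allI impI)
  fix \<mu> assume "\<mu> \<le> stages M"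
  with assms have "\<forall>\<^sub>F \<tau> in at_right 0. \<forall>x. v \<mu> \<tau> differentiable at x" "\<forall>\<^sub>F \<tau> in at_right 0. \<forall>x. w \<mu> \<tau> differentiable at x"
    by (simp_all add: diffbl_def)
  thus "\<forall>\<^sub>F \<tau> in at_right 0. \<forall>x. (\<lambda>x. v \<mu> \<tau> x * w \<mu> \<tau> x) differentiable at x"
    by eventually_elim (auto intro: differentiable_mult)
qed

lemma Ck_expands_add: "Ck_expands k q v \<Longrightarrow> Ck_expands k q w \<Longrightarrow> Ck_expands k q (\<lambda>\<mu> \<tau> x. v \<mu> \<tau> x + w \<mu> \<tau> x)"
proof (induction k arbitrary: v w)
  case 0
  thus ?case by (simp add: expands_add)
next
  case (Suc k)
  have "Ck_expands k q (\<lambda>\<mu> \<tau>. pd e (\<lambda>x. v \<mu> \<tau> x + w \<mu> \<tau> x))" if e: "e \<in> Basis" for e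
  proof (rule Ck_expands_cong)
    show "Ck_expands k q (\<lambda>\<mu> \<tau> x. pd e (v \<mu> \<tau>) x + pd e (w \<mu> \<tau>) x)"
      using Suc.prems e by (intro Suc.IH) auto
    fix \<mu> assume \<mu>: "\<mu> \<le> stages M"
    with Suc.prems have "\<forall>\<^sub>F \<tau> in at_right 0. \<forall>x. v \<mu> \<tau> differentiable at x"
      "\<forall>\<^sub>F \<tau> in at_right 0. \<forall>x. w \<mu> \<tau> differentiable at x" by (simp_all add: diffbl_def)
    thus "\<forall>\<^sub>F \<tau> in at_right 0. (\<lambda>x. pd e (v \<mu> \<tau>) x + pd e (w \<mu> \<tau>) x)
      = pd e (\<lambda>x. v \<mu> \<tau> x + w \<mu> \<tau> x)"
      by eventually_elim (auto simp: partial_deriv_add)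
  qed
  with Suc.prems show ?case by (auto intro: expands_add diffbl_add)
qed

lemma Ck_expands_mult: "Ck_expands k q v \<Longrightarrow> Ck_expands k q w \<Longrightarrow> Ck_expands k q (\<lambda>\<mu> \<tau> x. v \<mu> \<tau> x * w \<mu> \<tau> x)"
proof (induction k arbitrary: v w)
  case 0
  thus ?case by (simp add: expands_mult)
next
  case (Suc k)
  have "Ck_expands k q (\<lambda>\<mu> \<tau>. pd e (\<lambda>x. v \<mu> \<tau> x * w \<mu> \<tau> x))" if e: "e \<in> Basis" for e
  proof (rule Ck_expands_cong)
    show "Ck_expands k q (\<lambda>\<mu> \<tau> x. pd e (v \<mu> \<tau>) x * w \<mu> \<tau> x + v \<mu> \<tau> x * pd e (w \<mu> \<tau>) x)"
      using Suc.prems e Ck_expands_Suc by (intro Ck_expands_add Suc.IH) auto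
    fix \<mu> assume \<mu>: "\<mu> \<le> stages M"
    with Suc.prems have "\<forall>\<^sub>F \<tau> in at_right 0. \<forall>x. v \<mu> \<tau> differentiable at x"
      "\<forall>\<^sub>F \<tau> in at_right 0. \<forall>x. w \<mu> \<tau> differentiable at x" by (simp_all add: diffbl_def)
    thus "\<forall>\<^sub>F \<tau> in at_right 0. (\<lambda>x. pd e (v \<mu> \<tau>) x * w \<mu> \<tau> x + v \<mu> \<tau> x * pd e (w \<mu> \<tau>) x)
      = pd e (\<lambda>x. v \<mu> \<tau> x * w \<mu> \<tau> x)"
      by eventually_elim (auto simp: partial_deriv_mult)
  qed
  with Suc.prems show ?case by (auto intro: expands_mult diffbl_mult)
qed

lemma Ck_expands_scalar: "expands q (\<lambda>\<mu> \<tau> _. f \<mu> \<tau>) \<Longrightarrow> Ck_expands k q (\<lambda>\<mu> \<tau> _. f \<mu> \<tau>)"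
proof (induction k arbitrary: f)
  case (Suc k)
  have "Ck_expands k q (\<lambda>_ _ _. 0)" by (rule Suc.IH) (simp add: expands_const_fun)
  with Suc.prems show ?case by (auto simp: diffbl_def partial_deriv_const intro!: always_eventually)
qed simp

lemma Ck_expands_cmult: "Ck_expands k q w \<Longrightarrow> Ck_expands k q (\<lambda>\<mu> \<tau> x. c * w \<mu> \<tau> x)"
  by (intro Ck_expands_mult Ck_expands_scalar expands_const_fun) auto

lemma Ck_expands_sum: "(\<And>i. i \<in> I \<Longrightarrow> Ck_expands k q (w i)) \<Longrightarrow> Ck_expands k q (\<lambda>\<mu> \<tau> x. \<Sum>i\<in>I. w i \<mu> \<tau> x)"
proof (induction I rule: infinite_finite_induct)
  case (insert i I)
  thus ?case using Ck_expands_add by simp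
qed (auto intro!: Ck_expands_scalar expands_const_fun)

lemma expands_bounded_all:
  assumes w: "expands q w"
  shows "\<exists>B. \<forall>\<mu>\<le>stages M. \<forall>\<^sub>F \<tau> in at_right 0. \<forall>x\<in>K. \<bar>w \<mu> \<tau> x\<bar> \<le> B"
proof -
  have "\<forall>\<mu>\<in>{..stages M}. \<exists>B. \<forall>\<^sub>F \<tau> in at_right 0. \<forall>x\<in>K. \<bar>w \<mu> \<tau> x\<bar> \<le> B"
    using expands_bounded[OF w] by (auto simp: bigO_def)
  then obtain B where B: "\<And>\<mu>. \<mu> \<le> stages M \<Longrightarrow> \<forall>\<^sub>F \<tau> in at_right 0. \<forall>x\<in>K. \<bar>w \<mu> \<tau> x\<bar> \<le> B \<mu>"
    unfolding bchoice_iff by auto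
  have "B \<mu> \<le> Max (B ` {..stages M})" if "\<mu> \<le> stages M" for \<mu>
    using that by (intro Max_ge) auto
  hence "\<forall>\<^sub>F \<tau> in at_right 0. \<forall>x\<in>K. \<bar>w \<mu> \<tau> x\<bar> \<le> Max (B ` {..stages M})" if "\<mu> \<le> stages M" for \<mu>
    using B[OF that] that by (elim eventually_mono) (meson order_trans)
  thus ?thesis by blast
qed

lemma expands_compose_global:
  assumes D: "\<And>k y. (D k has_real_derivative D (Suc k) y) (at y)" and w: "expands q w"
  shows "expands q (\<lambda>\<mu> \<tau> x. D 0 (w \<mu> \<tau> x))"
proof -
  from expands_bounded_all[OF w] obtain B where
    *: "\<And>\<mu>. \<mu> \<le> stages M \<Longrightarrow> \<forall>\<^sub>F \<tau> in at_right 0. \<forall>x\<in>K. \<bar>w \<mu> \<tau> x\<bar> \<le> B" by blast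
  have **: "- B \<le> y \<and> y \<le> B" if "\<bar>y\<bar> \<le> B" for y :: real using that by linarith
  have "\<forall>\<^sub>F \<tau> in at_right 0. \<forall>x\<in>K. - B \<le> w \<mu> \<tau> x \<and> w \<mu> \<tau> x \<le> B" if "\<mu> \<le> stages M" for \<mu>
    using *[OF that] by (rule eventually_mono) (use ** in blast)
  from expands_compose[of "- B" B D, OF D w this] show ?thesis .
qed

text \<open>The chain rule replaces the sequence \<open>D\<close> by its shift, so the induction
  runs over all such sequences.\<close>

lemma Ck_expands_compose:
  assumes "\<And>k y. (D k has_real_derivative D (Suc k) y) (at y)" "Ck_expands k q w"
  shows "Ck_expands k q (\<lambda>\<mu> \<tau> x. D 0 (w \<mu> \<tau> x))"
  using assms
proof (induction k arbitrary: D)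
  case 0
  thus ?case using expands_compose_global[of D, OF 0(1)] by simp
next
  case (Suc k)
  have "Ck_expands k q (\<lambda>\<mu> \<tau>. pd e (\<lambda>x. D 0 (w \<mu> \<tau> x)))" if e: "e \<in> Basis" for e
  proof (rule Ck_expands_cong)
    have "Ck_expands k q (\<lambda>\<mu> \<tau> x. D 1 (w \<mu> \<tau> x))"
      using Suc.IH[of "\<lambda>k. D (Suc k)", OF Suc.prems(1) Ck_expands_Suc[OF Suc.prems(2)]] by simp
    thus "Ck_expands k q (\<lambda>\<mu> \<tau> x. D 1 (w \<mu> \<tau> x) * pd e (w \<mu> \<tau>) x)"
      using Suc.prems(2) e by (intro Ck_expands_mult) simp_all
    fix \<mu> assume \<mu>: "\<mu> \<le> stages M"
    with Suc.prems have "\<forall>\<^sub>F \<tau> in at_right 0. \<forall>x. w \<mu> \<tau> differentiable at x" by (simp_all add: diffbl_def)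
    thus "\<forall>\<^sub>F \<tau> in at_right 0. (\<lambda>x. D 1 (w \<mu> \<tau> x) * pd e (w \<mu> \<tau>) x)
      = pd e (\<lambda>x. D 0 (w \<mu> \<tau> x))"
    proof eventually_elim
      case (elim \<tau>)
      have "pd e (\<lambda>x. D 0 (w \<mu> \<tau> x)) x = D 1 (w \<mu> \<tau> x) * pd e (w \<mu> \<tau>) x" for x
        using partial_deriv_compose[OF elim[rule_format] Suc.prems(1)[of 0]] by simp
      thus ?case by auto
    qed
  qed
  moreover have "diffbl (\<lambda>\<mu> \<tau> x. D 0 (w \<mu> \<tau> x))"
    unfolding diffbl_def
  proof (intro allI impI)
    fix \<mu> assume "\<mu> \<le> stages M"
    with Suc.prems(2) have "\<forall>\<^sub>F \<tau> in at_right 0. \<forall>x. w \<mu> \<tau> differentiable at x" by (simp add: diffbl_def)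
    thus "\<forall>\<^sub>F \<tau> in at_right 0. \<forall>x. (\<lambda>x. D 0 (w \<mu> \<tau> x)) differentiable at x"
    proof (rule eventually_mono, intro allI)
      fix \<tau> x assume "\<forall>x. w \<mu> \<tau> differentiable at x"
      hence "w \<mu> \<tau> differentiable at x" ..
      from differentiable_compose_real[OF this Suc.prems(1)]
      show "(\<lambda>x. D 0 (w \<mu> \<tau> x)) differentiable at x" .
    qed
  qed
  moreover have "expands q (\<lambda>\<mu> \<tau> x. D 0 (w \<mu> \<tau> x))"
    by (rule expands_compose_global[of D, OF Suc.prems(1) Ck_expands_imp_E[OF Suc.prems(2)]])
  ultimately show ?case by simp
qed

lemma Ck_expands_partial: "(\<And>k. Ck_expands k q w) \<Longrightarrow> e \<in> Basis \<Longrightarrow> Ck_expands k q (\<lambda>\<mu> \<tau>. pd e (w \<mu> \<tau>))"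
  using Ck_expands.simps(2) by blast

lemma Ck_expands_diffbl: "(\<And>k. Ck_expands k q w) \<Longrightarrow> diffbl w"
  using Ck_expands.simps(2) by blast

text \<open>Connects derivatives indexed by lists, as in the definition of smoothness, with the
  nested form used by \<open>Ck_expands\<close>.\<close>

lemma Ck_expands_from_iter:
  assumes "\<And>es. set es \<subseteq> Basis \<Longrightarrow> expands q (\<lambda>\<mu> \<tau>. iter_pd es (w \<mu> \<tau>)) \<and> diffbl (\<lambda>\<mu> \<tau>. iter_pd es (w \<mu> \<tau>))"
  shows "Ck_expands k q w"
  using assms
proof (induction k arbitrary: w)
  case 0
  from 0[of "[]"] show ?case by (simp add: iter_partial_def)
next
  case (Suc k)
  have "Ck_expands k q (\<lambda>\<mu> \<tau>. pd e (w \<mu> \<tau>))" if "e \<in> Basis" for e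
  proof (rule Suc.IH)
    fix es :: "'a list" assume "set es \<subseteq> Basis"
    \<comment> \<open>A list acts from its right end, so the derivative taken first is
      appended.\<close>
    with Suc.prems[of "es @ [e]"] that
    show "expands q (\<lambda>\<mu> \<tau>. iter_pd es (pd e (w \<mu> \<tau>))) \<and>
          diffbl (\<lambda>\<mu> \<tau>. iter_pd es (pd e (w \<mu> \<tau>)))"
      by (simp add: iter_partial_def)
  qed
  with Suc.prems[of "[]"] show ?case by (simp add: iter_partial_def)
qed

text \<open>The step equations are linear in \<open>z\<close>, \<open>vF\<close>, \<open>vG\<close>,
  so a spatial derivative of \<open>z\<close> satisfies the same equations with differentiated
  right-hand sides. Evolution is assumed for all iterated derivatives, so that the induction can
  pass it on.\<close>

lemma Ck_expands_step:
  assumes "Ck_expands k q vF" "Ck_expands k q vG"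
    and "\<And>es. set es \<subseteq> Basis \<Longrightarrow> evolves (\<lambda>\<tau>. iter_pd es (z 0 \<tau>)) (\<lambda>\<tau>. iter_pd es (\<lambda>x. vF 0 \<tau> x + vG 0 \<tau> x))"
    and "\<And>es x. set es \<subseteq> Basis \<Longrightarrow> iter_pd es (z 0 0) differentiable at x"
    and "diffbl z"
    and "\<And>i. i \<in> {1..stages M} \<Longrightarrow> \<forall>\<^sub>F \<tau> in at_right 0. \<forall>x. z i \<tau> x =
       z 0 0 x + \<tau> * (\<Sum>j=1..i. cA M i j * vF j \<tau> x) + \<tau> * (\<Sum>j=1..<i. cA' M i j * vG j \<tau> x)"
    and "\<And>es. set es \<subseteq> Basis \<Longrightarrow> diffbl (\<lambda>\<mu> \<tau>. iter_pd es (z \<mu> \<tau>))"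
  shows "Ck_expands k (Suc q) z"
  using assms
proof (induction k arbitrary: z vF vG)
  case 0
  have "continuous_on K (z 0 0)"
    using 0(4)[of "[]"] by (simp add: iter_partial_def continuous_at_imp_continuous_on differentiable_imp_continuous_within)
  thus ?case
    using 0(1,2) 0(3)[of "[]"] by (auto simp: iter_partial_def intro!: expands_step[of q vF vG] eventually_mono[OF 0(6)])
next
  case (Suc k)
  have "continuous_on K (z 0 0)"
    using Suc.prems(4)[of "[]"] by (simp add: iter_partial_def continuous_at_imp_continuous_on differentiable_imp_continuous_within)
  hence expands: "expands (Suc q) z"
    using Suc.prems(1,2) Suc.prems(3)[of "[]"] by (auto simp: iter_partial_def intro!: expands_step[of q vF vG] eventually_mono[OF Suc.prems(6)])
  have dF: "\<forall>\<^sub>F \<tau> in at_right 0. \<forall>x. vF \<mu> \<tau> differentiable at x"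
    and dG: "\<forall>\<^sub>F \<tau> in at_right 0. \<forall>x. vG \<mu> \<tau> differentiable at x" if "\<mu> \<le> stages M" for \<mu>
    using Suc.prems(1,2) that by (auto simp: diffbl_def)
  have "Ck_expands k (Suc q) (\<lambda>\<mu> \<tau>. pd e (z \<mu> \<tau>))" if e: "e \<in> Basis" for e
  proof (rule Suc.IH)
    show "Ck_expands k q (\<lambda>\<mu> \<tau>. pd e (vF \<mu> \<tau>))" "Ck_expands k q (\<lambda>\<mu> \<tau>. pd e (vG \<mu> \<tau>))"
      using Suc.prems(1,2) e by simp_all
    fix es :: "'a list" assume es: "set es \<subseteq> Basis"
    show "iter_pd es (pd e (z 0 0)) differentiable at x" for x
      using Suc.prems(4)[of "es @ [e]"] es e by (simp add: iter_partial_def)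
    show "diffbl (\<lambda>\<mu> \<tau>. iter_pd es (pd e (z \<mu> \<tau>)))"
      using Suc.prems(7)[of "es @ [e]"] es e by (simp add: iter_partial_def)
    have 1: "evolves (\<lambda>\<tau>. iter_pd es (pd e (z 0 \<tau>)))
       (\<lambda>\<tau>. iter_pd es (pd e (\<lambda>x. vF 0 \<tau> x + vG 0 \<tau> x)))"
      using Suc.prems(3)[of "es @ [e]"] es e by (simp add: iter_partial_def)
    have 2: "\<forall>\<^sub>F \<tau> in at_right 0. pd e (\<lambda>x. vF 0 \<tau> x + vG 0 \<tau> x) =
       (\<lambda>x. pd e (vF 0 \<tau>) x + pd e (vG 0 \<tau>) x)"
      using dF[OF le0] dG[OF le0] by eventually_elim (auto simp: partial_deriv_add)
    show "evolves (\<lambda>\<tau>. iter_pd es (pd e (z 0 \<tau>)))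
       (\<lambda>\<tau>. iter_pd es (\<lambda>x. pd e (vF 0 \<tau>) x + pd e (vG 0 \<tau>) x))"
    proof -
      \<comment> \<open>The sum rule is available for small \<open>\<tau>\<close> only, so the range
        in \<open>evolves\<close> is shrunk accordingly.\<close>
      from 2 obtain d1 where d1: "d1 > 0" "\<And>\<tau>. 0 < \<tau> \<Longrightarrow> \<tau> < d1 \<Longrightarrow> pd e (\<lambda>x. vF 0 \<tau> x + vG 0 \<tau> x) =
         (\<lambda>x. pd e (vF 0 \<tau>) x + pd e (vG 0 \<tau>) x)"
        unfolding eventually_at_right_field by auto
      from 1 obtain d2 where d2: "d2 > 0"
        "\<And>x. x \<in> K \<Longrightarrow> continuous_on {0..d2} (\<lambda>\<tau>. iter_pd es (pd e (z 0 \<tau>)) x)"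
        "\<And>x \<tau>. x \<in> K \<Longrightarrow> 0 < \<tau> \<Longrightarrow> \<tau> < d2 \<Longrightarrow> ((\<lambda>\<tau>. iter_pd es (pd e (z 0 \<tau>)) x)
          has_real_derivative iter_pd es (pd e (\<lambda>x. vF 0 \<tau> x + vG 0 \<tau> x)) x) (at \<tau>)"
        unfolding evolves_def by auto
      have d3: "((\<lambda>\<tau>. iter_pd es (pd e (z 0 \<tau>)) x)
          has_real_derivative iter_pd es (\<lambda>x. pd e (vF 0 \<tau>) x + pd e (vG 0 \<tau>) x) x) (at \<tau>)"
        if "x \<in> K" "0 < \<tau>" "\<tau> < min d1 d2" for x \<tau>
        using d2(3)[of x \<tau>] d1(2)[of \<tau>] that by simp
      show ?thesis unfolding evolves_def
        by (rule exI[of _ "min d1 d2"])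
          (use d1(1) d2(1) d3 in \<open>auto intro: continuous_on_subset[OF d2(2)]\<close>)
    qed
  next
    show "diffbl (\<lambda>\<mu> \<tau>. pd e (z \<mu> \<tau>))"
      using Suc.prems(7)[of "[e]"] e by (simp add: iter_partial_def)
    fix i assume i: "i \<in> {1..stages M}"
    have "\<forall>\<^sub>F \<tau> in at_right 0. \<forall>j\<in>{1..i}. \<forall>x. vF j \<tau> differentiable at x"
      using dF i by (intro eventually_ball_finite) auto
    moreover have "\<forall>\<^sub>F \<tau> in at_right 0. \<forall>j\<in>{1..i}. \<forall>x. vG j \<tau> differentiable at x"
      using dG i by (intro eventually_ball_finite) auto
    moreover note Suc.prems(6)[OF i]
    ultimately show "\<forall>\<^sub>F \<tau> in at_right 0. \<forall>x. pd e (z i \<tau>) x =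
       pd e (z 0 0) x + \<tau> * (\<Sum>j=1..i. cA M i j * pd e (vF j \<tau>) x)
        + \<tau> * (\<Sum>j=1..<i. cA' M i j * pd e (vG j \<tau>) x)"
    proof eventually_elim
      case (elim \<tau>)
      have z: "z i \<tau> = (\<lambda>x. (z 0 0 x + \<tau> * (\<Sum>j=1..i. cA M i j * vF j \<tau> x)) + \<tau> * (\<Sum>j=1..<i. cA' M i j * vG j \<tau> x))"
        using elim(3) by auto
      have d0: "z 0 0 differentiable at x" for x using Suc.prems(4)[of "[]"] by (simp add: iter_partial_def)
      have dsF: "(\<lambda>x. \<Sum>j=1..i. cA M i j * vF j \<tau> x) differentiable at x" for x
        using elim(1) by (intro differentiable_sum differentiable_mult) auto
      have dsG: "(\<lambda>x. \<Sum>j=1..<i. cA' M i j * vG j \<tau> x) differentiable at x" for x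
        using elim(2) by (intro differentiable_sum differentiable_mult) auto
      show ?case
      proof
        fix x
        have "pd e (z i \<tau>) x = pd e (z 0 0) x +
          \<tau> * pd e (\<lambda>x. \<Sum>j=1..i. cA M i j * vF j \<tau> x) x + \<tau> * pd e (\<lambda>x. \<Sum>j=1..<i. cA' M i j * vG j \<tau> x) x"
          unfolding z using d0 dsF dsG
          by (subst partial_deriv_add partial_deriv_cmult; auto intro!: differentiable_add differentiable_mult)+
        also have "pd e (\<lambda>x. \<Sum>j=1..i. cA M i j * vF j \<tau> x) x = (\<Sum>j=1..i. cA M i j * pd e (vF j \<tau>) x)"
          using elim(1) by (subst partial_deriv_sum) (auto simp: partial_deriv_cmult intro!: differentiable_mult)
        also have "pd e (\<lambda>x. \<Sum>j=1..<i. cA' M i j * vG j \<tau> x) x = (\<Sum>j=1..<i. cA' M i j * pd e (vG j \<tau>) x)"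
          using elim(2) by (subst partial_deriv_sum) (auto simp: partial_deriv_cmult intro!: differentiable_mult)
        finally show "pd e (z i \<tau>) x =
           pd e (z 0 0) x + \<tau> * (\<Sum>j=1..i. cA M i j * pd e (vF j \<tau>) x)
            + \<tau> * (\<Sum>j=1..<i. cA' M i j * pd e (vG j \<tau>) x)" .
      qed
    qed
  qed
  with expands Suc.prems(5) show ?case by simp
qed

end

section \<open>Smooth and periodic functions\<close>

lemma has_derivative_transform_on:
  assumes "(f has_derivative D) (at z within S)" "z \<in> S" "\<And>y. y \<in> S \<Longrightarrow> f y = g y"
  shows "(g has_derivative D) (at z within S)"
  using has_derivative_transform[OF assms(2) _ assms(1), of g] assms(3) by simp

lemma partial_deriv_cong:
  assumes "\<And>z. z \<in> S \<Longrightarrow> f z = g z" "z \<in> S"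
  shows "partial_deriv S e f z = partial_deriv S e g z"
proof -
  have "(f has_derivative D) (at z within S) \<longleftrightarrow> (g has_derivative D) (at z within S)" for D
    using has_derivative_transform[OF assms(2), of f g] has_derivative_transform[OF assms(2), of g f] assms(1) by auto
  thus ?thesis unfolding partial_deriv_def frechet_derivative_def by simp
qed

lemma smooth_on_partial_deriv: "smooth_on S v \<Longrightarrow> e \<in> Basis \<Longrightarrow> smooth_on S (partial_deriv S e v)"
  unfolding smooth_on_def
proof (intro allI impI)
  fix es :: "'a list"
  assume "\<forall>es. set es \<subseteq> Basis \<longrightarrow> iter_partial S es v differentiable_on S" "e \<in> Basis" "set es \<subseteq> Basis"
  from this(1)[rule_format, of "es @ [e]"] this(2,3)
  show "iter_partial S es (partial_deriv S e v) differentiable_on S" by (simp add: iter_partial_def)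
qed

lemma smooth_on_iter_partial: "smooth_on S v \<Longrightarrow> set es \<subseteq> Basis \<Longrightarrow> smooth_on S (iter_partial S es v)"
  by (induction es) (auto simp: iter_partial_def intro: smooth_on_partial_deriv)

lemma smooth_on_imp_differentiable: "smooth_on S v \<Longrightarrow> v differentiable_on S"
  unfolding smooth_on_def by (metis empty_subsetI iter_partial_def foldr_Nil id_apply list.set(1))

lemma smooth_on_imp_continuous: "smooth_on S v \<Longrightarrow> continuous_on S v"
  by (simp add: differentiable_imp_continuous_on smooth_on_imp_differentiable)

lemma smooth_on_has_derivative:
  assumes "smooth_on S v" "z \<in> S"
  shows "(v has_derivative (\<lambda>e. partial_deriv S e v z)) (at z within S)"
  using smooth_on_imp_differentiable[OF assms(1)] assms(2)
  unfolding partial_deriv_def differentiable_on_def by (simp add: frechet_derivative_works[symmetric])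

subsection \<open>Smooth functions on a time slab\<close>

locale slab =
  fixes t0 T :: real
  assumes t0_less_T: "t0 < T"
begin

definition slab :: "(real \<times> 'a::euclidean_space) set" where
  "slab = {t0..T} \<times> UNIV"

lemma mem_slab[simp]: "(t, x) \<in> slab \<longleftrightarrow> t \<in> {t0..T}"
  by (simp add: slab_def)

text \<open>Directions \<open>(0, h)\<close> never leave the slab, so at a fixed time, even at an
  end point, the derivative within the slab becomes a full derivative in space.\<close>

lemma slice_derivative:
  fixes W :: "real \<times> 'a::euclidean_space \<Rightarrow> real"
  assumes "smooth_on slab W" "t \<in> {t0..T}"
  shows "((\<lambda>x. W (t, x)) has_derivative (\<lambda>h. partial_deriv slab (0, h) W (t, x))) (at x)"
proof -
  have g: "((\<lambda>x. (t, x)) has_derivative (\<lambda>h. (0, h))) (at x)"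
    by (auto intro!: derivative_eq_intros)
  have d: "(W has_derivative (\<lambda>e. partial_deriv slab e W (t, x))) (at (t, x) within slab)"
    using assms by (intro smooth_on_has_derivative) auto
  have "range (Pair t) \<subseteq> (slab :: (real \<times> 'a) set)" using assms(2) by auto
  from has_derivative_in_compose[OF g has_derivative_subset[OF d this]] show ?thesis by simp
qed

lemma slice_partial:
  fixes W :: "real \<times> 'a::euclidean_space \<Rightarrow> real"
  assumes "smooth_on slab W" "t \<in> {t0..T}"
  shows "pd e (\<lambda>x. W (t, x)) = (\<lambda>x. partial_deriv slab (0, e) W (t, x))"
  using partial_deriv_eq[OF slice_derivative[OF assms]] by blast

lemma space_Basis: "set es \<subseteq> Basis \<Longrightarrow> set (map (Pair 0) es) \<subseteq> (Basis :: (real \<times> 'a::euclidean_space) set)"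
  by (auto simp: Basis_prod_def)

lemma slice_iter_partial:
  fixes W :: "real \<times> 'a::euclidean_space \<Rightarrow> real"
  assumes "smooth_on slab W" "t \<in> {t0..T}" "set es \<subseteq> Basis"
  shows "iter_pd es (\<lambda>x. W (t, x)) = (\<lambda>x. iter_partial slab (map (Pair 0) es) W (t, x))"
  using assms(3)
proof (induction es)
  case (Cons e es)
  have "smooth_on slab (iter_partial slab (map (Pair 0) es) W)"
    using Cons.prems by (intro smooth_on_iter_partial assms space_Basis) auto
  from slice_partial[OF this assms(2)] Cons show ?case
    by (simp add: iter_partial_def)
qed (simp add: iter_partial_def)

lemma smooth_on_slice:
  fixes W :: "real \<times> 'a::euclidean_space \<Rightarrow> real"
  assumes "smooth_on slab W" "t \<in> {t0..T}"
  shows "smooth_on UNIV (\<lambda>x. W (t, x))"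
  unfolding smooth_on_def
proof (intro allI impI)
  fix es :: "'a list" assume es: "set es \<subseteq> Basis"
  have "smooth_on slab (iter_partial slab (map (Pair 0) es) W)"
    using es by (intro smooth_on_iter_partial assms space_Basis) auto
  from slice_derivative[OF this assms(2)]
  show "iter_pd es (\<lambda>x. W (t, x)) differentiable_on UNIV"
    unfolding slice_iter_partial[OF assms es] differentiable_on_def differentiable_def by blast
qed

lemma time_derivative:
  fixes W :: "real \<times> 'a::euclidean_space \<Rightarrow> real"
  assumes "smooth_on slab W" "t \<in> {t0..T}"
  shows "((\<lambda>s. W (s, x)) has_real_derivative partial_deriv slab (1, 0) W (t, x)) (at t within {t0..T})"
proof -
  have g: "((\<lambda>s. (s, x)) has_derivative (\<lambda>h. (h, 0))) (at t within {t0..T})"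
    by (auto intro!: derivative_eq_intros)
  have d: "(W has_derivative (\<lambda>e. partial_deriv slab e W (t, x))) (at (t, x) within slab)"
    using assms by (intro smooth_on_has_derivative) auto
  have "(\<lambda>s. (s, x)) ` {t0..T} \<subseteq> (slab :: (real \<times> 'a) set)" by auto
  from has_derivative_in_compose[OF g has_derivative_subset[OF d this]]
  have d: "((\<lambda>s. W (s, x)) has_derivative (\<lambda>h. partial_deriv slab (h, 0) W (t, x))) (at t within {t0..T})" .
  have "linear (\<lambda>e. partial_deriv slab e W (t, x))"
    using has_derivative_linear[OF smooth_on_has_derivative[OF assms(1), of "(t, x)"]] assms(2) by simp
  hence L: "partial_deriv slab (h, 0) W (t, x) = partial_deriv slab (1, 0) W (t, x) * h" for h
    using linear_scale[of "\<lambda>e. partial_deriv slab e W (t, x)" h "(1, 0)"] by simp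
  have "(\<lambda>h. partial_deriv slab (h, 0) W (t, x)) = (*) (partial_deriv slab (1, 0) W (t, x))"
    by (rule ext) (rule L)
  with d show ?thesis unfolding has_field_derivative_def by (simp only:)
qed

lemma DERIV_within_unique:
  assumes "(f has_real_derivative D) (at t within {t0..T})" "(f has_real_derivative D') (at t within {t0..T})" "t \<in> {t0..T}"
  shows "D = D'"
  using vector_derivative_unique_within_closed_interval[of t0 T t f D D'] assms t0_less_T
  by (simp add: has_real_derivative_iff_has_vector_derivative)

lemma time_Basis: "(1, 0) \<in> (Basis :: (real \<times> 'a::euclidean_space) set)"
  by (simp add: Basis_prod_def)

text \<open>Symmetry of mixed derivatives, up to and including the end points of the time interval.
  \<open>W\<close> is written as a time integral of its time derivative, differentiated in space
  under the integral sign, and the resulting integral formula for the space derivative is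
  differentiated in time.\<close>

lemma time_space_commute:
  fixes W :: "real \<times> 'a::euclidean_space \<Rightarrow> real"
  assumes W: "smooth_on slab W" and e: "e \<in> Basis" and t: "t \<in> {t0..T}"
  shows "partial_deriv slab (1, 0) (partial_deriv slab (0, e) W) (t, x) =
         partial_deriv slab (0, e) (partial_deriv slab (1, 0) W) (t, x)"
proof -
  let ?G = "partial_deriv slab (1, 0) W"
  let ?V = "partial_deriv slab (0, e) W"
  let ?Ge = "partial_deriv slab (0, e) ?G"
  have e': "(0, e) \<in> (Basis :: (real \<times> 'a) set)" using e by (auto simp: Basis_prod_def)
  have G: "smooth_on slab ?G" by (intro smooth_on_partial_deriv W time_Basis)
  have V: "smooth_on slab ?V" by (intro smooth_on_partial_deriv W e')
  have Ge: "smooth_on slab ?Ge" by (intro smooth_on_partial_deriv G e')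
  \<comment> \<open>Restriction to a line in direction \<open>e\<close>, which makes the
    one-dimensional rule for differentiation under the integral applicable.\<close>
  have line: "((\<lambda>h. X (s, x + h *\<^sub>R e)) has_real_derivative partial_deriv slab (0, e) X (s, x + h *\<^sub>R e)) (at h within UNIV)"
    if X: "smooth_on slab X" and s: "s \<in> {t0..T}" for X s h
  proof -
    let ?D = "\<lambda>k. partial_deriv slab (0, k) X (s, x + h *\<^sub>R e)"
    have g: "((\<lambda>h. x + h *\<^sub>R e) has_derivative (\<lambda>k. k *\<^sub>R e)) (at h)"
      by (auto intro!: derivative_eq_intros)
    have D: "((\<lambda>y. X (s, y)) has_derivative ?D) (at (x + h *\<^sub>R e))"
      by (rule slice_derivative[OF X s])
    have "((\<lambda>h. X (s, x + h *\<^sub>R e)) has_derivative (\<lambda>k. ?D (k *\<^sub>R e))) (at h)"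
      using has_derivative_compose[OF g D] .
    moreover have "?D (k *\<^sub>R e) = ?D e * k" for k
      using linear_scale[OF has_derivative_linear[OF D], of k e] by simp
    ultimately show ?thesis by (simp add: has_field_derivative_def)
  qed
  have int: "?V (s, x) = ?V (t0, x) + integral {t0..s} (\<lambda>\<sigma>. ?Ge (\<sigma>, x))" if s: "s \<in> {t0..T}" for s
  proof -
    have FTC: "W (s, y) - W (t0, y) = integral {t0..s} (\<lambda>\<sigma>. ?G (\<sigma>, y))" for y
    proof -
      have "((\<lambda>\<sigma>. ?G (\<sigma>, y)) has_integral (W (s, y) - W (t0, y))) {t0..s}"
      proof (rule fundamental_theorem_of_calculus)
        fix \<sigma> assume "\<sigma> \<in> {t0..s}"
        with s have "((\<lambda>s. W (s, y)) has_real_derivative ?G (\<sigma>, y)) (at \<sigma> within {t0..s})"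
          by (intro DERIV_subset[OF time_derivative[OF W]]) auto
        thus "((\<lambda>s. W (s, y)) has_vector_derivative ?G (\<sigma>, y)) (at \<sigma> within {t0..s})"
          by (simp only: has_real_derivative_iff_has_vector_derivative)
      qed (use s in auto)
      thus ?thesis by (simp add: integral_unique)
    qed
    have cG: "continuous_on (cbox t0 s) (\<lambda>\<sigma>. ?G (\<sigma>, y))" for y
      using s by (intro continuous_on_compose2[OF smooth_on_imp_continuous[OF G]] continuous_intros) auto
    have "((\<lambda>h. integral (cbox t0 s) (\<lambda>\<sigma>. ?G (\<sigma>, x + h *\<^sub>R e))) has_field_derivative
        integral (cbox t0 s) (\<lambda>\<sigma>. ?Ge (\<sigma>, x + 0 *\<^sub>R e))) (at 0 within UNIV)"
    proof (rule leibniz_rule_field_derivative[where f = "\<lambda>h \<sigma>. ?G (\<sigma>, x + h *\<^sub>R e)" and fx = "\<lambda>h \<sigma>. ?Ge (\<sigma>, x + h *\<^sub>R e)"])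
      show "((\<lambda>h. ?G (\<sigma>, x + h *\<^sub>R e)) has_real_derivative ?Ge (\<sigma>, x + h *\<^sub>R e)) (at h within UNIV)"
        if "\<sigma> \<in> cbox t0 s" for h \<sigma> using line[OF G] that s by auto
      show "(\<lambda>\<sigma>. ?G (\<sigma>, x + h *\<^sub>R e)) integrable_on cbox t0 s" for h
        using cG by (rule integrable_continuous)
      show "continuous_on (UNIV \<times> cbox t0 s) (\<lambda>(h, \<sigma>). ?Ge (\<sigma>, x + h *\<^sub>R e))"
        unfolding split_beta using s
        by (intro continuous_on_compose2[OF smooth_on_imp_continuous[OF Ge]] continuous_intros) auto
    qed auto
    moreover have "integral (cbox t0 s) (\<lambda>\<sigma>. ?G (\<sigma>, x + h *\<^sub>R e)) = W (s, x + h *\<^sub>R e) - W (t0, x + h *\<^sub>R e)" for h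
      using FTC by simp
    ultimately have "((\<lambda>h. W (s, x + h *\<^sub>R e) - W (t0, x + h *\<^sub>R e)) has_field_derivative
        integral {t0..s} (\<lambda>\<sigma>. ?Ge (\<sigma>, x))) (at 0)" by simp
    moreover have "((\<lambda>h. W (s, x + h *\<^sub>R e) - W (t0, x + h *\<^sub>R e)) has_field_derivative ?V (s, x) - ?V (t0, x)) (at 0)"
      using line[OF W s, of 0] line[OF W, of t0 0] t0_less_T by (intro DERIV_diff) auto
    ultimately have "integral {t0..s} (\<lambda>\<sigma>. ?Ge (\<sigma>, x)) = ?V (s, x) - ?V (t0, x)" by (rule DERIV_unique)
    thus ?thesis by simp
  qed
  have "continuous_on {t0..T} (\<lambda>\<sigma>. ?Ge (\<sigma>, x))"
    by (intro continuous_on_compose2[OF smooth_on_imp_continuous[OF Ge]] continuous_intros) auto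
  from DERIV_add[OF DERIV_const integral_has_real_derivative[OF this t], of "?V (t0, x)"]
  have "((\<lambda>s. ?V (t0, x) + integral {t0..s} (\<lambda>\<sigma>. ?Ge (\<sigma>, x))) has_real_derivative ?Ge (t, x)) (at t within {t0..T})"
    by simp
  hence "((\<lambda>s. ?V (s, x)) has_real_derivative ?Ge (t, x)) (at t within {t0..T})"
    unfolding has_field_derivative_def
    by (rule has_derivative_transform_on[OF _ t]) (rule int[symmetric])
  from DERIV_within_unique[OF time_derivative[OF V t, of x] this t] show ?thesis .
qed

lemma time_iter_commute:
  fixes W :: "real \<times> 'a::euclidean_space \<Rightarrow> real"
  assumes W: "smooth_on slab W" and es: "set es \<subseteq> Basis" and z: "z \<in> slab"
  shows "partial_deriv slab (1, 0) (iter_partial slab (map (Pair 0) es) W) z =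
         iter_partial slab (map (Pair 0) es) (partial_deriv slab (1, 0) W) z"
  using es z
proof (induction es arbitrary: z)
  case (Cons e es)
  let ?V = "iter_partial slab (map (Pair 0) es) W"
  have V: "smooth_on slab ?V" using Cons.prems by (intro smooth_on_iter_partial W space_Basis) auto
  obtain t x where z: "z = (t, x)" by (cases z)
  have "partial_deriv slab (1, 0) (partial_deriv slab (0, e) ?V) z = partial_deriv slab (0, e) (partial_deriv slab (1, 0) ?V) z"
    unfolding z using Cons.prems z by (intro time_space_commute V) auto
  also have "\<dots> = partial_deriv slab (0, e) (iter_partial slab (map (Pair 0) es) (partial_deriv slab (1, 0) W)) z"
    using Cons by (intro partial_deriv_cong) auto
  finally show ?case by (simp add: iter_partial_def)
qed (simp add: iter_partial_def)

text \<open>Provides the evolution of every spatial derivative that \<open>Ck_expands_step\<close>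
  demands.\<close>

lemma slab_evolution:
  fixes W :: "real \<times> 'a::euclidean_space \<Rightarrow> real"
  assumes W: "smooth_on slab W" and es: "set es \<subseteq> Basis" and t: "t \<in> {t0..T}"
  shows "((\<lambda>s. iter_pd es (\<lambda>x. W (s, x)) x) has_real_derivative
     iter_pd es (\<lambda>x. partial_deriv slab (1, 0) W (t, x)) x) (at t within {t0..T})"
proof -
  let ?V = "iter_partial slab (map (Pair 0) es) W"
  have V: "smooth_on slab ?V" by (intro smooth_on_iter_partial W space_Basis es)
  have G: "smooth_on slab (partial_deriv slab (1, 0) W)" by (intro smooth_on_partial_deriv W time_Basis)
  have "((\<lambda>s. ?V (s, x)) has_real_derivative iter_partial slab (map (Pair 0) es) (partial_deriv slab (1, 0) W) (t, x)) (at t within {t0..T})"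
    using time_derivative[OF V t, of x] time_iter_commute[OF W es, of "(t, x)"] t by simp
  hence "((\<lambda>s. iter_pd es (\<lambda>x. W (s, x)) x) has_real_derivative
     iter_partial slab (map (Pair 0) es) (partial_deriv slab (1, 0) W) (t, x)) (at t within {t0..T})"
    unfolding has_field_derivative_def
    by (rule has_derivative_transform_on[OF _ t]) (simp add: slice_iter_partial[OF W _ es])
  thus ?thesis by (simp add: slice_iter_partial[OF G t es])
qed

lemma slab_bounded:
  fixes W :: "real \<times> 'a::euclidean_space \<Rightarrow> real"
  assumes W: "smooth_on slab W" and es: "set es \<subseteq> Basis"
  shows "\<exists>B. \<forall>t\<in>{t0..T}. \<forall>x\<in>cbox a b. \<bar>iter_pd es (\<lambda>x. W (t, x)) x\<bar> \<le> B"
proof -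
  let ?V = "iter_partial slab (map (Pair 0) es) W"
  have V: "smooth_on slab ?V" by (intro smooth_on_iter_partial W space_Basis es)
  have "continuous_on ({t0..T} \<times> cbox a b) ?V"
    by (rule continuous_on_subset[OF smooth_on_imp_continuous[OF V]]) (auto simp: slab_def)
  hence "compact (?V ` ({t0..T} \<times> cbox a b))" by (intro compact_continuous_image compact_Times) auto
  then obtain B where "\<forall>y\<in>?V ` ({t0..T} \<times> cbox a b). norm y \<le> B" using compact_imp_bounded bounded_iff by metis
  thus ?thesis by (intro exI[of _ B]) (auto simp: slice_iter_partial[OF W _ es])
qed

end

subsection \<open>Periodic functions\<close>

text \<open>Both sides choose from the same set of derivatives, so the identity also holds where
  \<open>v\<close> is not differentiable, and periodicity passes to derivatives
  unconditionally.\<close>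

lemma partial_deriv_shift:
  "pd e v (x + c) = pd e (\<lambda>y. v (y + c)) x"
proof -
  have "(v has_derivative D) (at (x + c)) \<longleftrightarrow> ((\<lambda>y. v (y + c)) has_derivative D) (at x)" for D
  proof
    assume "(v has_derivative D) (at (x + c))"
    moreover have "((\<lambda>y. y + c) has_derivative (\<lambda>h. h)) (at x)" by (auto intro!: derivative_eq_intros)
    ultimately show "((\<lambda>y. v (y + c)) has_derivative D) (at x)"
      using has_derivative_compose[of "\<lambda>y. y + c" "\<lambda>h. h" x UNIV v D] by simp
  next
    assume "((\<lambda>y. v (y + c)) has_derivative D) (at x)"
    moreover have "((\<lambda>y. y - c) has_derivative (\<lambda>h. h)) (at (x + c))" by (auto intro!: derivative_eq_intros)
    ultimately show "(v has_derivative D) (at (x + c))"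
      using has_derivative_compose[of "\<lambda>y. y - c" "\<lambda>h. h" "x + c" UNIV "\<lambda>y. v (y + c)" D] by simp
  qed
  thus ?thesis unfolding partial_deriv_def frechet_derivative_def by simp
qed

lemma box_periodic_partial:
  assumes "box_periodic a b v"
  shows "box_periodic a b (pd e v)"
  using assms unfolding box_periodic_def by (simp add: partial_deriv_shift)

text \<open>The shifted box is cut along the face \<open>x \<bullet> e = b \<bullet> e\<close>. The
  protruding part, moved back by one period, fills the gap left at the opposite side.\<close>

lemma integral_periodic_shift:
  fixes h :: "'a::euclidean_space \<Rightarrow> real"
  assumes e: "e \<in> Basis" and ab: "\<forall>i\<in>Basis. a \<bullet> i < b \<bullet> i"
    and cont: "continuous_on UNIV h" and per: "\<And>x. h (x + ((b - a) \<bullet> e) *\<^sub>R e) = h x"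
    and c: "0 \<le> c" "c \<le> (b - a) \<bullet> e"
  shows "integral (cbox a b) (\<lambda>x. h (x + c *\<^sub>R e)) = integral (cbox a b) h"
proof -
  let ?L = "(b - a) \<bullet> e"
  have int: "h integrable_on cbox p q" for p q
    by (rule integrable_continuous) (rule continuous_on_subset[OF cont], simp)
  have 1: "cbox (a + c *\<^sub>R e) (b + c *\<^sub>R e) \<inter> {x. x \<bullet> e \<le> b \<bullet> e} = cbox a b \<inter> {x. x \<bullet> e \<ge> a \<bullet> e + c}"
    using e c by (auto simp: mem_box inner_simps inner_Basis split: if_splits) fastforce+
  have 2: "cbox (a + c *\<^sub>R e) (b + c *\<^sub>R e) \<inter> {x. x \<bullet> e \<ge> b \<bullet> e} = cbox (a + ?L *\<^sub>R e) ((b + (c - ?L) *\<^sub>R e) + ?L *\<^sub>R e)"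
    using e c by (auto simp: mem_box inner_simps inner_Basis split: if_splits) fastforce+
  have 3: "cbox a (b + (c - ?L) *\<^sub>R e) = cbox a b \<inter> {x. x \<bullet> e \<le> a \<bullet> e + c}"
    using e c by (auto simp: mem_box inner_simps inner_Basis split: if_splits) fastforce+
  have "integral (cbox a b) (\<lambda>x. h (x + c *\<^sub>R e)) = integral (cbox (a + c *\<^sub>R e) (b + c *\<^sub>R e)) h"
    using integral_shift_cbox_plus[of a b h "c *\<^sub>R e"] by (simp add: o_def add.commute)
  also have "\<dots> = integral (cbox a b \<inter> {x. x \<bullet> e \<ge> a \<bullet> e + c}) h +
     integral (cbox (a + ?L *\<^sub>R e) ((b + (c - ?L) *\<^sub>R e) + ?L *\<^sub>R e)) h"
    using integral_split[OF int e, of "a + c *\<^sub>R e" "b + c *\<^sub>R e" "b \<bullet> e"] unfolding 1 2 .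
  also have "integral (cbox (a + ?L *\<^sub>R e) ((b + (c - ?L) *\<^sub>R e) + ?L *\<^sub>R e)) h = integral (cbox a b \<inter> {x. x \<bullet> e \<le> a \<bullet> e + c}) h"
    using integral_shift_cbox_plus[of a "b + (c - ?L) *\<^sub>R e" h "?L *\<^sub>R e"] per unfolding 3
    by (simp add: o_def add.commute)
  finally show ?thesis using integral_split[OF int e, of a b "a \<bullet> e + c"] by simp
qed

text \<open>The integral of \<open>h (x + c *\<^sub>R e)\<close> over the box is constant in
  \<open>c\<close>, and its derivative at \<open>c = 0\<close>, taken under the integral sign, is
  the integral in question. This replaces an iterated integration in the direction
  \<open>e\<close>.\<close>

lemma integral_partial_periodic:
  fixes h :: "'a::euclidean_space \<Rightarrow> real"
  assumes e: "e \<in> Basis" and ab: "\<forall>i\<in>Basis. a \<bullet> i < b \<bullet> i"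
    and diff: "\<And>x. h differentiable at x" and cont: "continuous_on UNIV (pd e h)"
    and per: "box_periodic a b h"
  shows "integral (cbox a b) (pd e h) = 0"
proof -
  let ?L = "(b - a) \<bullet> e"
  have L: "?L > 0" using ab e by (simp add: inner_diff_left)
  have ch: "continuous_on UNIV h"
    using diff by (simp add: continuous_at_imp_continuous_on differentiable_imp_continuous_within)
  have per': "h (x + ?L *\<^sub>R e) = h x" for x using per e unfolding box_periodic_def by blast
  have der: "((\<lambda>c. h (x + c *\<^sub>R e)) has_real_derivative pd e h (x + c *\<^sub>R e)) (at c within {0..?L})" for c x
  proof -
    let ?D = "\<lambda>k. pd k h (x + c *\<^sub>R e)"
    have D: "(h has_derivative ?D) (at (x + c *\<^sub>R e))"
      using diff unfolding partial_deriv_def by (simp add: frechet_derivative_works[symmetric])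
    have g: "((\<lambda>c. x + c *\<^sub>R e) has_derivative (\<lambda>k. k *\<^sub>R e)) (at c within {0..?L})"
      by (auto intro!: derivative_eq_intros)
    have "?D (k *\<^sub>R e) = ?D e * k" for k
      using linear_scale[OF has_derivative_linear[OF D], of k e] by simp
    with has_derivative_compose[OF g D] show ?thesis by (simp add: has_field_derivative_def)
  qed
  have "((\<lambda>c. integral (cbox a b) (\<lambda>x. h (x + c *\<^sub>R e))) has_field_derivative
      integral (cbox a b) (\<lambda>x. pd e h (x + 0 *\<^sub>R e))) (at 0 within {0..?L})"
  proof (rule leibniz_rule_field_derivative[where f = "\<lambda>c x. h (x + c *\<^sub>R e)" and fx = "\<lambda>c x. pd e h (x + c *\<^sub>R e)"])
    show "(\<lambda>x. h (x + c *\<^sub>R e)) integrable_on cbox a b" for c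
      by (intro integrable_continuous continuous_on_compose2[OF ch] continuous_intros) auto
    show "continuous_on ({0..?L} \<times> cbox a b) (\<lambda>(c, x). pd e h (x + c *\<^sub>R e))"
      unfolding split_beta by (intro continuous_on_compose2[OF cont] continuous_intros) auto
  qed (use der L in auto)
  hence "((\<lambda>c. integral (cbox a b) h) has_real_derivative integral (cbox a b) (pd e h)) (at 0 within {0..?L})"
    unfolding has_field_derivative_def
    by (simp, elim has_derivative_transform_on) (use L integral_periodic_shift[OF e ab ch per'] in auto)
  \<comment> \<open>A constant has derivative 0, and one-sided derivatives at an end point of a
    nondegenerate interval are unique.\<close>
  moreover have "((\<lambda>c. integral (cbox a b) h) has_real_derivative 0) (at 0 within {0..?L})" by simp
  ultimately show ?thesis
    using vector_derivative_unique_within_closed_interval[of 0 ?L 0] L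
    by (metis atLeastAtMost_iff box_real(2) has_real_derivative_iff_has_vector_derivative less_eq_real_def)
qed

lemma integral_by_parts_periodic:
  fixes v w :: "'a::euclidean_space \<Rightarrow> real"
  assumes ab: "\<forall>i\<in>Basis. a \<bullet> i < b \<bullet> i"
    and v: "\<And>x. v differentiable at x" "\<And>e. e \<in> Basis \<Longrightarrow> continuous_on UNIV (pd e v)"
      "box_periodic a b v"
    and w: "\<And>e x. e \<in> Basis \<Longrightarrow> pd e w differentiable at x"
      "\<And>e. e \<in> Basis \<Longrightarrow> continuous_on UNIV (pd e (pd e w))"
      "box_periodic a b w"
  shows "integral (cbox a b) (\<lambda>x. v x * laplacian w x) =
    - (\<Sum>e\<in>Basis. integral (cbox a b) (\<lambda>x. pd e v x * pd e w x))"
proof -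
  have cdiff: "continuous_on UNIV f" if "\<And>x. f differentiable at x" for f :: "'a \<Rightarrow> real"
    using that by (simp add: continuous_at_imp_continuous_on differentiable_imp_continuous_within)
  note cont = cdiff[OF v(1)] v(2) cdiff[OF w(1)] w(2)
  have intg: "f integrable_on cbox a b" if "continuous_on UNIV f" for f :: "'a \<Rightarrow> real"
    by (rule integrable_continuous) (rule continuous_on_subset[OF that], simp)
  have e: "integral (cbox a b) (\<lambda>x. v x * pd e (pd e w) x) =
     - integral (cbox a b) (\<lambda>x. pd e v x * pd e w x)" if e: "e \<in> Basis" for e
  proof -
    let ?h = "\<lambda>x. v x * pd e w x"
    have p: "pd e ?h = (\<lambda>x. pd e v x * pd e w x + v x * pd e (pd e w) x)"
      by (rule ext, rule partial_deriv_mult) (intro v w e)+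
    have "integral (cbox a b) (pd e ?h) = 0"
    proof (rule integral_partial_periodic[OF e ab])
      show "?h differentiable at x" for x by (intro differentiable_mult v w e)
      show "continuous_on UNIV (pd e ?h)" unfolding p by (intro continuous_intros cont e)
      show "box_periodic a b ?h" using v(3) box_periodic_partial[OF w(3), of e] unfolding box_periodic_def by simp
    qed
    moreover have "integral (cbox a b) (pd e ?h) =
      integral (cbox a b) (\<lambda>x. pd e v x * pd e w x) +
      integral (cbox a b) (\<lambda>x. v x * pd e (pd e w) x)"
      unfolding p by (intro integral_add intg continuous_intros cont e)
    ultimately show ?thesis by simp
  qed
  have "integral (cbox a b) (\<lambda>x. v x * laplacian w x) =
    (\<Sum>e\<in>Basis. integral (cbox a b) (\<lambda>x. v x * pd e (pd e w) x))"
    unfolding laplacian_def sum_distrib_left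
    by (intro integral_sum intg continuous_intros cont) auto
  with e show ?thesis by (simp add: sum_negf)
qed

section \<open>Expansions of the stages of the SAV system\<close>

lemma real_partial_deriv:
  fixes f :: "real \<Rightarrow> real"
  assumes "smooth_on S f" "z \<in> S"
  shows "(f has_real_derivative partial_deriv S 1 f z) (at z within S)"
proof -
  let ?D = "\<lambda>e. partial_deriv S e f z"
  have D: "(f has_derivative ?D) (at z within S)" by (rule smooth_on_has_derivative[OF assms])
  have "?D e = ?D 1 * e" for e
    using linear_scale[OF has_derivative_linear[OF D], of e 1] by simp
  hence "?D = (*) (?D 1)" by blast
  with D show ?thesis unfolding has_field_derivative_def by metis
qed

text \<open>Puts a smooth function of one variable into the form of a derivative sequence, as
  \<open>Ck_expands_compose\<close> expects it.\<close>

lemma smooth_on_real_derivs: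
  fixes f :: "real \<Rightarrow> real"
  assumes "smooth_on UNIV f"
  shows "((deriv ^^ k) f has_real_derivative (deriv ^^ Suc k) f y) (at y)"
proof -
  have "smooth_on UNIV ((deriv ^^ k) f)" for k
  proof (induction k)
    case (Suc k)
    from real_partial_deriv[OF Suc]
    have "deriv ((deriv ^^ k) f) = pd 1 ((deriv ^^ k) f)"
      by (intro ext DERIV_imp_deriv) simp
    with smooth_on_partial_deriv[OF Suc, of 1] show ?case by simp
  qed (simp add: assms)
  hence "(deriv ^^ k) f differentiable at y"
    using smooth_on_imp_differentiable differentiable_on_def by (metis UNIV_I)
  hence "((deriv ^^ k) f has_real_derivative deriv ((deriv ^^ k) f) y) (at y)"
    using DERIV_deriv_iff_real_differentiable by blast
  thus ?thesis by simp
qed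

context expansion
begin

text \<open>The inverse square root is smooth only away from 0. This is why
  \<open>expands_compose\<close> works on an interval and why a lower bound uniform in
  \<open>\<tau>\<close> is required.\<close>

lemma expands_inverse_sqrt:
  assumes w: "expands q w" and c: "c > 0"
    and lower: "\<And>\<mu>. \<mu> \<le> stages M \<Longrightarrow> \<forall>\<^sub>F \<tau> in at_right 0. \<forall>x\<in>K. c \<le> w \<mu> \<tau> x"
  shows "expands q (\<lambda>\<mu> \<tau> x. 1 / sqrt (w \<mu> \<tau> x))"
proof -
  from expands_bounded_all[OF w] obtain B where
    B: "\<And>\<mu>. \<mu> \<le> stages M \<Longrightarrow> \<forall>\<^sub>F \<tau> in at_right 0. \<forall>x\<in>K. \<bar>w \<mu> \<tau> x\<bar> \<le> B" by blast
  \<comment> \<open>\<open>D k\<close> is the k-th derivative of \<open>y powr (- 1 / 2)\<close>;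
    the product collects the successive exponents.\<close>
  define D where "D k y = (\<Prod>j<k. - 1 / 2 - real j) * y powr (- 1 / 2 - real k)" for k y
  have D: "(D k has_real_derivative D (Suc k) y) (at y)" if "c \<le> y" for k y
  proof -
    have "((\<lambda>y. y powr (- 1 / 2 - real k)) has_real_derivative (- 1 / 2 - real k) * y powr (- 1 / 2 - real k - 1)) (at y)"
      using that c by (intro has_real_derivative_powr) simp
    from DERIV_cmult[OF this, of "\<Prod>j<k. - 1 / 2 - real j"] show ?thesis
      unfolding D_def[abs_def] by (simp add: algebra_simps)
  qed
  have "expands q (\<lambda>\<mu> \<tau> x. D 0 (w \<mu> \<tau> x))"
  proof (rule expands_compose[of c B D, OF _ w])
    fix \<mu> assume \<mu>: "\<mu> \<le> stages M"
    from lower[OF \<mu>] B[OF \<mu>] show "\<forall>\<^sub>F \<tau> in at_right 0. \<forall>x\<in>K. c \<le> w \<mu> \<tau> x \<and> w \<mu> \<tau> x \<le> B"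
      by eventually_elim (auto simp: abs_le_iff)
  qed (use D in auto)
  moreover have "\<forall>\<^sub>F \<tau> in at_right 0. \<forall>x\<in>K. D 0 (w \<mu> \<tau> x) = 1 / sqrt (w \<mu> \<tau> x)" if "\<mu> \<le> stages M" for \<mu>
    using lower[OF that]
  proof eventually_elim
    case (elim \<tau>)
    have "D 0 y = 1 / sqrt y" if "c \<le> y" for y
      using that c by (simp add: D_def powr_minus_divide powr_half_sqrt)
    with elim show ?case by blast
  qed
  ultimately show ?thesis by (rule expands_cong[rotated])
qed

lemma Ck_expands_laplacian:
  assumes "\<And>k. Ck_expands k q w"
  shows "Ck_expands k q (\<lambda>\<mu> \<tau>. laplacian (w \<mu> \<tau>))"
proof -
  have "Ck_expands k q (\<lambda>\<mu> \<tau> x. \<Sum>e\<in>Basis. pd e (pd e (w \<mu> \<tau>)) x)"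
    by (intro Ck_expands_sum Ck_expands_partial assms)
  thus ?thesis by (simp add: laplacian_def[abs_def])
qed

text \<open>Repeats one component at every index, so that the calculus for whole vectors applies to
  a single stage while other stages are not yet controlled. At order 0 this costs nothing, since
  only boundedness is involved.\<close>

lemma Ck_expands_fix:
  assumes "Ck_expands k 0 w" "j \<le> stages M"
  shows "Ck_expands k 0 (\<lambda>_. w j)"
  using assms(1)
proof (induction k arbitrary: w)
  case 0
  thus ?case using expands_bounded assms(2) by (auto intro: expands_bigO)
next
  case (Suc k)
  have "expands 0 (\<lambda>_. w j)" using Suc.prems expands_bounded assms(2) by (auto intro: expands_bigO)
  moreover have "diffbl (\<lambda>_. w j)" using Suc.prems assms(2) by (simp add: diffbl_def)
  moreover have "Ck_expands k 0 (\<lambda>_ \<tau>. pd e (w j \<tau>))" if "e \<in> Basis" for e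
    using Suc.IH[of "\<lambda>\<mu> \<tau>. pd e (w \<mu> \<tau>)"] Suc.prems that by simp
  ultimately show ?case by simp
qed

lemma Ck_expands_continuous:
  assumes "Ck_expands (Suc 0) q w" "\<mu> \<le> stages M"
  shows "\<forall>\<^sub>F \<tau> in at_right 0. continuous_on X (w \<mu> \<tau>)"
proof -
  have "\<forall>\<^sub>F \<tau> in at_right 0. \<forall>x. w \<mu> \<tau> differentiable at x" using assms by (simp add: diffbl_def)
  thus ?thesis
    by eventually_elim (simp add: continuous_at_imp_continuous_on differentiable_imp_continuous_within)
qed

lemma expands_integral_Ck:
  assumes "\<And>k. Ck_expands k q w"
  shows "expands q (\<lambda>\<mu> \<tau> _. integral K (w \<mu> \<tau>))"
  by (rule expands_integral[OF Ck_expands_imp_E[OF assms] Ck_expands_continuous[OF assms]])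

lemma expands_1_diff:
  assumes "expands 1 w" "\<mu> \<le> stages M" "\<mu>' \<le> stages M"
  shows "bigO 1 (\<lambda>\<tau> x. w \<mu> \<tau> x - w \<mu>' \<tau> x)"
proof -
  obtain c where "\<And>\<mu>. \<mu> \<le> stages M \<Longrightarrow> bigO 1 (\<lambda>\<tau> x. w \<mu> \<tau> x - c x)"
    using expands_1_limit[OF assms(1)] by auto
  from bigO_diff[OF this[OF assms(2)] this[OF assms(3)]] show ?thesis by simp
qed

end

section \<open>The operators of the SAV system\<close>

locale sav_expansion = expansion M "lo P" "hi P" for P :: "'a::euclidean_space sav" and M +
  assumes domain: "\<forall>e\<in>Basis. lo P \<bullet> e < hi P \<bullet> e"
    and potential: "smooth_on UNIV (pot P)"
    and mobility: "mob P = (\<lambda>v x. - v x) \<or> mob P = laplacian"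
begin

lemma lo_K: "lo P \<in> K"
  using domain by (auto simp: mem_box intro: less_imp_le)

lemma Ck_expands_mob:
  assumes "\<And>k. Ck_expands k q w"
  shows "Ck_expands k q (\<lambda>\<mu> \<tau>. mob P (w \<mu> \<tau>))"
proof (cases "mob P = laplacian")
  case True
  thus ?thesis using Ck_expands_laplacian[OF assms] by simp
next
  case False
  hence "mob P = (\<lambda>v x. - v x)" using mobility by blast
  thus ?thesis using Ck_expands_cmult[OF assms, of k "- 1"] by simp
qed

text \<open>The premise covers all \<open>k\<close> because level \<open>k\<close> of the conclusion
  consumes two (Allen-Cahn) or four (Cahn-Hilliard) further derivatives of \<open>v\<close>.\<close>

lemma Ck_expands_L:
  assumes "\<And>k. Ck_expands k q v"
  shows "Ck_expands k q (\<lambda>\<mu> \<tau>. sav_L P (v \<mu> \<tau>))"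
  unfolding sav_L_def by (intro Ck_expands_mob Ck_expands_cmult Ck_expands_laplacian assms)

lemma Ck_expands_pot': "Ck_expands k q v \<Longrightarrow> Ck_expands k q (\<lambda>\<mu> \<tau> x. deriv (pot P) (v \<mu> \<tau> x))"
  using Ck_expands_compose[of "\<lambda>k. (deriv ^^ Suc k) (pot P)" k q v] smooth_on_real_derivs[OF potential, of "Suc _"]
  by simp

lemma Ck_expands_pot: "Ck_expands k q v \<Longrightarrow> Ck_expands k q (\<lambda>\<mu> \<tau> x. pot P (v \<mu> \<tau> x))"
  using Ck_expands_compose[of "\<lambda>k. (deriv ^^ k) (pot P)" k q v] smooth_on_real_derivs[OF potential]
  by simp

lemma expands_Q:
  assumes "\<And>k. Ck_expands k q v"
  shows "expands q (\<lambda>\<mu> \<tau> _. sav_Q P (v \<mu> \<tau>))"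
  unfolding sav_Q_def by (intro expands_add expands_const_fun expands_integral_Ck Ck_expands_pot assms) simp

lemma expands_inverse_sqrt_Q:
  assumes "\<And>k. Ck_expands k q v" "c > 0" "\<And>\<mu>. \<mu> \<le> stages M \<Longrightarrow> \<forall>\<^sub>F \<tau> in at_right 0. c \<le> sav_Q P (v \<mu> \<tau>)"
  shows "expands q (\<lambda>\<mu> \<tau> _. 1 / sqrt (sav_Q P (v \<mu> \<tau>)))"
  by (rule expands_inverse_sqrt[OF expands_Q[OF assms(1)] assms(2)]) (rule eventually_mono[OF assms(3)], auto)

lemma Ck_expands_N:
  assumes "\<And>k. Ck_expands k q v" "c > 0" "\<And>\<mu>. \<mu> \<le> stages M \<Longrightarrow> \<forall>\<^sub>F \<tau> in at_right 0. c \<le> sav_Q P (v \<mu> \<tau>)"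
    and \<rho>: "expands q (\<lambda>\<mu> \<tau> _. \<rho> \<mu> \<tau>)"
  shows "Ck_expands k q (\<lambda>\<mu> \<tau>. sav_N P (v \<mu> \<tau>) (\<rho> \<mu> \<tau>))"
proof -
  have "expands q (\<lambda>\<mu> \<tau> _. \<rho> \<mu> \<tau> * (1 / sqrt (sav_Q P (v \<mu> \<tau>))))"
    by (rule expands_mult[OF \<rho> expands_inverse_sqrt_Q[OF assms(1-3)]])
  hence *: "expands q (\<lambda>\<mu> \<tau> _. \<rho> \<mu> \<tau> / sqrt (sav_Q P (v \<mu> \<tau>)))" by simp
  show ?thesis unfolding sav_N_def
    by (intro Ck_expands_mob Ck_expands_mult Ck_expands_pot' assms(1) Ck_expands_scalar *)
qed

lemma expands_Nt:
  assumes "\<And>k. Ck_expands k q v" "c > 0" "\<And>\<mu>. \<mu> \<le> stages M \<Longrightarrow> \<forall>\<^sub>F \<tau> in at_right 0. c \<le> sav_Q P (v \<mu> \<tau>)"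
    and \<rho>: "expands q (\<lambda>\<mu> \<tau> _. \<rho> \<mu> \<tau>)"
  shows "expands q (\<lambda>\<mu> \<tau> _. sav_Nt P (v \<mu> \<tau>) (\<rho> \<mu> \<tau>))"
proof -
  have 1: "expands q (\<lambda>\<mu> \<tau> _. 1 / 2 * (1 / sqrt (sav_Q P (v \<mu> \<tau>))))"
    by (rule expands_cmult[OF expands_inverse_sqrt_Q[OF assms(1-3)]])
  have "Ck_expands k q (\<lambda>\<mu> \<tau> x. deriv (pot P) (v \<mu> \<tau> x) * (sav_L P (v \<mu> \<tau>) x + sav_N P (v \<mu> \<tau>) (\<rho> \<mu> \<tau>) x))" for k
    by (rule Ck_expands_mult[OF Ck_expands_pot'[OF assms(1)] Ck_expands_add[OF Ck_expands_L[OF assms(1)] Ck_expands_N[OF assms]]])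
  from expands_mult[OF 1 expands_integral_Ck[OF this]]
  show ?thesis by (simp add: sav_Nt_def l2_inner_def)
qed

end

section \<open>Bootstrap for the exact solution and the stages\<close>

locale sav_step = sav_expansion P M + slab t0 T for P :: "'a::euclidean_space sav" and M t0 T +
  fixes u :: "real \<Rightarrow> 'a \<Rightarrow> real" and r :: "real \<Rightarrow> real"
    and \<tau>0 :: real and U :: "real \<Rightarrow> nat \<Rightarrow> 'a \<Rightarrow> real" and R :: "real \<Rightarrow> nat \<Rightarrow> real"
  assumes eps: "eps P > 0"
    and tableau: "imex_tableau M"
    and solution: "sav_solution P t0 T u r"
    and \<tau>0: "\<tau>0 > 0" and family: "smooth_stage_family P M \<tau>0 U"
    and rrk: "\<forall>\<tau>\<in>{0<..\<tau>0}. rrk_stages P M \<tau> (u t0) (r t0) (U \<tau>) (R \<tau>)"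
begin

lemma stages_pos: "1 \<le> stages M"
proof (rule ccontr)
  assume "\<not> 1 \<le> stages M"
  hence "(\<Sum>i=1..stages M. cb M i) = 0" by simp
  with tableau show False by (simp add: imex_tableau_def)
qed

definition UU :: "nat \<Rightarrow> real \<Rightarrow> 'a \<Rightarrow> real" where
  "UU \<mu> \<tau> = (if \<mu> = 0 then u (t0 + \<tau>) else U \<tau> \<mu>)"

definition RR :: "nat \<Rightarrow> real \<Rightarrow> real" where
  "RR \<mu> \<tau> = (if \<mu> = 0 then r (t0 + \<tau>) else R \<tau> \<mu>)"

abbreviation LL :: "nat \<Rightarrow> real \<Rightarrow> 'a \<Rightarrow> real" where "LL \<mu> \<tau> \<equiv> sav_L P (UU \<mu> \<tau>)"
abbreviation NN :: "nat \<Rightarrow> real \<Rightarrow> 'a \<Rightarrow> real" where "NN \<mu> \<tau> \<equiv> sav_N P (UU \<mu> \<tau>) (RR \<mu> \<tau>)"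
abbreviation TT :: "nat \<Rightarrow> real \<Rightarrow> real" where "TT \<mu> \<tau> \<equiv> sav_Nt P (UU \<mu> \<tau>) (RR \<mu> \<tau>)"

abbreviation W :: "real \<times> 'a \<Rightarrow> real" where "W \<equiv> \<lambda>(t, x). u t x"

text \<open>Taken as a derivative within the slab and not as the right-hand side of the equation, so
  that its smoothness in space and time is immediate; \<open>ut_eq\<close> identifies the
  two.\<close>

definition ut :: "real \<Rightarrow> 'a \<Rightarrow> real" where
  "ut t x = partial_deriv slab (1, 0) W (t, x)"

definition utt :: "real \<Rightarrow> 'a \<Rightarrow> real" where
  "utt t x = partial_deriv slab (1, 0) (partial_deriv slab (1, 0) W) (t, x)"

lemma smooth_W: "smooth_on slab W"
  using solution by (simp add: sav_solution_def slab_def)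

lemma smooth_Wt: "smooth_on slab (partial_deriv slab (1, 0) W)"
  by (intro smooth_on_partial_deriv smooth_W time_Basis)

lemma smooth_Wtt: "smooth_on slab (partial_deriv slab (1, 0) (partial_deriv slab (1, 0) W))"
  by (intro smooth_on_partial_deriv smooth_Wt time_Basis)

lemma smooth_u: "t \<in> {t0..T} \<Longrightarrow> smooth_on UNIV (u t)"
  using smooth_on_slice[OF smooth_W, of t] by simp

lemma smooth_ut: "t \<in> {t0..T} \<Longrightarrow> smooth_on UNIV (ut t)"
  using smooth_on_slice[OF smooth_Wt, of t] by (simp add: ut_def[abs_def])

lemma u_evolution:
  assumes "set es \<subseteq> Basis" "t \<in> {t0..T}"
  shows "((\<lambda>s. iter_pd es (u s) x) has_real_derivative iter_pd es (ut t) x) (at t within {t0..T})"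
  using slab_evolution[OF smooth_W assms, of x] by (simp add: ut_def[abs_def])

lemma ut_evolution:
  assumes "set es \<subseteq> Basis" "t \<in> {t0..T}"
  shows "((\<lambda>s. iter_pd es (ut s) x) has_real_derivative iter_pd es (utt t) x) (at t within {t0..T})"
  using slab_evolution[OF smooth_Wt assms, of x] by (simp add: ut_def[abs_def] utt_def[abs_def])

lemma ut_eq:
  assumes "t \<in> {t0..T}"
  shows "ut t = (\<lambda>x. sav_L P (u t) x + sav_N P (u t) (r t) x)"
proof
  fix x
  have "((\<lambda>s. u s x) has_real_derivative sav_L P (u t) x + sav_N P (u t) (r t) x) (at t within {t0..T})"
    using solution assms by (simp add: sav_solution_def)
  moreover have "((\<lambda>s. u s x) has_real_derivative ut t x) (at t within {t0..T})"
    using u_evolution[of "[]" t x] assms by (simp add: iter_partial_def)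
  ultimately show "ut t x = sav_L P (u t) x + sav_N P (u t) (r t) x"
    using assms by (intro DERIV_within_unique)
qed

lemma r_evolution:
  "t \<in> {t0..T} \<Longrightarrow> (r has_real_derivative sav_Nt P (u t) (r t)) (at t within {t0..T})"
  using solution by (simp add: sav_solution_def)

lemma ev_time: "\<forall>\<^sub>F \<tau> in at_right 0. t0 + \<tau> \<in> {t0..T} \<and> \<tau> \<in> {0<..\<tau>0}"
  using eventually_at_right_real[of 0 "min (T - t0) \<tau>0"] t0_less_T \<tau>0
  by (auto elim!: eventually_mono)

lemma bigO_time_bounded:
  assumes "\<And>t x. t \<in> {t0..T} \<Longrightarrow> x \<in> K \<Longrightarrow> \<bar>g t x\<bar> \<le> B"
  shows "bigO 0 (\<lambda>\<tau>. g (t0 + \<tau>))"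
  unfolding bigO_def using ev_time assms by (intro exI[of _ B]) (auto elim!: eventually_mono)

text \<open>Derivatives within the closed interval are two-sided in its interior, and continuity
  takes care of the initial time.\<close>

lemma evolves_shift:
  assumes "\<And>t x. t \<in> {t0..T} \<Longrightarrow> x \<in> K \<Longrightarrow> ((\<lambda>s. f s x) has_real_derivative g t x) (at t within {t0..T})"
  shows "evolves (\<lambda>\<tau>. f (t0 + \<tau>)) (\<lambda>\<tau>. g (t0 + \<tau>))"
  unfolding evolves_def
proof (intro exI[of _ "T - t0"] conjI ballI)
  show "T - t0 > 0" using t0_less_T by simp
  fix x assume x: "x \<in> K"
  have "continuous_on {t0..T} (\<lambda>s. f s x)"
    using assms[OF _ x] by (rule DERIV_continuous_on)
  thus "continuous_on {0..T - t0} (\<lambda>\<tau>. f (t0 + \<tau>) x)"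
    by (rule continuous_on_compose2) (auto intro!: continuous_intros)
  fix \<tau> assume \<tau>: "\<tau> \<in> {0<..<T - t0}"
  hence "((\<lambda>s. f s x) has_real_derivative g (t0 + \<tau>) x) (at (t0 + \<tau>) within {t0..T})"
    using x by (intro assms) auto
  hence "((\<lambda>s. f s x) has_real_derivative g (t0 + \<tau>) x) (at (t0 + \<tau>))"
    using \<tau> by (simp add: at_within_Icc_at)
  thus "((\<lambda>\<tau>. f (t0 + \<tau>) x) has_real_derivative g (t0 + \<tau>) x) (at \<tau>)"
    by (simp add: DERIV_shift add.commute)
qed

lemma evolves_cong:
  assumes "evolves z G" "\<forall>\<^sub>F \<tau> in at_right 0. \<forall>x\<in>K. G \<tau> x = H \<tau> x"
  shows "evolves z H"
proof -
  from assms(1) obtain d where d: "d > 0" "\<And>x. x \<in> K \<Longrightarrow> continuous_on {0..d} (\<lambda>\<tau>. z \<tau> x)"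
    "\<And>x \<tau>. x \<in> K \<Longrightarrow> 0 < \<tau> \<Longrightarrow> \<tau> < d \<Longrightarrow> ((\<lambda>\<tau>. z \<tau> x) has_real_derivative G \<tau> x) (at \<tau>)"
    unfolding evolves_def by auto
  from assms(2) obtain d1 where d1: "d1 > 0" "\<And>\<tau> x. 0 < \<tau> \<Longrightarrow> \<tau> < d1 \<Longrightarrow> x \<in> K \<Longrightarrow> G \<tau> x = H \<tau> x"
    unfolding eventually_at_right_field by auto
  have "((\<lambda>\<tau>. z \<tau> x) has_real_derivative H \<tau> x) (at \<tau>)" if "x \<in> K" "0 < \<tau>" "\<tau> < min d d1" for x \<tau>
    using d(3)[of x \<tau>] d1(2)[of \<tau> x] that by simp
  thus ?thesis unfolding evolves_def using d(1) d1(1)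
    by (intro exI[of _ "min d d1"]) (auto intro: continuous_on_subset[OF d(2)])
qed

lemma evolves_bigO_1: "evolves z G \<Longrightarrow> bigO 0 G \<Longrightarrow> bigO 1 (\<lambda>\<tau> x. z \<tau> x - z 0 x)"
  using evolves_bigO[of z G 0 "\<lambda>_ _. 0"] by simp

lemma ev_smooth_UU: "\<mu> \<le> stages M \<Longrightarrow> \<forall>\<^sub>F \<tau> in at_right 0. smooth_on UNIV (UU \<mu> \<tau>)"
  using ev_time
proof (rule eventually_mono)
  fix \<tau> assume "\<mu> \<le> stages M" "t0 + \<tau> \<in> {t0..T} \<and> \<tau> \<in> {0<..\<tau>0}"
  thus "smooth_on UNIV (UU \<mu> \<tau>)"
    using family smooth_u[of "t0 + \<tau>"] by (auto simp: UU_def smooth_stage_family_def)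
qed

lemma diffbl_iter_UU:
  assumes "set es \<subseteq> Basis"
  shows "diffbl (\<lambda>\<mu> \<tau>. iter_pd es (UU \<mu> \<tau>))"
  unfolding diffbl_def
proof (intro allI impI)
  fix \<mu> assume "\<mu> \<le> stages M"
  from ev_smooth_UU[OF this] show "\<forall>\<^sub>F \<tau> in at_right 0. \<forall>x. iter_pd es (UU \<mu> \<tau>) differentiable at x"
    by (rule eventually_mono) (use assms in \<open>auto simp: smooth_on_def differentiable_on_def\<close>)
qed

text \<open>The start of the bootstrap: bounds from compactness for the exact solution, and from the
  uniform smoothness of the family for the stages.\<close>

lemma Ck_expands_0_UU: "Ck_expands k 0 UU"
proof (rule Ck_expands_from_iter, intro conjI diffbl_iter_UU expands_bigO)
  fix es :: "'a list" and \<mu> assume es: "set es \<subseteq> Basis" and \<mu>: "\<mu> \<le> stages M"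
  show "bigO 0 (\<lambda>\<tau>. iter_pd es (UU \<mu> \<tau>))"
  proof (cases "\<mu> = 0")
    case True
    obtain B where "\<forall>t\<in>{t0..T}. \<forall>x\<in>K. \<bar>iter_pd es (u t) x\<bar> \<le> B"
      using slab_bounded[OF smooth_W es, of "lo P" "hi P"] by auto
    hence "bigO 0 (\<lambda>\<tau>. iter_pd es (u (t0 + \<tau>)))" by (intro bigO_time_bounded[of _ B]) auto
    with True show ?thesis by (simp add: UU_def)
  next
    case False
    with \<mu> es family obtain B where "\<forall>\<tau>\<in>{0<..\<tau>0}. \<forall>x. \<bar>iter_pd es (U \<tau> \<mu>) x\<bar> \<le> B"
      unfolding smooth_stage_family_def by (metis One_nat_def Suc_leI atLeastAtMost_iff bot_nat_0.not_eq_extremum)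
    with False show ?thesis unfolding bigO_def using ev_time
      by (intro exI[of _ B]) (auto simp: UU_def elim!: eventually_mono)
  qed
qed

definition Q0 :: real where "Q0 = sav_Q P (u t0)"

lemma Q0_pos: "Q0 > 0"
  using solution t0_less_T by (simp add: sav_solution_def Q0_def)

text \<open>First-order closeness to the initial value has to be known before any expansion:
  positivity of \<open>sav_Q\<close> for each single \<open>\<tau>\<close> would allow it to tend to
  0, and then the nonlinear terms need not stay bounded.\<close>

definition near :: "nat \<Rightarrow> bool" where
  "near \<mu> \<longleftrightarrow> bigO 1 (\<lambda>\<tau> x. UU \<mu> \<tau> x - u t0 x) \<and> bigO 1 (\<lambda>\<tau> _. RR \<mu> \<tau> - r t0)"

lemma t0_mem: "t0 \<in> {t0..T}"
  using t0_less_T by simp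

lemma smooth_imp_differentiable_at: "smooth_on UNIV v \<Longrightarrow> (v :: 'a \<Rightarrow> real) differentiable at x"
  using smooth_on_imp_differentiable[of UNIV v] by (simp add: differentiable_on_def)

lemma near_imp_Q:
  assumes "near \<mu>" "\<mu> \<le> stages M"
  shows "\<forall>\<^sub>F \<tau> in at_right 0. Q0 / 2 \<le> sav_Q P (UU \<mu> \<tau>)"
proof -
  \<comment> \<open>An auxiliary vector that compares \<open>u t0\<close> at index 0 with one
    component of \<open>UU\<close> at all other indices; index 1 exists by
    \<open>stages_pos\<close>.\<close>
  define v where "v j \<tau> = (if j = 0 then u t0 else UU \<mu> \<tau>)" for j :: nat and \<tau>
  have cu: "continuous_on X (u t0)" for X
    using smooth_on_imp_continuous[OF smooth_u[OF t0_mem]] by (rule continuous_on_subset) simp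
  have "bigO 1 (\<lambda>\<tau> x. v j \<tau> x - u t0 x)" for j
    using assms(1) by (cases "j = 0") (auto simp: v_def near_def bigO_zero)
  hence "expands 1 (\<lambda>j \<tau> x. u t0 x + (v j \<tau> x - u t0 x))"
    by (intro expands_add expands_const_fun expands_bigO cu)
  hence "expands 1 v" by simp
  moreover have pd: "((deriv ^^ k) (pot P) has_real_derivative (deriv ^^ Suc k) (pot P) y) (at y)" for k y
    by (rule smooth_on_real_derivs[OF potential])
  ultimately have "expands 1 (\<lambda>j \<tau> x. (deriv ^^ 0) (pot P) (v j \<tau> x))"
    by (intro expands_compose_global[where D = "\<lambda>k. (deriv ^^ k) (pot P)"])
  hence "expands 1 (\<lambda>j \<tau> _. integral K (\<lambda>x. (deriv ^^ 0) (pot P) (v j \<tau> x)))"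
  proof (rule expands_integral)
    fix j assume "j \<le> stages M"
    have "continuous_on UNIV (pot P)"
      using smooth_on_imp_continuous[OF potential] .
    moreover have "\<forall>\<^sub>F \<tau> in at_right 0. continuous_on K (v j \<tau>)"
      using ev_smooth_UU[OF assms(2)]
      by (rule eventually_mono) (auto simp: v_def cu intro: continuous_on_subset[OF smooth_on_imp_continuous])
    ultimately show "\<forall>\<^sub>F \<tau> in at_right 0. continuous_on K (\<lambda>x. (deriv ^^ 0) (pot P) (v j \<tau> x))"
      by (elim eventually_mono) (auto intro: continuous_on_compose2)
  qed
  from expands_1_diff[OF this stages_pos, of 0]
  have "bigO 1 (\<lambda>\<tau> (x::'a). sav_Q P (UU \<mu> \<tau>) - Q0)"
    by (simp add: v_def sav_Q_def Q0_def)
  from bigO_1_tendsto[OF this lo_K] have "((\<lambda>\<tau>. sav_Q P (UU \<mu> \<tau>)) \<longlongrightarrow> Q0) (at_right 0)" .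
  from order_tendstoD(1)[OF this, of "Q0 / 2"] Q0_pos show ?thesis
    by (auto elim: eventually_mono)
qed

lemma near_imp_bounded:
  assumes "near \<mu>" "\<mu> \<le> stages M"
  shows "bigO 0 (NN \<mu>)" "bigO 0 (\<lambda>\<tau> _. TT \<mu> \<tau>)"
proof -
  have v: "Ck_expands k 0 (\<lambda>_. UU \<mu>)" for k by (rule Ck_expands_fix[OF Ck_expands_0_UU assms(2)])
  have "bigO 0 (\<lambda>\<tau> _. RR \<mu> \<tau> - r t0)" using assms(1) unfolding near_def by (auto intro: bigO_mono)
  from bigO_add[OF this bigO_const[of "r t0"]] have "bigO 0 (\<lambda>\<tau> _. RR \<mu> \<tau>)" by simp
  hence \<rho>: "expands 0 (\<lambda>_ \<tau> _. RR \<mu> \<tau>)" by (intro expands_bigO)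
  have Q: "Q0 / 2 > 0" using Q0_pos by simp
  have "Ck_expands 0 0 (\<lambda>_. NN \<mu>)" by (rule Ck_expands_N[OF v Q near_imp_Q[OF assms] \<rho>])
  from expands_bounded[OF Ck_expands_imp_E[OF this], of 0] show "bigO 0 (NN \<mu>)" by simp
  have "expands 0 (\<lambda>_ \<tau> _. TT \<mu> \<tau>)" by (rule expands_Nt[OF v Q near_imp_Q[OF assms] \<rho>])
  from expands_bounded[OF this, of 0] show "bigO 0 (\<lambda>\<tau> _. TT \<mu> \<tau>)" by simp
qed

lemma ev_stage:
  assumes "i \<in> {1..stages M}"
  shows "\<forall>\<^sub>F \<tau> in at_right 0. (\<forall>x. UU i \<tau> x = u t0 x + \<tau> * (\<Sum>j=1..i. cA M i j * LL j \<tau> x) + \<tau> * (\<Sum>j=1..<i. cA' M i j * NN j \<tau> x))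
    \<and> RR i \<tau> = r t0 + \<tau> * (\<Sum>j=1..<i. cA' M i j * TT j \<tau>)"
  using ev_time
proof (rule eventually_mono)
  fix \<tau> assume "t0 + \<tau> \<in> {t0..T} \<and> \<tau> \<in> {0<..\<tau>0}"
  hence "rrk_stages P M \<tau> (u t0) (r t0) (U \<tau>) (R \<tau>)" using rrk by blast
  with assms show "(\<forall>x. UU i \<tau> x = u t0 x + \<tau> * (\<Sum>j=1..i. cA M i j * LL j \<tau> x) + \<tau> * (\<Sum>j=1..<i. cA' M i j * NN j \<tau> x))
    \<and> RR i \<tau> = r t0 + \<tau> * (\<Sum>j=1..<i. cA' M i j * TT j \<tau>)"
    by (auto simp: rrk_stages_def UU_def RR_def)
qed

lemma UU_RR_0: "UU 0 0 = u t0" "RR 0 0 = r t0"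
  by (simp_all add: UU_def RR_def)

lemma UU_0: "UU 0 \<tau> = u (t0 + \<tau>)" and RR_0: "RR 0 \<tau> = r (t0 + \<tau>)"
  by (simp_all add: UU_def RR_def)

lemma evolves_UU:
  assumes "set es \<subseteq> Basis"
  shows "evolves (\<lambda>\<tau>. iter_pd es (UU 0 \<tau>)) (\<lambda>\<tau>. iter_pd es (\<lambda>x. LL 0 \<tau> x + NN 0 \<tau> x))"
proof -
  have "evolves (\<lambda>\<tau>. iter_pd es (u (t0 + \<tau>))) (\<lambda>\<tau>. iter_pd es (ut (t0 + \<tau>)))"
    by (rule evolves_shift) (rule u_evolution[OF assms])
  thus ?thesis unfolding UU_0 RR_0
    by (rule evolves_cong) (use ev_time in \<open>auto simp: ut_eq elim!: eventually_mono\<close>)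
qed

lemma evolves_RR: "evolves (\<lambda>\<tau> _. RR 0 \<tau>) (\<lambda>\<tau> _. TT 0 \<tau>)"
  unfolding UU_0 RR_0 using evolves_shift[of "\<lambda>t _. r t" "\<lambda>t _. sav_Nt P (u t) (r t)"] r_evolution by simp

lemma r_smooth: "smooth_on {t0..T} r"
  using solution by (simp add: sav_solution_def)

text \<open>Bounds and derivatives of \<open>sav_Nt\<close> along the solution are thus obtained
  from the smoothness of \<open>r\<close>, without differentiating the nonlocal operator.\<close>

lemma Nt_eq:
  assumes "t \<in> {t0..T}"
  shows "sav_Nt P (u t) (r t) = partial_deriv {t0..T} 1 r t"
  using DERIV_within_unique[OF r_evolution[OF assms] real_partial_deriv[OF r_smooth assms] assms] .

lemma Nt_evolution:
  assumes "t \<in> {t0..T}"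
  shows "((\<lambda>t. sav_Nt P (u t) (r t)) has_real_derivative partial_deriv {t0..T} 1 (partial_deriv {t0..T} 1 r) t) (at t within {t0..T})"
proof -
  have "smooth_on {t0..T} (partial_deriv {t0..T} 1 r)" by (intro smooth_on_partial_deriv r_smooth) simp
  from real_partial_deriv[OF this assms]
  show ?thesis unfolding has_field_derivative_def
    by (rule has_derivative_transform_on[OF _ assms]) (rule Nt_eq[symmetric])
qed

lemma smooth_real_bounded:
  assumes "smooth_on {t0..T} f"
  shows "\<exists>B. \<forall>t\<in>{t0..T}. \<bar>f t\<bar> \<le> B"
  using compact_imp_bounded[OF compact_continuous_image[OF smooth_on_imp_continuous[OF assms] compact_Icc]]
  by (auto simp: bounded_iff)

lemma near_0: "near 0"
proof -
  obtain B where B: "\<forall>t\<in>{t0..T}. \<forall>x\<in>K. \<bar>iter_pd [] (ut t) x\<bar> \<le> B"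
    using slab_bounded[OF smooth_Wt, of "[]" "lo P" "hi P"] by (auto simp: ut_def[abs_def])
  hence "bigO 0 (\<lambda>\<tau>. ut (t0 + \<tau>))" by (intro bigO_time_bounded[of _ B]) (auto simp: iter_partial_def)
  moreover have "evolves (\<lambda>\<tau>. u (t0 + \<tau>)) (\<lambda>\<tau>. ut (t0 + \<tau>))"
    using u_evolution[of "[]"] by (intro evolves_shift) (simp add: iter_partial_def)
  ultimately have 1: "bigO 1 (\<lambda>\<tau> x. u (t0 + \<tau>) x - u t0 x)"
    using evolves_bigO_1[of "\<lambda>\<tau>. u (t0 + \<tau>)"] by simp
  have "smooth_on {t0..T} (partial_deriv {t0..T} 1 r)" by (intro smooth_on_partial_deriv r_smooth) simp
  then obtain B' where B': "\<forall>t\<in>{t0..T}. \<bar>partial_deriv {t0..T} 1 r t\<bar> \<le> B'" using smooth_real_bounded by blast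
  hence "bigO 0 (\<lambda>\<tau> (_::'a). sav_Nt P (u (t0 + \<tau>)) (r (t0 + \<tau>)))"
    by (intro bigO_time_bounded[of "\<lambda>t _. sav_Nt P (u t) (r t)" B']) (simp add: Nt_eq)
  from evolves_bigO_1[OF evolves_RR] this have 2: "bigO 1 (\<lambda>\<tau> _. r (t0 + \<tau>) - r t0)"
    by (simp add: UU_def RR_def)
  show ?thesis using 1 2 by (simp add: near_def UU_def RR_def)
qed

lemma bigO_1_tau: "bigO 0 g \<Longrightarrow> bigO 1 (\<lambda>\<tau> x. \<tau> * g \<tau> x)"
  using bigO_tau_times by force

text \<open>Explicit terms come from earlier stages, which are near by induction and hence bounded.
  Implicit terms, including that of stage \<open>i\<close> itself, involve only the linear operator
  and are bounded by uniform smoothness.\<close>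

lemma near_stage: "i \<le> stages M \<Longrightarrow> near i"
proof (induction i rule: less_induct)
  case (less i)
  show ?case
  proof (cases "i = 0")
    case True
    thus ?thesis using near_0 by simp
  next
    case False
    have L: "bigO 0 (LL j)" if "j \<le> stages M" for j
      using expands_bounded[OF Ck_expands_imp_E[OF Ck_expands_L[OF Ck_expands_0_UU]] that] by simp
    have nb: "bigO 0 (NN j)" "bigO 0 (\<lambda>\<tau> _. TT j \<tau>)" if "j < i" for j
      using near_imp_bounded[OF less.IH] that less.prems by simp_all
    have "bigO 1 (\<lambda>\<tau> x. \<tau> * ((\<Sum>j=1..i. cA M i j * LL j \<tau> x) + (\<Sum>j=1..<i. cA' M i j * NN j \<tau> x)))"
      using less.prems by (intro bigO_1_tau bigO_add bigO_sum bigO_cmult L nb) auto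
    moreover have "bigO 1 (\<lambda>\<tau> _. \<tau> * (\<Sum>j=1..<i. cA' M i j * TT j \<tau>))"
      by (intro bigO_1_tau bigO_sum bigO_cmult nb) auto
    moreover have "\<forall>\<^sub>F \<tau> in at_right 0. \<forall>x\<in>K. \<tau> * ((\<Sum>j=1..i. cA M i j * LL j \<tau> x) + (\<Sum>j=1..<i. cA' M i j * NN j \<tau> x)) = UU i \<tau> x - u t0 x"
      "\<forall>\<^sub>F \<tau> in at_right 0. \<forall>x\<in>K. \<tau> * (\<Sum>j=1..<i. cA' M i j * TT j \<tau>) = RR i \<tau> - r t0"
      using ev_stage[of i] False less.prems by (auto elim!: eventually_mono simp: distrib_left)
    ultimately show ?thesis unfolding near_def using iffD1[OF bigO_cong] by fast
  qed
qed

lemma Ck_expands_NN_step: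
  assumes "\<And>k. Ck_expands k q UU" "expands q (\<lambda>\<mu> \<tau> _. RR \<mu> \<tau>)"
  shows "Ck_expands k q NN" "expands q (\<lambda>\<mu> \<tau> _. TT \<mu> \<tau>)"
proof -
  have Q: "Q0 / 2 > 0" using Q0_pos by simp
  have ev: "\<mu> \<le> stages M \<Longrightarrow> \<forall>\<^sub>F \<tau> in at_right 0. Q0 / 2 \<le> sav_Q P (UU \<mu> \<tau>)" for \<mu>
    by (intro near_imp_Q near_stage)
  show "Ck_expands k q NN" by (rule Ck_expands_N[OF assms(1) Q ev assms(2)])
  show "expands q (\<lambda>\<mu> \<tau> _. TT \<mu> \<tau>)" by (rule expands_Nt[OF assms(1) Q ev assms(2)])
qed

text \<open>Expansions of order \<open>q\<close> of the components carry over to \<open>LL\<close>,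
  \<open>NN\<close> and \<open>TT\<close>; inserting these into the evolution and the stage
  equations gives order \<open>q + 1\<close>. The induction is on \<open>q\<close>, with all
  \<open>k\<close> inside the hypothesis.\<close>

lemma Ck_expands_UU_RR: "(\<forall>k. Ck_expands k q UU) \<and> expands q (\<lambda>\<mu> \<tau> _. RR \<mu> \<tau>)"
proof (induction q)
  case 0
  have "bigO 0 (\<lambda>\<tau> _. RR \<mu> \<tau>)" if "\<mu> \<le> stages M" for \<mu>
  proof -
    have "bigO 0 (\<lambda>\<tau> _. RR \<mu> \<tau> - r t0)" using near_stage[OF that] unfolding near_def by (auto intro: bigO_mono)
    from bigO_add[OF this bigO_const[of "r t0"]] show ?thesis by simp
  qed
  thus ?case using Ck_expands_0_UU by (auto intro: expands_bigO)
next
  case (Suc q)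
  hence IH: "\<And>k. Ck_expands k q UU" "expands q (\<lambda>\<mu> \<tau> _. RR \<mu> \<tau>)" by auto
  have "Ck_expands k (Suc q) UU" for k
  proof (rule Ck_expands_step[OF Ck_expands_L[OF IH(1)] Ck_expands_NN_step(1)[OF IH]])
    fix es :: "'a list" assume es: "set es \<subseteq> Basis"
    show "evolves (\<lambda>\<tau>. iter_pd es (UU 0 \<tau>)) (\<lambda>\<tau>. iter_pd es (\<lambda>x. LL 0 \<tau> x + NN 0 \<tau> x))"
      by (rule evolves_UU[OF es])
    show "iter_pd es (UU 0 0) differentiable at x" for x
      using smooth_u[OF t0_mem] es by (simp add: UU_RR_0 smooth_on_def differentiable_on_def)
    show "diffbl (\<lambda>\<mu> \<tau>. iter_pd es (UU \<mu> \<tau>))" by (rule diffbl_iter_UU[OF es])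
  next
    show "diffbl UU" using diffbl_iter_UU[of "[]"] by (simp add: iter_partial_def)
    fix i assume "i \<in> {1..stages M}"
    from ev_stage[OF this] show "\<forall>\<^sub>F \<tau> in at_right 0. \<forall>x. UU i \<tau> x =
       UU 0 0 x + \<tau> * (\<Sum>j=1..i. cA M i j * LL j \<tau> x) + \<tau> * (\<Sum>j=1..<i. cA' M i j * NN j \<tau> x)"
      unfolding UU_RR_0 by (rule eventually_mono) blast
  qed
  moreover have "expands (Suc q) (\<lambda>\<mu> \<tau> _. RR \<mu> \<tau>)"
  \<comment> \<open>The equation for \<open>r\<close> has no implicit part, hence the zero function
    in the first slot.\<close>
  proof (rule expands_step[of q "\<lambda>_ _ _. 0", OF _ Ck_expands_NN_step(2)[OF IH]])
    show "evolves (\<lambda>\<tau> _. RR 0 \<tau>) (\<lambda>\<tau> _. 0 + TT 0 \<tau>)" using evolves_RR by simp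
    fix i assume "i \<in> {1..stages M}"
    from ev_stage[OF this] show "\<forall>\<^sub>F \<tau> in at_right 0. \<forall>x\<in>K. RR i \<tau> =
       RR 0 0 + \<tau> * (\<Sum>j=1..i. cA M i j * 0) + \<tau> * (\<Sum>j=1..<i. cA' M i j * TT j \<tau>)"
      unfolding UU_RR_0 by (rule eventually_mono) simp
  qed (auto intro: expands_const_fun)
  ultimately show ?case by blast
qed

lemmas Ck_expands_UU = Ck_expands_UU_RR[THEN conjunct1, rule_format]
lemmas expands_RR = Ck_expands_UU_RR[THEN conjunct2]
lemmas Ck_expands_NN = Ck_expands_NN_step(1)[OF Ck_expands_UU expands_RR]
lemmas expands_TT = Ck_expands_NN_step(2)[OF Ck_expands_UU expands_RR]
lemmas Ck_expands_LL = Ck_expands_L[OF Ck_expands_UU]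

end

section \<open>Energy and relaxation coefficient\<close>

context sav_expansion
begin

text \<open>Functions of class C^1, for which the Dirichlet form below is bilinear.\<close>

definition good :: "('a \<Rightarrow> real) \<Rightarrow> bool" where
  "good v \<longleftrightarrow> (\<forall>x. v differentiable at x) \<and> (\<forall>e\<in>Basis. continuous_on UNIV (pd e v))"

text \<open>The Dirichlet form, written in partial derivatives because these are the functions for
  which expansions are available.\<close>

definition grad_inner :: "('a \<Rightarrow> real) \<Rightarrow> ('a \<Rightarrow> real) \<Rightarrow> real" where
  "grad_inner v w = (\<Sum>e\<in>Basis. integral K (\<lambda>x. pd e v x * pd e w x))"

lemma integrable_K: "continuous_on UNIV f \<Longrightarrow> (f :: 'a \<Rightarrow> real) integrable_on K"
  by (rule integrable_continuous) (rule continuous_on_subset, auto)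

lemma good_diff: "good v \<Longrightarrow> v differentiable at x"
  by (simp add: good_def)

lemma good_cont: "good v \<Longrightarrow> e \<in> Basis \<Longrightarrow> continuous_on UNIV (pd e v)"
  by (simp add: good_def)

lemma good_continuous: "good v \<Longrightarrow> continuous_on X v"
  by (simp add: good_def continuous_at_imp_continuous_on differentiable_imp_continuous_within)

lemma good_add:
  assumes "good v" "good w"
  shows "good (\<lambda>x. v x + w x)"
proof -
  have "pd e (\<lambda>x. v x + w x) = (\<lambda>x. pd e v x + pd e w x)" for e
    using assms by (intro ext partial_deriv_add good_diff)
  with assms show ?thesis
    by (auto simp: good_def intro!: differentiable_add continuous_intros)
qed

lemma good_cmult:
  assumes "good v"
  shows "good (\<lambda>x. c * v x)"
proof -
  have "pd e (\<lambda>x. c * v x) = (\<lambda>x. c * pd e v x)" for e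
    using assms by (intro ext partial_deriv_cmult good_diff)
  with assms show ?thesis
    by (auto simp: good_def intro!: differentiable_mult continuous_intros)
qed

lemma good_zero: "good (\<lambda>_. 0)"
  by (simp add: good_def partial_deriv_const)

lemma good_sum: "(\<And>i. i \<in> I \<Longrightarrow> good (v i)) \<Longrightarrow> good (\<lambda>x. \<Sum>i\<in>I. v i x)"
  by (induction I rule: infinite_finite_induct) (auto simp: good_zero intro: good_add)

lemma grad_inner_commute: "grad_inner v w = grad_inner w v"
  by (simp add: grad_inner_def mult.commute)

lemma grad_inner_add_left:
  assumes "good v" "good v'" "good w"
  shows "grad_inner (\<lambda>x. v x + v' x) w = grad_inner v w + grad_inner v' w"
proof -
  have "integral K (\<lambda>x. pd e (\<lambda>x. v x + v' x) x * pd e w x) =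
    integral K (\<lambda>x. pd e v x * pd e w x) + integral K (\<lambda>x. pd e v' x * pd e w x)"
    if e: "e \<in> Basis" for e
  proof -
    have "(\<lambda>x. pd e (\<lambda>x. v x + v' x) x * pd e w x) =
      (\<lambda>x. pd e v x * pd e w x + pd e v' x * pd e w x)"
      using assms by (simp add: partial_deriv_add good_diff distrib_right)
    thus ?thesis using assms e
      by (simp, intro integral_add integrable_K continuous_intros good_cont)
  qed
  thus ?thesis by (simp add: grad_inner_def sum.distrib)
qed

lemma grad_inner_cmult_left: "good v \<Longrightarrow> grad_inner (\<lambda>x. c * v x) w = c * grad_inner v w"
  by (simp add: grad_inner_def partial_deriv_cmult good_diff mult.assoc sum_distrib_left)

lemma grad_inner_add_right: "good v \<Longrightarrow> good w \<Longrightarrow> good w' \<Longrightarrow> grad_inner v (\<lambda>x. w x + w' x) = grad_inner v w + grad_inner v w'"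
  using grad_inner_add_left[of w w' v] by (simp add: grad_inner_commute[of v])

lemma grad_inner_cmult_right: "good w \<Longrightarrow> grad_inner v (\<lambda>x. c * w x) = c * grad_inner v w"
  using grad_inner_cmult_left[of w c v] by (simp add: grad_inner_commute[of v])

lemma grad_inner_diff_left: "good v \<Longrightarrow> good v' \<Longrightarrow> good w \<Longrightarrow> grad_inner (\<lambda>x. v x - v' x) w = grad_inner v w - grad_inner v' w"
  using grad_inner_add_left[of v "\<lambda>x. - 1 * v' x" w] good_cmult[of v' "- 1"] grad_inner_cmult_left[of v' "- 1" w] by simp

lemma grad_inner_zero_right: "grad_inner v (\<lambda>_. 0) = 0"
  by (simp add: grad_inner_def partial_deriv_const)

lemma grad_inner_sum_right:
  assumes "good v" "\<And>i. i \<in> I \<Longrightarrow> good (w i)"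
  shows "grad_inner v (\<lambda>x. \<Sum>i\<in>I. w i x) = (\<Sum>i\<in>I. grad_inner v (w i))"
  using assms(2)
  by (induction I rule: infinite_finite_induct) (auto simp: grad_inner_zero_right grad_inner_add_right assms(1) good_sum)

lemma Ck_expands_good:
  assumes "\<And>k. Ck_expands k q w" "\<mu> \<le> stages M"
  shows "\<forall>\<^sub>F \<tau> in at_right 0. good (w \<mu> \<tau>)"
proof -
  have "\<forall>\<^sub>F \<tau> in at_right 0. \<forall>e\<in>Basis. continuous_on UNIV (pd e (w \<mu> \<tau>))"
    using Ck_expands_continuous[OF Ck_expands_partial[OF assms(1)] assms(2)]
    by (intro eventually_ball_finite) auto
  moreover have "\<forall>\<^sub>F \<tau> in at_right 0. \<forall>x. w \<mu> \<tau> differentiable at x"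
    using Ck_expands_diffbl[OF assms(1)] assms(2) by (simp add: diffbl_def)
  ultimately show ?thesis unfolding good_def by eventually_elim auto
qed

lemma Ck_expands_good_partial:
  assumes "\<And>k. Ck_expands k q w" "\<mu> \<le> stages M"
  shows "\<forall>\<^sub>F \<tau> in at_right 0. \<forall>e\<in>Basis. good (pd e (w \<mu> \<tau>))"
  using Ck_expands_good[OF Ck_expands_partial[OF assms(1)] assms(2)] by (intro eventually_ball_finite) auto

lemma expands_grad_inner:
  assumes "\<And>k. Ck_expands k q v" "\<And>k. Ck_expands k q w"
  shows "expands q (\<lambda>\<mu> \<tau> _. grad_inner (v \<mu> \<tau>) (w \<mu> \<tau>))"
proof -
  have "expands q (\<lambda>\<mu> \<tau> _. integral K (\<lambda>x. pd e (v \<mu> \<tau>) x * pd e (w \<mu> \<tau>) x))" if "e \<in> Basis" for e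
    by (rule expands_integral_Ck[OF Ck_expands_mult[OF Ck_expands_partial[OF assms(1) that] Ck_expands_partial[OF assms(2) that]]])
  thus ?thesis unfolding grad_inner_def by (rule expands_sum)
qed

lemma grad_inner_by_parts:
  assumes "good v" "box_periodic (lo P) (hi P) v" "\<And>e. e \<in> Basis \<Longrightarrow> good (pd e w)" "box_periodic (lo P) (hi P) w"
  shows "integral K (\<lambda>x. v x * laplacian w x) = - grad_inner v w"
  unfolding grad_inner_def using assms
  by (intro integral_by_parts_periodic domain) (auto intro: good_diff good_cont)

lemma grad_inner_grad:
  assumes "good v"
  shows "(l2_norm (lo P) (hi P) (grad v))\<^sup>2 = grad_inner v v"
proof -
  have "grad v x \<bullet> e = pd e v x" if "e \<in> Basis" for x e
    using that by (simp add: grad_def)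
  hence "grad v x \<bullet> grad v x = (\<Sum>e\<in>Basis. pd e v x * pd e v x)" for x
    by (subst euclidean_inner) simp
  hence "l2_inner (lo P) (hi P) (grad v) (grad v) = grad_inner v v"
    unfolding l2_inner_def grad_inner_def using assms
    by (simp, intro integral_sum integrable_K continuous_intros good_cont) auto
  moreover have "l2_inner (lo P) (hi P) (grad v) (grad v) \<ge> 0"
    unfolding l2_inner_def by (cases "(\<lambda>x. grad v x \<bullet> grad v x) integrable_on K")
      (auto intro: integral_nonneg simp: not_integrable_integral)
  ultimately show ?thesis by (simp add: l2_norm_def)
qed

lemma box_periodic_laplacian: "box_periodic (lo P) (hi P) v \<Longrightarrow> box_periodic (lo P) (hi P) (laplacian v)"
  using box_periodic_partial[OF box_periodic_partial, of "lo P" "hi P" v]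
  unfolding box_periodic_def laplacian_def by simp

lemma box_periodic_mob: "box_periodic (lo P) (hi P) v \<Longrightarrow> box_periodic (lo P) (hi P) (mob P v)"
  using mobility box_periodic_laplacian[of v] by (auto simp: box_periodic_def)

lemma box_periodic_L: "box_periodic (lo P) (hi P) v \<Longrightarrow> box_periodic (lo P) (hi P) (sav_L P v)"
  unfolding sav_L_def using box_periodic_laplacian[of v] by (intro box_periodic_mob) (simp add: box_periodic_def)

lemma box_periodic_N: "box_periodic (lo P) (hi P) v \<Longrightarrow> box_periodic (lo P) (hi P) (sav_N P v \<rho>)"
  unfolding sav_N_def by (intro box_periodic_mob) (simp add: box_periodic_def)

text \<open>From \<open>f*f - g*g = (f - g) * (2*f - (f - g))\<close>, which makes boundedness of
  \<open>f\<close> alone sufficient.\<close>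

lemma bigO_square_diff:
  assumes "bigO 0 f" "bigO q (\<lambda>\<tau> x. f \<tau> x - g \<tau> x)"
  shows "bigO q (\<lambda>\<tau> x. f \<tau> x * f \<tau> x - g \<tau> x * g \<tau> x)"
proof -
  have "bigO 0 (\<lambda>\<tau> x. 2 * f \<tau> x - (f \<tau> x - g \<tau> x))"
    by (rule bigO_diff[OF bigO_cmult[OF assms(1)] bigO_mono[OF assms(2)]]) simp
  from bigO_mult[OF assms(2) this] show ?thesis by (simp add: algebra_simps)
qed

lemma bigO_grad_inner_diff:
  assumes bd: "\<And>e. e \<in> Basis \<Longrightarrow> bigO 0 (\<lambda>\<tau>. pd e (v \<tau>))"
    and diff: "\<And>e. e \<in> Basis \<Longrightarrow> bigO q (\<lambda>\<tau> x. pd e (v \<tau>) x - pd e (w \<tau>) x)"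
    and good: "\<forall>\<^sub>F \<tau> in at_right 0. good (v \<tau>) \<and> good (w \<tau>)"
  shows "bigO q (\<lambda>\<tau> _. grad_inner (v \<tau>) (v \<tau>) - grad_inner (w \<tau>) (w \<tau>))"
proof -
  let ?i = "\<lambda>e \<tau> x. pd e (v \<tau>) x * pd e (v \<tau>) x - pd e (w \<tau>) x * pd e (w \<tau>) x"
  have 1: "bigO q (\<lambda>\<tau> _. \<Sum>e\<in>Basis. integral K (?i e \<tau>))"
    by (intro bigO_sum bigO_integral bigO_square_diff bd diff)
  have "\<forall>\<^sub>F \<tau> in at_right 0. \<forall>x\<in>K. (\<Sum>e\<in>Basis. integral K (?i e \<tau>)) =
      grad_inner (v \<tau>) (v \<tau>) - grad_inner (w \<tau>) (w \<tau>)"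
    using good
  proof eventually_elim
    case (elim \<tau>)
    have "integral K (?i e \<tau>) = integral K (\<lambda>x. pd e (v \<tau>) x * pd e (v \<tau>) x) - integral K (\<lambda>x. pd e (w \<tau>) x * pd e (w \<tau>) x)"
      if "e \<in> Basis" for e
      using elim that by (intro integral_diff integrable_K continuous_intros good_cont) auto
    thus ?case by (simp add: grad_inner_def sum_subtractf)
  qed
  from iffD1[OF bigO_cong[OF this] 1] show ?thesis .
qed

definition energy :: "('a \<Rightarrow> real) \<Rightarrow> real \<Rightarrow> real" where
  "energy v \<rho> = (eps P)\<^sup>2 / 2 * grad_inner v v + \<rho>\<^sup>2"

end

context slab
begin

lemma slab_continuous:
  fixes W :: "real \<times> 'a::euclidean_space \<Rightarrow> real"
  assumes W: "smooth_on slab W" and es: "set es \<subseteq> Basis"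
  shows "continuous_on ({t0..T} \<times> X) (\<lambda>(t, x). iter_pd es (\<lambda>x. W (t, x)) x)"
proof -
  let ?V = "iter_partial slab (map (Pair 0) es) W"
  have V: "smooth_on slab ?V" by (intro smooth_on_iter_partial W space_Basis es)
  have "continuous_on ({t0..T} \<times> X) ?V"
    by (rule continuous_on_subset[OF smooth_on_imp_continuous[OF V]]) (auto simp: slab_def)
  thus ?thesis
    by (rule continuous_on_cong[THEN iffD1, rotated 2]) (auto simp: slice_iter_partial[OF W _ es])
qed

end

section \<open>Evolution of the energy, and limits of the increments\<close>

context sav_step
begin

lemma grad_inner_evolution:
  assumes t: "t \<in> {t0..T}"
  shows "((\<lambda>t. grad_inner (u t) (u t)) has_real_derivative 2 * grad_inner (u t) (ut t)) (at t within {t0..T})"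
proof -
  have e: "((\<lambda>t. integral K (\<lambda>x. pd e (u t) x * pd e (u t) x)) has_field_derivative
     integral K (\<lambda>x. 2 * (pd e (u t) x * pd e (ut t) x))) (at t within {t0..T})"
    if e: "e \<in> Basis" for e
  proof (rule leibniz_rule_field_derivative[where f = "\<lambda>t x. pd e (u t) x * pd e (u t) x"
        and fx = "\<lambda>t x. 2 * (pd e (u t) x * pd e (ut t) x)"])
    fix s x assume s: "s \<in> {t0..T}"
    have d: "((\<lambda>s. pd e (u s) x) has_real_derivative pd e (ut s) x) (at s within {t0..T})"
      using u_evolution[of "[e]" s x] e s by (simp add: iter_partial_def)
    from DERIV_mult[OF d d]
    show "((\<lambda>s. pd e (u s) x * pd e (u s) x) has_real_derivative
       2 * (pd e (u s) x * pd e (ut s) x)) (at s within {t0..T})"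
      by (simp add: algebra_simps)
  next
    fix s assume "s \<in> {t0..T}"
    from smooth_on_imp_continuous[OF smooth_on_partial_deriv[OF smooth_u[OF this] e]]
    show "(\<lambda>x. pd e (u s) x * pd e (u s) x) integrable_on K"
      by (intro integrable_K continuous_intros)
  next
    have 1: "continuous_on ({t0..T} \<times> K) (\<lambda>(t, x). pd e (u t) x)"
      using slab_continuous[OF smooth_W, of "[e]" K] e by (simp add: iter_partial_def)
    have 2: "continuous_on ({t0..T} \<times> K) (\<lambda>(t, x). pd e (ut t) x)"
      using slab_continuous[OF smooth_Wt, of "[e]" K] e by (simp add: iter_partial_def ut_def[abs_def])
    show "continuous_on ({t0..T} \<times> K) (\<lambda>(t, x). 2 * (pd e (u t) x * pd e (ut t) x))"
      using continuous_on_mult_left[OF continuous_on_mult[OF 1 2], of 2] by (simp add: split_beta)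
  qed (use t in auto)
  have "((\<lambda>t. grad_inner (u t) (u t)) has_real_derivative (\<Sum>e\<in>Basis. integral K (\<lambda>x. 2 * (pd e (u t) x * pd e (ut t) x)))) (at t within {t0..T})"
    unfolding grad_inner_def by (rule DERIV_sum) (rule e)
  thus ?thesis by (simp add: grad_inner_def sum_distrib_left)
qed

lemma ev_good:
  assumes "\<mu> \<le> stages M"
  shows "\<forall>\<^sub>F \<tau> in at_right 0. good (UU \<mu> \<tau>) \<and> good (LL \<mu> \<tau>) \<and> good (NN \<mu> \<tau>)"
  using Ck_expands_good[OF Ck_expands_UU assms] Ck_expands_good[OF Ck_expands_LL assms] Ck_expands_good[OF Ck_expands_NN assms]
  by eventually_elim auto

lemma ev_good_all: "\<forall>\<^sub>F \<tau> in at_right 0. \<forall>\<mu>\<in>{..stages M}. good (UU \<mu> \<tau>) \<and> good (LL \<mu> \<tau>) \<and> good (NN \<mu> \<tau>)"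
  using ev_good by (intro eventually_ball_finite) auto

lemma good_smooth: "smooth_on UNIV v \<Longrightarrow> good v"
  unfolding good_def
  by (auto intro: smooth_imp_differentiable_at smooth_on_imp_continuous smooth_on_partial_deriv)

text \<open>The energy is treated as one more component of the system. Its rate is grouped into a
  part with \<open>LL\<close> and a part with \<open>NN\<close> and \<open>TT\<close>, so that
  \<open>expands_final\<close> integrates them with \<open>cb\<close> and \<open>cb'\<close>
  respectively.\<close>

lemma energy_evolves:
  "evolves (\<lambda>\<tau> _. energy (u (t0 + \<tau>)) (r (t0 + \<tau>)))
     (\<lambda>\<tau> _. (eps P)\<^sup>2 * grad_inner (UU 0 \<tau>) (LL 0 \<tau>) + ((eps P)\<^sup>2 * grad_inner (UU 0 \<tau>) (NN 0 \<tau>) + 2 * (RR 0 \<tau> * TT 0 \<tau>)))"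
proof -
  have d: "((\<lambda>t. energy (u t) (r t)) has_real_derivative (eps P)\<^sup>2 * grad_inner (u t) (ut t) + 2 * (r t * sav_Nt P (u t) (r t))) (at t within {t0..T})"
    if t: "t \<in> {t0..T}" for t
    unfolding energy_def
    by (rule derivative_eq_intros grad_inner_evolution r_evolution t refl)+ simp
  have "evolves (\<lambda>\<tau> _. energy (u (t0 + \<tau>)) (r (t0 + \<tau>)))
     (\<lambda>\<tau> _. (eps P)\<^sup>2 * grad_inner (u (t0 + \<tau>)) (ut (t0 + \<tau>)) + 2 * (r (t0 + \<tau>) * sav_Nt P (u (t0 + \<tau>)) (r (t0 + \<tau>))))"
    by (rule evolves_shift) (rule d)
  thus ?thesis
  proof (rule evolves_cong)
    show "\<forall>\<^sub>F \<tau> in at_right 0. \<forall>x\<in>K. (eps P)\<^sup>2 * grad_inner (u (t0 + \<tau>)) (ut (t0 + \<tau>)) + 2 * (r (t0 + \<tau>) * sav_Nt P (u (t0 + \<tau>)) (r (t0 + \<tau>)))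
      = (eps P)\<^sup>2 * grad_inner (UU 0 \<tau>) (LL 0 \<tau>) + ((eps P)\<^sup>2 * grad_inner (UU 0 \<tau>) (NN 0 \<tau>) + 2 * (RR 0 \<tau> * TT 0 \<tau>))"
      using ev_good[of 0, simplified] ev_time
      by eventually_elim (auto simp: UU_0 RR_0 ut_eq grad_inner_add_right distrib_left)
  qed
qed

definition incr_u :: "real \<Rightarrow> 'a \<Rightarrow> real" where
  "incr_u \<tau> = rrk_incr_u P M (U \<tau>) (R \<tau>)"

definition incr_r :: "real \<Rightarrow> real" where
  "incr_r \<tau> = rrk_incr_r P M (U \<tau>) (R \<tau>)"

lemma incr_u_eq: "incr_u \<tau> = (\<lambda>x. \<Sum>i=1..stages M. cb M i * LL i \<tau> x + cb' M i * NN i \<tau> x)"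
  by (auto simp: incr_u_def rrk_incr_u_def UU_def RR_def intro!: sum.cong)

lemma incr_r_eq: "incr_r \<tau> = (\<Sum>i=1..stages M. cb' M i * TT i \<tau>)"
  by (auto simp: incr_r_def rrk_incr_r_def UU_def RR_def intro!: sum.cong)

lemma partial_incr_u:
  assumes "\<forall>\<mu>\<in>{..stages M}. good (UU \<mu> \<tau>) \<and> good (LL \<mu> \<tau>) \<and> good (NN \<mu> \<tau>)"
  shows "pd e (incr_u \<tau>) x = (\<Sum>i=1..stages M. cb M i * pd e (LL i \<tau>) x + cb' M i * pd e (NN i \<tau>) x)"
proof -
  have d: "LL i \<tau> differentiable at x" "NN i \<tau> differentiable at x" if "i \<in> {1..stages M}" for i x
    using assms that by (auto intro: good_diff)
  have "pd e (incr_u \<tau>) x = (\<Sum>i=1..stages M. pd e (\<lambda>x. cb M i * LL i \<tau> x + cb' M i * NN i \<tau> x) x)"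
    unfolding incr_u_eq using d by (intro partial_deriv_sum differentiable_add differentiable_mult) auto
  also have "\<dots> = (\<Sum>i=1..stages M. cb M i * pd e (LL i \<tau>) x + cb' M i * pd e (NN i \<tau>) x)"
    using d by (intro sum.cong refl) (simp add: partial_deriv_add partial_deriv_cmult differentiable_mult)
  finally show ?thesis .
qed

lemma good_incr_u:
  assumes "\<forall>\<mu>\<in>{..stages M}. good (UU \<mu> \<tau>) \<and> good (LL \<mu> \<tau>) \<and> good (NN \<mu> \<tau>)"
  shows "good (incr_u \<tau>)"
  unfolding incr_u_eq using assms by (intro good_sum good_add good_cmult) auto

lemma sum_weights: "(\<Sum>i=1..stages M. cb M i) = 1" "(\<Sum>i=1..stages M. cb' M i) = 1"
  using tableau by (simp_all add: imex_tableau_def)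

text \<open>All components share their leading coefficient and the weights sum to 1, so a weighted
  mean over the stages agrees with the exact value to first order.\<close>

lemma weighted_bigO:
  assumes "expands 1 vF" "expands 1 vG"
  shows "bigO 1 (\<lambda>\<tau> x. (\<Sum>i=1..stages M. cb M i * vF i \<tau> x + cb' M i * vG i \<tau> x) - (vF 0 \<tau> x + vG 0 \<tau> x))"
proof -
  have "bigO 1 (\<lambda>\<tau> x. \<Sum>i=1..stages M. cb M i * (vF i \<tau> x - vF 0 \<tau> x) + cb' M i * (vG i \<tau> x - vG 0 \<tau> x))"
    by (intro bigO_sum bigO_add bigO_cmult expands_1_diff assms) auto
  moreover have "(\<Sum>i=1..stages M. cb M i * (f i - f 0) + cb' M i * (g i - g 0)) =
     (\<Sum>i=1..stages M. cb M i * f i + cb' M i * g i) - (f 0 + g 0)" for f g :: "nat \<Rightarrow> real"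
    using sum_weights by (simp add: right_diff_distrib sum.distrib sum_subtractf flip: sum_distrib_right)
  hence "(\<lambda>\<tau> x. \<Sum>i=1..stages M. cb M i * (vF i \<tau> x - vF 0 \<tau> x) + cb' M i * (vG i \<tau> x - vG 0 \<tau> x)) =
     (\<lambda>\<tau> x. (\<Sum>i=1..stages M. cb M i * vF i \<tau> x + cb' M i * vG i \<tau> x) - (vF 0 \<tau> x + vG 0 \<tau> x))"
    by (intro ext)
  ultimately show ?thesis by (simp only:)
qed

lemma ut_near:
  assumes "set es \<subseteq> Basis"
  shows "bigO 1 (\<lambda>\<tau> x. iter_pd es (ut (t0 + \<tau>)) x - iter_pd es (ut t0) x)"
proof -
  obtain B where "\<forall>t\<in>{t0..T}. \<forall>x\<in>K. \<bar>iter_pd es (utt t) x\<bar> \<le> B"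
    using slab_bounded[OF smooth_Wtt assms, of "lo P" "hi P"] by (auto simp: utt_def[abs_def])
  hence "bigO 0 (\<lambda>\<tau>. iter_pd es (utt (t0 + \<tau>)))" by (intro bigO_time_bounded[of _ B]) auto
  moreover have "evolves (\<lambda>\<tau>. iter_pd es (ut (t0 + \<tau>))) (\<lambda>\<tau>. iter_pd es (utt (t0 + \<tau>)))"
    by (rule evolves_shift) (rule ut_evolution[OF assms])
  ultimately show ?thesis using evolves_bigO_1[of "\<lambda>\<tau>. iter_pd es (ut (t0 + \<tau>))"] by simp
qed

text \<open>Serves twice: it identifies the limit of the denominator, and it supplies the extra
  power of \<open>\<tau>\<close> in the relaxation technique.\<close>

lemma incr_u_near: "bigO 1 (\<lambda>\<tau> x. incr_u \<tau> x - ut t0 x)"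
proof -
  have 1: "bigO 1 (\<lambda>\<tau> x. incr_u \<tau> x - (LL 0 \<tau> x + NN 0 \<tau> x))"
    using weighted_bigO[OF Ck_expands_imp_E[OF Ck_expands_LL] Ck_expands_imp_E[OF Ck_expands_NN]] by (simp add: incr_u_eq)
  have 2: "bigO 1 (\<lambda>\<tau> x. ut (t0 + \<tau>) x - ut t0 x)" using ut_near[of "[]"] by (simp add: iter_partial_def)
  have "\<forall>\<^sub>F \<tau> in at_right 0. \<forall>x\<in>K. incr_u \<tau> x - (LL 0 \<tau> x + NN 0 \<tau> x) + (ut (t0 + \<tau>) x - ut t0 x) = incr_u \<tau> x - ut t0 x"
    using ev_time by eventually_elim (simp add: UU_0 RR_0 ut_eq)
  from iffD1[OF bigO_cong[OF this] bigO_add[OF 1 2]] show ?thesis .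
qed

lemma partial_incr_u_near:
  assumes e: "e \<in> Basis"
  shows "bigO 1 (\<lambda>\<tau> x. pd e (incr_u \<tau>) x - pd e (ut t0) x)"
proof -
  let ?F = "\<lambda>\<mu> \<tau>. pd e (LL \<mu> \<tau>)" and ?G = "\<lambda>\<mu> \<tau>. pd e (NN \<mu> \<tau>)"
  have 1: "bigO 1 (\<lambda>\<tau> x. (\<Sum>i=1..stages M. cb M i * ?F i \<tau> x + cb' M i * ?G i \<tau> x) - (?F 0 \<tau> x + ?G 0 \<tau> x))"
    by (rule weighted_bigO[OF Ck_expands_imp_E[OF Ck_expands_partial[OF Ck_expands_LL e]] Ck_expands_imp_E[OF Ck_expands_partial[OF Ck_expands_NN e]]])
  have 2: "bigO 1 (\<lambda>\<tau> x. pd e (ut (t0 + \<tau>)) x - pd e (ut t0) x)"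
    using ut_near[of "[e]"] e by (simp add: iter_partial_def)
  have "\<forall>\<^sub>F \<tau> in at_right 0. \<forall>x\<in>K. (\<Sum>i=1..stages M. cb M i * ?F i \<tau> x + cb' M i * ?G i \<tau> x) - (?F 0 \<tau> x + ?G 0 \<tau> x)
     + (pd e (ut (t0 + \<tau>)) x - pd e (ut t0) x) = pd e (incr_u \<tau>) x - pd e (ut t0) x"
    using ev_time ev_good_all
  proof eventually_elim
    case (elim \<tau>)
    have "good (LL 0 \<tau>)" "good (NN 0 \<tau>)" using elim(2) by auto
    hence "pd e (ut (t0 + \<tau>)) x = ?F 0 \<tau> x + ?G 0 \<tau> x" for x
      using elim(1) by (simp add: ut_eq UU_0 RR_0 partial_deriv_add good_diff)
    thus ?case by (simp add: partial_incr_u[OF elim(2)])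
  qed
  from iffD1[OF bigO_cong[OF this] bigO_add[OF 1 2]] show ?thesis .
qed

lemma incr_r_near: "bigO 1 (\<lambda>\<tau> _. incr_r \<tau> - sav_Nt P (u t0) (r t0))"
proof -
  have 1: "bigO 1 (\<lambda>\<tau> _. incr_r \<tau> - TT 0 \<tau>)"
    using weighted_bigO[of "\<lambda>_ _ _. 0", OF expands_const_fun expands_TT] by (simp add: incr_r_eq)
  let ?r'' = "partial_deriv {t0..T} 1 (partial_deriv {t0..T} 1 r)"
  have "smooth_on {t0..T} ?r''" by (intro smooth_on_partial_deriv r_smooth) simp_all
  then obtain B where "\<forall>t\<in>{t0..T}. \<bar>?r'' t\<bar> \<le> B" using smooth_real_bounded by blast
  hence b: "bigO 0 (\<lambda>\<tau> (_::'a). ?r'' (t0 + \<tau>))" by (intro bigO_time_bounded[of "\<lambda>t _. ?r'' t" B]) simp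
  have "evolves (\<lambda>\<tau> _. TT 0 \<tau>) (\<lambda>\<tau> _. ?r'' (t0 + \<tau>))"
    using evolves_shift[of "\<lambda>t _. sav_Nt P (u t) (r t)" "\<lambda>t _. ?r'' t"] Nt_evolution by (simp add: UU_0 RR_0)
  from evolves_bigO_1[OF this b] have 2: "bigO 1 (\<lambda>\<tau> _. TT 0 \<tau> - sav_Nt P (u t0) (r t0))" by (simp add: UU_0 RR_0)
  from bigO_add[OF 1 2] show ?thesis by simp
qed

end

section \<open>One-step errors and the comparison of energies\<close>

locale sav_order = sav_step +
  fixes p :: nat
  assumes order: "imex_order M p" and p_ge_2: "p \<ge> 2"
    and nondegenerate: "(\<exists>x. sav_L P (u t0) x + sav_N P (u t0) (r t0) x \<noteq> 0) \<or>
       (\<forall>\<^sub>F \<tau> in at_right 0. rrk_D P M (U \<tau>) (R \<tau>) = 0)"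
begin

lemma u_order: "bigO (Suc p) (\<lambda>\<tau> x. u (t0 + \<tau>) x - (u t0 x + \<tau> * incr_u \<tau> x))"
proof -
  have "evolves (UU 0) (\<lambda>\<tau> x. LL 0 \<tau> x + NN 0 \<tau> x)" using evolves_UU[of "[]"] by (simp add: iter_partial_def)
  from expands_final[OF order Ck_expands_imp_E[OF Ck_expands_LL] Ck_expands_imp_E[OF Ck_expands_NN] this] show ?thesis
    by (simp add: UU_0 incr_u_eq)
qed

lemma partial_u_order:
  assumes e: "e \<in> Basis"
  shows "bigO (Suc p) (\<lambda>\<tau> x. pd e (u (t0 + \<tau>)) x - (pd e (u t0) x + \<tau> * pd e (incr_u \<tau>) x))"
proof -
  have "evolves (\<lambda>\<tau>. pd e (UU 0 \<tau>)) (\<lambda>\<tau>. pd e (\<lambda>x. LL 0 \<tau> x + NN 0 \<tau> x))"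
    using evolves_UU[of "[e]"] e by (simp add: iter_partial_def)
  hence "evolves (\<lambda>\<tau>. pd e (UU 0 \<tau>)) (\<lambda>\<tau> x. pd e (LL 0 \<tau>) x + pd e (NN 0 \<tau>) x)"
    by (rule evolves_cong) (rule eventually_mono[OF ev_good_all], simp add: partial_deriv_add good_diff)
  from expands_final[OF order Ck_expands_imp_E[OF Ck_expands_partial[OF Ck_expands_LL e]] Ck_expands_imp_E[OF Ck_expands_partial[OF Ck_expands_NN e]] this]
  have 1: "bigO (Suc p) (\<lambda>\<tau> x. pd e (u (t0 + \<tau>)) x - (pd e (u t0) x +
     \<tau> * (\<Sum>i=1..stages M. cb M i * pd e (LL i \<tau>) x + cb' M i * pd e (NN i \<tau>) x)))"
    by (simp add: UU_0)
  have "\<forall>\<^sub>F \<tau> in at_right 0. \<forall>x\<in>K. pd e (u (t0 + \<tau>)) x - (pd e (u t0) x +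
     \<tau> * (\<Sum>i=1..stages M. cb M i * pd e (LL i \<tau>) x + cb' M i * pd e (NN i \<tau>) x))
     = pd e (u (t0 + \<tau>)) x - (pd e (u t0) x + \<tau> * pd e (incr_u \<tau>) x)"
    using ev_good_all by eventually_elim (simp add: partial_incr_u)
  from iffD1[OF bigO_cong[OF this] 1] show ?thesis .
qed

lemma r_order: "bigO (Suc p) (\<lambda>\<tau> _. r (t0 + \<tau>) - (r t0 + \<tau> * incr_r \<tau>))"
proof -
  have "evolves (\<lambda>\<tau> _. RR 0 \<tau>) (\<lambda>\<tau> _. 0 + TT 0 \<tau>)" using evolves_RR by simp
  from expands_final[OF order expands_const_fun expands_TT this] show ?thesis by (simp add: RR_0 incr_r_eq)
qed

abbreviation energy_quadrature :: "real \<Rightarrow> real" where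
  "energy_quadrature \<tau> \<equiv> (\<Sum>i=1..stages M. cb M i * ((eps P)\<^sup>2 * grad_inner (UU i \<tau>) (LL i \<tau>)) +
        cb' M i * ((eps P)\<^sup>2 * grad_inner (UU i \<tau>) (NN i \<tau>) + 2 * (RR i \<tau> * TT i \<tau>)))"

text \<open>\<open>expands_final\<close> applies to any quantity whose rate has expansions. The
  approximation here integrates the rates at the stages and is different from the energy of the
  update.\<close>

lemma energy_order:
  "bigO (Suc p) (\<lambda>\<tau> _. energy (u (t0 + \<tau>)) (r (t0 + \<tau>)) - (energy (u t0) (r t0) +
     \<tau> * energy_quadrature \<tau>))"
  using expands_final[OF order expands_cmult[OF expands_grad_inner[OF Ck_expands_UU Ck_expands_LL]]
      expands_add[OF expands_cmult[OF expands_grad_inner[OF Ck_expands_UU Ck_expands_NN]] expands_cmult[OF expands_mult[OF expands_RR expands_TT]]] energy_evolves]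
  by simp

text \<open>The energy contains the gradient, so the one-step error of \<open>u\<close> does not
  suffice and that of its partial derivatives is used as well.\<close>

lemma energy_rk:
  "bigO (Suc p) (\<lambda>\<tau> _. energy (u (t0 + \<tau>)) (r (t0 + \<tau>)) - energy (\<lambda>x. u t0 x + \<tau> * incr_u \<tau> x) (r t0 + \<tau> * incr_r \<tau>))"
proof -
  let ?v = "\<lambda>\<tau>. u (t0 + \<tau>)" and ?w = "\<lambda>\<tau> x. u t0 x + \<tau> * incr_u \<tau> x"
  have ev: "\<forall>\<^sub>F \<tau> in at_right 0. good (incr_u \<tau>) \<and> good (?v \<tau>)"
    using ev_good_all by eventually_elim (force intro: good_incr_u simp: UU_0 dest: bspec[of _ _ 0])
  have gu: "good (u t0)" by (intro good_smooth smooth_u t0_mem)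
  have "bigO (Suc p) (\<lambda>\<tau> _. grad_inner (?v \<tau>) (?v \<tau>) - grad_inner (?w \<tau>) (?w \<tau>))"
  proof (rule bigO_grad_inner_diff)
    fix e :: 'a assume e: "e \<in> Basis"
    show "bigO 0 (\<lambda>\<tau>. pd e (?v \<tau>))"
      using expands_bounded[OF Ck_expands_imp_E[OF Ck_expands_partial[OF Ck_expands_UU e]], of 0] by (simp add: UU_0)
    have "\<forall>\<^sub>F \<tau> in at_right 0. \<forall>x\<in>K. pd e (?v \<tau>) x - (pd e (u t0) x + \<tau> * pd e (incr_u \<tau>) x) = pd e (?v \<tau>) x - pd e (?w \<tau>) x"
      using ev by eventually_elim (simp add: partial_deriv_add partial_deriv_cmult good_diff good_cmult gu)
    from iffD1[OF bigO_cong[OF this] partial_u_order[OF e]]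
    show "bigO (Suc p) (\<lambda>\<tau> x. pd e (?v \<tau>) x - pd e (?w \<tau>) x)" .
  next
    show "\<forall>\<^sub>F \<tau> in at_right 0. good (?v \<tau>) \<and> good (?w \<tau>)"
      using ev by eventually_elim (simp add: good_add good_cmult gu)
  qed
  moreover have "bigO 0 (\<lambda>\<tau> _. r (t0 + \<tau>))" using expands_bounded[OF expands_RR, of 0] by (simp add: RR_0)
  hence "bigO (Suc p) (\<lambda>\<tau> _. r (t0 + \<tau>) * r (t0 + \<tau>) - (r t0 + \<tau> * incr_r \<tau>) * (r t0 + \<tau> * incr_r \<tau>))"
    by (intro bigO_square_diff r_order)
  ultimately have "bigO (Suc p) (\<lambda>\<tau> _. (eps P)\<^sup>2 / 2 * (grad_inner (?v \<tau>) (?v \<tau>) - grad_inner (?w \<tau>) (?w \<tau>))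
     + (r (t0 + \<tau>) * r (t0 + \<tau>) - (r t0 + \<tau> * incr_r \<tau>) * (r t0 + \<tau> * incr_r \<tau>)))"
    by (intro bigO_add[OF bigO_cmult])
  thus ?thesis by (simp add: energy_def right_diff_distrib power2_eq_square add_diff_add)
qed

definition numer :: "real \<Rightarrow> real" where
  "numer \<tau> = (\<Sum>i=1..stages M.
      (eps P)\<^sup>2 * l2_inner (lo P) (hi P) (\<lambda>x. u t0 x - U \<tau> i x)
         (laplacian (\<lambda>x. cb M i * sav_L P (U \<tau> i) x + cb' M i * sav_N P (U \<tau> i) (R \<tau> i) x))
      - 2 * (r t0 - R \<tau> i) * cb' M i * sav_Nt P (U \<tau> i) (R \<tau> i))"

definition denom :: "real \<Rightarrow> real" where
  "denom \<tau> = rrk_D P M (U \<tau>) (R \<tau>)"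

lemma ev_denom: "\<forall>\<^sub>F \<tau> in at_right 0. denom \<tau> = (eps P)\<^sup>2 / 2 * grad_inner (incr_u \<tau>) (incr_u \<tau>) + (incr_r \<tau>)\<^sup>2"
  using ev_good_all
  by eventually_elim (simp add: denom_def rrk_D_def grad_inner_grad[OF good_incr_u] flip: incr_u_def incr_r_def)

lemma periodic_u: "t \<in> {t0..T} \<Longrightarrow> box_periodic (lo P) (hi P) (u t)"
  using solution by (simp add: sav_solution_def)

lemma ev_periodic:
  assumes "i \<in> {1..stages M}"
  shows "\<forall>\<^sub>F \<tau> in at_right 0. box_periodic (lo P) (hi P) (UU i \<tau>)"
  using ev_time by (rule eventually_mono) (use family assms in \<open>auto simp: UU_def smooth_stage_family_def\<close>)

text \<open>Integration by parts removes the Laplacian. The part with the stage is a term of the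
  energy quadrature; the part with \<open>u t0\<close> belongs to the linear coefficient of the
  energy along the update direction.\<close>

lemma numer_summand:
  assumes i: "i \<in> {1..stages M}"
  shows "\<forall>\<^sub>F \<tau> in at_right 0. l2_inner (lo P) (hi P) (\<lambda>x. u t0 x - U \<tau> i x)
         (laplacian (\<lambda>x. cb M i * sav_L P (U \<tau> i) x + cb' M i * sav_N P (U \<tau> i) (R \<tau> i) x)) =
      cb M i * grad_inner (UU i \<tau>) (LL i \<tau>) + cb' M i * grad_inner (UU i \<tau>) (NN i \<tau>)
       - grad_inner (u t0) (\<lambda>x. cb M i * LL i \<tau> x + cb' M i * NN i \<tau> x)"
proof -
  have i': "i \<le> stages M" "i \<noteq> 0" using i by auto
  have "Ck_expands k 0 (\<lambda>\<mu> \<tau> x. cb M i * LL \<mu> \<tau> x + cb' M i * NN \<mu> \<tau> x)" for k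
    by (rule Ck_expands_add[OF Ck_expands_cmult[OF Ck_expands_LL] Ck_expands_cmult[OF Ck_expands_NN]])
  from Ck_expands_good_partial[OF this i'(1)]
  have "\<forall>\<^sub>F \<tau> in at_right 0. \<forall>e\<in>Basis. good (pd e (\<lambda>x. cb M i * LL i \<tau> x + cb' M i * NN i \<tau> x))" .
  thus ?thesis using ev_good[OF i'(1)] ev_periodic[OF i]
  proof eventually_elim
    case (elim \<tau>)
    let ?d = "\<lambda>x. cb M i * LL i \<tau> x + cb' M i * NN i \<tau> x"
    have gu: "good (u t0)" by (intro good_smooth smooth_u t0_mem)
    have gd: "good ?d" using elim(2) by (intro good_add good_cmult) auto
    have gm: "good (\<lambda>x. u t0 x - UU i \<tau> x)"
      using good_add[OF gu good_cmult[of "UU i \<tau>" "- 1"]] elim(2) by simp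
    have pd: "box_periodic (lo P) (hi P) ?d"
      using box_periodic_L[OF elim(3)] box_periodic_N[OF elim(3), of "RR i \<tau>"] by (simp add: box_periodic_def)
    have pm: "box_periodic (lo P) (hi P) (\<lambda>x. u t0 x - UU i \<tau> x)"
      using periodic_u[OF t0_mem] elim(3) by (simp add: box_periodic_def)
    have "integral K (\<lambda>x. (u t0 x - UU i \<tau> x) * laplacian ?d x) = - grad_inner (\<lambda>x. u t0 x - UU i \<tau> x) ?d"
      by (rule grad_inner_by_parts[OF gm pm _ pd]) (use elim(1) in auto)
    also have "\<dots> = grad_inner (UU i \<tau>) ?d - grad_inner (u t0) ?d"
      using grad_inner_diff_left[OF gu _ gd, of "UU i \<tau>"] elim(2) by simp
    also have "grad_inner (UU i \<tau>) ?d = cb M i * grad_inner (UU i \<tau>) (LL i \<tau>) + cb' M i * grad_inner (UU i \<tau>) (NN i \<tau>)"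
      using elim(2) by (simp add: grad_inner_add_right grad_inner_cmult_right good_cmult)
    finally show ?case using i'(2) by (simp add: l2_inner_def UU_def RR_def)
  qed
qed

text \<open>Identifies the numerator as the energy quadrature minus the first-order coefficient of
  the energy polynomial in \<open>energy_quadratic\<close>.\<close>

lemma ev_numer: "\<forall>\<^sub>F \<tau> in at_right 0. numer \<tau> =
   energy_quadrature \<tau>
   - (eps P)\<^sup>2 * grad_inner (u t0) (incr_u \<tau>) - 2 * (r t0 * incr_r \<tau>)"
proof -
  have "\<forall>\<^sub>F \<tau> in at_right 0. \<forall>i\<in>{1..stages M}. l2_inner (lo P) (hi P) (\<lambda>x. u t0 x - U \<tau> i x)
         (laplacian (\<lambda>x. cb M i * sav_L P (U \<tau> i) x + cb' M i * sav_N P (U \<tau> i) (R \<tau> i) x)) =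
      cb M i * grad_inner (UU i \<tau>) (LL i \<tau>) + cb' M i * grad_inner (UU i \<tau>) (NN i \<tau>)
       - grad_inner (u t0) (\<lambda>x. cb M i * LL i \<tau> x + cb' M i * NN i \<tau> x)"
    using numer_summand by (intro eventually_ball_finite) auto
  thus ?thesis using ev_good_all
  proof eventually_elim
    case (elim \<tau>)
    let ?d = "\<lambda>i x. cb M i * LL i \<tau> x + cb' M i * NN i \<tau> x"
    have gu: "good (u t0)" by (intro good_smooth smooth_u t0_mem)
    have gd: "good (?d i)" if "i \<in> {1..stages M}" for i
      using elim(2) that by (intro good_add good_cmult) auto
    have g: "grad_inner (u t0) (incr_u \<tau>) = (\<Sum>i=1..stages M. grad_inner (u t0) (?d i))"
      unfolding incr_u_eq by (rule grad_inner_sum_right[OF gu gd])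
    have "numer \<tau> = (\<Sum>i=1..stages M. (eps P)\<^sup>2 * (cb M i * grad_inner (UU i \<tau>) (LL i \<tau>) + cb' M i * grad_inner (UU i \<tau>) (NN i \<tau>)
       - grad_inner (u t0) (?d i)) - 2 * (r t0 - RR i \<tau>) * cb' M i * TT i \<tau>)"
      unfolding numer_def using elim(1) by (intro sum.cong refl) (simp add: UU_def RR_def)
    also have "\<dots> = (\<Sum>i=1..stages M. (cb M i * ((eps P)\<^sup>2 * grad_inner (UU i \<tau>) (LL i \<tau>)) +
        cb' M i * ((eps P)\<^sup>2 * grad_inner (UU i \<tau>) (NN i \<tau>) + 2 * (RR i \<tau> * TT i \<tau>)))
        - (eps P)\<^sup>2 * grad_inner (u t0) (?d i) - 2 * (r t0 * (cb' M i * TT i \<tau>)))"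
      by (intro sum.cong refl) (simp add: algebra_simps)
    finally show ?case unfolding g incr_r_eq by (simp add: sum_subtractf sum_distrib_left)
  qed
qed

lemma energy_quadratic:
  "\<forall>\<^sub>F \<tau> in at_right 0. energy (\<lambda>x. u t0 x + \<tau> * incr_u \<tau> x) (r t0 + \<tau> * incr_r \<tau>) =
     energy (u t0) (r t0) + \<tau> * ((eps P)\<^sup>2 * grad_inner (u t0) (incr_u \<tau>) + 2 * (r t0 * incr_r \<tau>)) + \<tau> * (\<tau> * denom \<tau>)"
  using ev_good_all ev_denom
proof eventually_elim
  case (elim \<tau>)
  have gu: "good (u t0)" by (intro good_smooth smooth_u t0_mem)
  note gd = good_incr_u[OF elim(1)]
  have "grad_inner (\<lambda>x. u t0 x + \<tau> * incr_u \<tau> x) (\<lambda>x. u t0 x + \<tau> * incr_u \<tau> x) =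
     grad_inner (u t0) (u t0) + 2 * \<tau> * grad_inner (u t0) (incr_u \<tau>) + \<tau> * \<tau> * grad_inner (incr_u \<tau>) (incr_u \<tau>)"
    using gu gd by (simp add: grad_inner_add_left grad_inner_add_right grad_inner_cmult_left grad_inner_cmult_right good_cmult good_add grad_inner_commute[of "incr_u \<tau>" "u t0"])
  thus ?case unfolding elim(2) energy_def by (simp add: power2_eq_square algebra_simps)
qed

text \<open>Both the quadrature and the Runge--Kutta update approximate the exact energy. In the
  difference of the two errors the exact energy cancels, and what remains is this expression by
  \<open>ev_numer\<close> and \<open>energy_quadratic\<close>.\<close>

lemma numer_denom: "bigO (Suc p) (\<lambda>\<tau> _. \<tau> * (\<tau> * denom \<tau> - numer \<tau>))"
proof -
  note d = bigO_diff[OF energy_order energy_rk]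
  have "\<forall>\<^sub>F \<tau> in at_right 0. \<forall>x\<in>K. energy (u (t0 + \<tau>)) (r (t0 + \<tau>)) - (energy (u t0) (r t0) +
     \<tau> * energy_quadrature \<tau>)
     - (energy (u (t0 + \<tau>)) (r (t0 + \<tau>)) - energy (\<lambda>x. u t0 x + \<tau> * incr_u \<tau> x) (r t0 + \<tau> * incr_r \<tau>))
     = \<tau> * (\<tau> * denom \<tau> - numer \<tau>)"
    using ev_numer energy_quadratic
  proof eventually_elim
    case (elim \<tau>)
    show ?case unfolding elim by (simp add: algebra_simps)
  qed
  from iffD1[OF bigO_cong[OF this] d] show ?thesis .
qed

end

section \<open>Nondegeneracy of the denominator\<close>

lemma box_periodic_reduce:
  fixes v :: "'a::euclidean_space \<Rightarrow> real"
  assumes ab: "\<forall>e\<in>Basis. a \<bullet> e < b \<bullet> e" and per: "box_periodic a b v"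
  shows "\<exists>y\<in>cbox a b. v y = v x"
proof -
  have nat: "v (x + (real n * ((b - a) \<bullet> e)) *\<^sub>R e) = v x" if "e \<in> Basis" for x e n
  proof (induction n)
    case (Suc n)
    have "v ((x + (real n * ((b - a) \<bullet> e)) *\<^sub>R e) + ((b - a) \<bullet> e) *\<^sub>R e) = v (x + (real n * ((b - a) \<bullet> e)) *\<^sub>R e)"
      using per that unfolding box_periodic_def by blast
    with Suc show ?case by (simp add: algebra_simps)
  qed simp
  have int: "v (x + (of_int k * ((b - a) \<bullet> e)) *\<^sub>R e) = v x" if "e \<in> Basis" for x e and k :: int
  proof (cases "k \<ge> 0")
    case True
    thus ?thesis using nat[OF that, of x "nat k"] by simp
  next
    case False
    \<comment> \<open>For negative \<open>k\<close> the identity is used at the shifted point, from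
      which \<open>- k\<close> periods lead back to \<open>x\<close>.\<close>
    thus ?thesis using nat[OF that, of "x + (of_int k * ((b - a) \<bullet> e)) *\<^sub>R e" "nat (- k)"] by simp
  qed
  \<comment> \<open>The number of periods that brings the coordinate in direction \<open>e\<close>
    into the box, with the floor leaving a remainder of less than one period.\<close>
  define k where "k e = - \<lfloor>((x - a) \<bullet> e) / ((b - a) \<bullet> e)\<rfloor>" for e
  define y where "y = x + (\<Sum>e\<in>Basis. (of_int (k e) * ((b - a) \<bullet> e)) *\<^sub>R e)"
  have "v (x + (\<Sum>e\<in>A. (of_int (k e) * ((b - a) \<bullet> e)) *\<^sub>R e)) = v x" if "A \<subseteq> Basis" for A
    using finite_subset[OF that finite_Basis] that
  proof (induction A rule: finite_induct)
    case (insert e A)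
    thus ?case using int[of e "x + (\<Sum>e\<in>A. (of_int (k e) * ((b - a) \<bullet> e)) *\<^sub>R e)" "k e"]
      by (simp add: algebra_simps)
  qed simp
  hence "v y = v x" by (simp add: y_def)
  moreover have "y \<in> cbox a b"
    unfolding mem_box
  proof
    fix e :: 'a assume e: "e \<in> Basis"
    let ?L = "(b - a) \<bullet> e" and ?q = "((x - a) \<bullet> e) / ((b - a) \<bullet> e)"
    have L: "?L > 0" using ab e by (simp add: inner_diff_left)
    have ye: "y \<bullet> e = x \<bullet> e - of_int \<lfloor>?q\<rfloor> * ?L"
    proof -
      have "y \<bullet> e = x \<bullet> e + of_int (k e) * ?L" using e by (simp add: y_def inner_add_left)
      thus ?thesis by (simp add: k_def)
    qed
    have "of_int \<lfloor>?q\<rfloor> * ?L \<le> ?q * ?L" using L by (intro mult_right_mono) auto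
    moreover have "?q * ?L \<le> (of_int \<lfloor>?q\<rfloor> + 1) * ?L" using L by (intro mult_right_mono) linarith+
    moreover have "?q * ?L = (x - a) \<bullet> e" using L by simp
    ultimately have "of_int \<lfloor>?q\<rfloor> * ?L \<le> (x - a) \<bullet> e" "(x - a) \<bullet> e \<le> of_int \<lfloor>?q\<rfloor> * ?L + ?L"
      by (simp_all add: distrib_right)
    thus "a \<bullet> e \<le> y \<bullet> e \<and> y \<bullet> e \<le> b \<bullet> e" unfolding ye by (simp add: inner_diff_left)
  qed
  ultimately show ?thesis by blast
qed

context sav_expansion
begin

text \<open>Integration by parts against the constant 1.\<close>

lemma integral_laplacian_zero:
  assumes "\<And>e. e \<in> Basis \<Longrightarrow> good (pd e w)" "box_periodic (lo P) (hi P) w"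
  shows "integral K (laplacian w) = 0"
proof -
  have 1: "good (\<lambda>_. 1)" by (simp add: good_def partial_deriv_const)
  have 2: "box_periodic (lo P) (hi P) (\<lambda>_. 1)" by (simp add: box_periodic_def)
  have "grad_inner (\<lambda>_. 1) w = 0" by (simp add: grad_inner_def partial_deriv_const)
  with grad_inner_by_parts[OF 1 2 assms] show ?thesis by simp
qed

text \<open>Makes the calculus of order 0 a regularity check for fixed functions:
  \<open>good\<close> for expressions in \<open>u t0\<close> follows from the closure
  lemmas.\<close>

lemma Ck_expands_smooth:
  assumes "smooth_on UNIV f"
  shows "Ck_expands k 0 (\<lambda>_ _. f)"
proof (rule Ck_expands_from_iter, intro conjI)
  fix es :: "'a list" assume es: "set es \<subseteq> Basis"
  have s: "smooth_on UNIV (iter_pd es f)" by (rule smooth_on_iter_partial[OF assms es])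
  have "continuous_on K (iter_pd es f)"
    by (rule continuous_on_subset[OF smooth_on_imp_continuous[OF s]]) simp
  thus "expands 0 (\<lambda>_ _. iter_pd es f)" by (intro expands_bigO bigO_continuous)
  show "diffbl (\<lambda>_ _. iter_pd es f)"
    using smooth_on_imp_differentiable[OF s] by (simp add: diffbl_def differentiable_on_def)
qed

lemma Ck_expands_fixed_good: "(\<And>k. Ck_expands k 0 (\<lambda>_ _. f)) \<Longrightarrow> good f"
  using Ck_expands_good[of 0 "\<lambda>_ _. f" 0] by simp

lemma Ck_expands_fixed_good_partial: "(\<And>k. Ck_expands k 0 (\<lambda>_ _. f)) \<Longrightarrow> e \<in> Basis \<Longrightarrow> good (pd e f)"
  using Ck_expands_fixed_good[OF Ck_expands_partial] by simp

lemma measure_K_pos: "measure lborel K > 0"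
  using domain by (intro content_pos_lt) blast

lemma grad_inner_nonneg: "grad_inner v v \<ge> 0"
proof -
  have "integral K (\<lambda>x. pd e v x * pd e v x) \<ge> 0" for e
    by (cases "(\<lambda>x. pd e v x * pd e v x) integrable_on K")
      (auto intro: integral_nonneg simp: not_integrable_integral)
  thus ?thesis unfolding grad_inner_def by (intro sum_nonneg)
qed

lemma grad_inner_eq_0_imp_constant:
  assumes v: "good v" and 0: "grad_inner v v = 0"
  shows "\<exists>c. \<forall>x\<in>K. v x = c"
proof -
  let ?f = "\<lambda>e x. pd e v x * pd e v x"
  have cont: "continuous_on UNIV (?f e)" if "e \<in> Basis" for e
    using v that by (intro continuous_intros good_cont)
  have int: "?f e integrable_on K" if "e \<in> Basis" for e
    by (rule integrable_K[OF cont[OF that]])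
  have nonneg: "integral K (?f e) \<ge> 0" if "e \<in> Basis" for e
    using int[OF that] by (intro integral_nonneg) auto
  have zero: "pd e v x = 0" if e: "e \<in> Basis" and x: "x \<in> K" for e x
  proof -
    have "integral K (?f e) = 0"
      using 0 sum_nonneg_eq_0_iff[of Basis "\<lambda>e. integral K (?f e)"] nonneg e unfolding grad_inner_def by simp
    hence "(?f e has_integral 0) K" using int[OF e] by (metis integrable_integral)
    hence "?f e x = 0"
      by (rule has_integral_0_cbox_imp_0[rotated 2])
        (use cont[OF e] domain x in \<open>auto intro: continuous_on_subset simp: box_ne_empty\<close>)
    thus ?thesis by simp
  qed
  have "\<exists>c. \<forall>x\<in>K. v x = c"
  proof (rule has_derivative_zero_constant)
    fix x assume x: "x \<in> K"
    obtain v' where v': "(v has_derivative v') (at x)" "\<And>e. pd e v x = v' e"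
      using has_derivative_partial[OF good_diff[OF v]] by blast
    have "v' h = 0" for h
    proof -
      have "v' h = v' (\<Sum>e\<in>Basis. (h \<bullet> e) *\<^sub>R e)" by (simp add: euclidean_representation)
      also have "\<dots> = (\<Sum>e\<in>Basis. (h \<bullet> e) * v' e)"
        using has_derivative_linear[OF v'(1)] by (simp add: linear_sum linear_scale)
      also have "\<dots> = 0" using zero[OF _ x] v'(2) by (intro sum.neutral) simp
      finally show ?thesis .
    qed
    hence "v' = (\<lambda>h. 0)" by blast
    with v'(1) show "(v has_derivative (\<lambda>h. 0)) (at x within K)" by (auto intro: has_derivative_at_withinI)
  qed simp
  thus ?thesis .
qed

lemma l2_norm_bigo:
  assumes "bigO q g"
  shows "(\<lambda>\<tau>. l2_norm (lo P) (hi P) (g \<tau>)) \<in> O[at_right 0](\<lambda>\<tau>. \<tau> ^ q)"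
proof -
  from ObdE[OF bigO_integral[OF bigO_mult[OF assms assms]]] obtain B where B: "B \<ge> 0"
    "\<forall>\<^sub>F \<tau> in at_right 0. \<forall>x\<in>K. \<bar>integral K (\<lambda>x. g \<tau> x * g \<tau> x)\<bar> \<le> B * \<tau> ^ (q + q)" .
  have "\<forall>\<^sub>F \<tau> in at_right 0. norm (l2_norm (lo P) (hi P) (g \<tau>)) \<le> sqrt B * norm (\<tau> ^ q)"
    using B(2) eventually_tau
  proof eventually_elim
    case (elim \<tau>)
    \<comment> \<open>The real \<open>sqrt\<close> is odd, so this holds whatever the sign of the
      integral.\<close>
    have "norm (l2_norm (lo P) (hi P) (g \<tau>)) = sqrt \<bar>integral K (\<lambda>x. g \<tau> x * g \<tau> x)\<bar>"
      unfolding l2_norm_def l2_inner_def by (simp add: abs_if real_sqrt_minus)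
    also have "\<dots> \<le> sqrt (B * \<tau> ^ (q + q))" using elim(1) lo_K by (intro real_sqrt_le_mono) blast
    also have "\<dots> = sqrt B * norm (\<tau> ^ q)" using elim(2) by (simp add: real_sqrt_mult power_add)
    finally show ?case .
  qed
  thus ?thesis by (rule bigoI)
qed

lemma bigO_scalar_bigo:
  assumes "bigO q (\<lambda>\<tau> _. f \<tau>)"
  shows "f \<in> O[at_right 0](\<lambda>\<tau>. \<tau> ^ q)"
proof -
  from ObdE[OF assms] obtain B where B: "\<forall>\<^sub>F \<tau> in at_right 0. \<forall>x\<in>K. \<bar>f \<tau>\<bar> \<le> B * \<tau> ^ q" by blast
  have "\<forall>\<^sub>F \<tau> in at_right 0. norm (f \<tau>) \<le> B * norm (\<tau> ^ q)"
    using B eventually_tau by eventually_elim (use lo_K in auto)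
  thus ?thesis by (rule bigoI)
qed

lemma bigO_scalar_tendsto:
  assumes "bigO 1 (\<lambda>\<tau> _. f \<tau> - c)"
  shows "(f \<longlongrightarrow> c) (at_right 0)"
  using bigO_1_tendsto[OF assms lo_K] .

end

context sav_order
begin

text \<open>The denominator with the increments replaced by the exact time derivatives at
  \<open>t0\<close>; it is the limit of \<open>denom\<close>.\<close>

definition D0 :: real where
  "D0 = (eps P)\<^sup>2 / 2 * grad_inner (ut t0) (ut t0) + (sav_Nt P (u t0) (r t0))\<^sup>2"

lemma good_ut: "good (ut t0)"
  by (intro good_smooth smooth_ut t0_mem)

lemma denom_near: "bigO 1 (\<lambda>\<tau> _. denom \<tau> - D0)"
proof -
  have g: "bigO 1 (\<lambda>\<tau> _. grad_inner (incr_u \<tau>) (incr_u \<tau>) - grad_inner (ut t0) (ut t0))"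
  proof (rule bigO_grad_inner_diff)
    fix e :: 'a assume e: "e \<in> Basis"
    show 1: "bigO 1 (\<lambda>\<tau> x. pd e (incr_u \<tau>) x - pd e (ut t0) x)" by (rule partial_incr_u_near[OF e])
    have "bigO 0 (\<lambda>\<tau> x. (pd e (incr_u \<tau>) x - pd e (ut t0) x) + pd e (ut t0) x)"
      by (intro bigO_add[OF bigO_mono[OF 1]] bigO_continuous continuous_on_subset[OF good_cont[OF good_ut e]]) auto
    thus "bigO 0 (\<lambda>\<tau>. pd e (incr_u \<tau>))" by simp
  next
    show "\<forall>\<^sub>F \<tau> in at_right 0. good (incr_u \<tau>) \<and> good (ut t0)"
      using ev_good_all by eventually_elim (simp add: good_incr_u good_ut)
  qed
  have "bigO 0 (\<lambda>\<tau> _. incr_r \<tau> - sav_Nt P (u t0) (r t0))" using incr_r_near by (auto intro: bigO_mono)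
  from bigO_add[OF this bigO_const[of "sav_Nt P (u t0) (r t0)"]] have "bigO 0 (\<lambda>\<tau> _. incr_r \<tau>)" by simp
  hence 2: "bigO 1 (\<lambda>\<tau> _. incr_r \<tau> * incr_r \<tau> - sav_Nt P (u t0) (r t0) * sav_Nt P (u t0) (r t0))"
    by (intro bigO_square_diff incr_r_near)
  have "\<forall>\<^sub>F \<tau> in at_right 0. \<forall>x\<in>K. (eps P)\<^sup>2 / 2 * (grad_inner (incr_u \<tau>) (incr_u \<tau>) - grad_inner (ut t0) (ut t0))
      + (incr_r \<tau> * incr_r \<tau> - sav_Nt P (u t0) (r t0) * sav_Nt P (u t0) (r t0)) = denom \<tau> - D0"
    using ev_denom by eventually_elim (simp add: D0_def right_diff_distrib power2_eq_square)
  from iffD1[OF bigO_cong[OF this] bigO_add[OF bigO_cmult[OF g] 2]] show ?thesis .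
qed

text \<open>If \<open>D0\<close> vanished, \<open>ut t0\<close> would be a nonzero constant
  \<open>c\<close> on the box and \<open>r\<close> would be stationary. But \<open>ut t0\<close> has
  integral 0. For Cahn-Hilliard it is a sum of Laplacians of periodic functions. For Allen-Cahn the
  stationarity of \<open>r\<close> says that \<open>c\<close> times the integral of
  \<open>deriv (pot P) (u t0 x)\<close> is 0, so this integral vanishes together with that of the
  Laplacian.\<close>

lemma D0_pos:
  assumes "\<exists>x. sav_L P (u t0) x + sav_N P (u t0) (r t0) x \<noteq> 0"
  shows "D0 > 0"
proof (rule ccontr)
  assume "\<not> D0 > 0"
  moreover have "(eps P)\<^sup>2 / 2 * grad_inner (ut t0) (ut t0) \<ge> 0" using grad_inner_nonneg by simp
  moreover have "(sav_Nt P (u t0) (r t0))\<^sup>2 \<ge> 0" by simp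
  ultimately have "(eps P)\<^sup>2 / 2 * grad_inner (ut t0) (ut t0) = 0" "(sav_Nt P (u t0) (r t0))\<^sup>2 = 0"
    unfolding D0_def by linarith+
  hence g0: "grad_inner (ut t0) (ut t0) = 0" and n0: "sav_Nt P (u t0) (r t0) = 0" using eps by auto
  from grad_inner_eq_0_imp_constant[OF good_ut g0] obtain c where c: "\<And>x. x \<in> K \<Longrightarrow> ut t0 x = c" by blast
  have per: "box_periodic (lo P) (hi P) (u t0)" by (rule periodic_u[OF t0_mem])
  have L_per: "box_periodic (lo P) (hi P) (sav_L P (u t0))" and N_per: "box_periodic (lo P) (hi P) (sav_N P (u t0) (r t0))"
    using per by (rule box_periodic_L, rule box_periodic_N)
  have ut: "ut t0 x = sav_L P (u t0) x + sav_N P (u t0) (r t0) x" for x by (simp add: ut_eq[OF t0_mem])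
  have "box_periodic (lo P) (hi P) (ut t0)"
    using L_per N_per unfolding box_periodic_def by (simp add: ut)
  \<comment> \<open>The point where the right-hand side is nonzero may lie outside the box;
    periodicity moves it inside.\<close>
  with box_periodic_reduce[OF domain this] assms c have c0: "c \<noteq> 0" by (metis ut)
  have int_ut: "integral K (ut t0) = c * measure lborel K"
    using integral_cong[of K "ut t0" "\<lambda>_. c"] c by simp
  have s: "Ck_expands k 0 (\<lambda>_ _. u t0)" for k by (rule Ck_expands_smooth[OF smooth_u[OF t0_mem]])
  have F: "Ck_expands k 0 (\<lambda>_ _ x. deriv (pot P) (u t0 x))" for k by (rule Ck_expands_pot'[OF s])
  have N: "Ck_expands k 0 (\<lambda>_ _ x. r t0 / sqrt (sav_Q P (u t0)) * deriv (pot P) (u t0 x))" for k by (rule Ck_expands_cmult[OF F])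
  have La: "Ck_expands k 0 (\<lambda>_ _ x. - (eps P)\<^sup>2 * laplacian (u t0) x)" for k by (rule Ck_expands_cmult[OF Ck_expands_laplacian[OF s]])
  have intF: "(\<lambda>x. deriv (pot P) (u t0 x)) integrable_on K"
    by (intro integrable_K good_continuous Ck_expands_fixed_good F)
  have intL: "laplacian (u t0) integrable_on K"
    by (intro integrable_K good_continuous Ck_expands_fixed_good Ck_expands_laplacian s)
  have lap_u: "integral K (laplacian (u t0)) = 0"
    by (rule integral_laplacian_zero[OF Ck_expands_fixed_good_partial[OF s] per])
  have "integral K (ut t0) = 0"
  proof (cases "mob P = laplacian")
    case True
    have 1: "integral K (sav_L P (u t0)) = 0"
      unfolding sav_L_def True using box_periodic_laplacian[OF per]
      by (intro integral_laplacian_zero Ck_expands_fixed_good_partial[OF La]) (auto simp: box_periodic_def)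
    have 2: "integral K (sav_N P (u t0) (r t0)) = 0"
      unfolding sav_N_def True using per
      by (intro integral_laplacian_zero Ck_expands_fixed_good_partial[OF N]) (auto simp: box_periodic_def)
    have i1: "sav_L P (u t0) integrable_on K"
      unfolding sav_L_def True by (intro integrable_K good_continuous Ck_expands_fixed_good Ck_expands_laplacian La)
    have i2: "sav_N P (u t0) (r t0) integrable_on K"
      unfolding sav_N_def True by (intro integrable_K good_continuous Ck_expands_fixed_good Ck_expands_laplacian N)
    have "integral K (ut t0) = integral K (\<lambda>x. sav_L P (u t0) x + sav_N P (u t0) (r t0) x)"
      by (simp add: ut_eq[OF t0_mem])
    also have "\<dots> = 0" using integral_add[OF i1 i2] 1 2 by simp
    finally show ?thesis .
  next
    case False
    hence mob: "mob P = (\<lambda>v x. - v x)" using mobility by blast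
    have "l2_inner (lo P) (hi P) (\<lambda>x. deriv (pot P) (u t0 x)) (\<lambda>x. sav_L P (u t0) x + sav_N P (u t0) (r t0) x) = 0"
      using n0 Q0_pos by (simp add: sav_Nt_def Q0_def)
    moreover have "l2_inner (lo P) (hi P) (\<lambda>x. deriv (pot P) (u t0 x)) (\<lambda>x. sav_L P (u t0) x + sav_N P (u t0) (r t0) x) =
      integral K (\<lambda>x. deriv (pot P) (u t0 x) * c)"
      unfolding l2_inner_def using c by (intro integral_cong) (simp add: ut)
    ultimately have "integral K (\<lambda>x. deriv (pot P) (u t0 x)) = 0" using c0 by simp
    moreover have "ut t0 = (\<lambda>x. (eps P)\<^sup>2 * laplacian (u t0) x - r t0 / sqrt (sav_Q P (u t0)) * deriv (pot P) (u t0 x))"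
      by (simp add: ut_eq[OF t0_mem] sav_L_def sav_N_def mob)
    moreover have "integral K (\<lambda>x. (eps P)\<^sup>2 * laplacian (u t0) x - r t0 / sqrt (sav_Q P (u t0)) * deriv (pot P) (u t0 x)) =
      (eps P)\<^sup>2 * integral K (laplacian (u t0)) - r t0 / sqrt (sav_Q P (u t0)) * integral K (\<lambda>x. deriv (pot P) (u t0 x))"
      using integral_diff[OF integrable_on_cmult_left[OF intL, of "(eps P)\<^sup>2"] integrable_on_cmult_left[OF intF, of "r t0 / sqrt (sav_Q P (u t0))"]]
      by simp
    ultimately show ?thesis using lap_u by simp
  qed
  with int_ut c0 measure_K_pos show False by simp
qed

section \<open>The relaxation coefficient and the relaxed step\<close>

definition gam :: "real \<Rightarrow> real" where
  "gam \<tau> = rrk_gamma P M \<tau> (u t0) (r t0) (U \<tau>) (R \<tau>)"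

lemma gam_eq: "gam \<tau> = (if denom \<tau> = 0 then 1 else numer \<tau> / (\<tau> * denom \<tau>))"
  by (simp add: gam_def rrk_gamma_def denom_def numer_def)

text \<open>\<open>gam \<tau> - 1\<close> is the quantity of \<open>numer_denom\<close>, up to sign,
  divided by \<open>\<tau> * \<tau> * denom \<tau>\<close>. The two factors \<open>\<tau>\<close>
  reduce the order from \<open>p + 1\<close> to \<open>p - 1\<close>, and \<open>denom\<close> is
  bounded below near its positive limit.\<close>

lemma gam_near: "bigO (p - 1) (\<lambda>\<tau> _. gam \<tau> - 1)"
proof (cases "\<forall>\<^sub>F \<tau> in at_right 0. denom \<tau> = 0")
  case True
  hence "\<forall>\<^sub>F \<tau> in at_right 0. \<forall>x\<in>K. 0 = gam \<tau> - 1" by eventually_elim (simp add: gam_eq)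
  from iffD1[OF bigO_cong[OF this] bigO_zero] show ?thesis .
next
  case False
  \<comment> \<open>In this case the second alternative of the nondegeneracy assumption is
    excluded.\<close>
  hence pos: "D0 > 0" using nondegenerate D0_pos unfolding denom_def by blast
  have "\<forall>\<^sub>F \<tau> in at_right 0. D0 / 2 < denom \<tau>"
    using order_tendstoD(1)[OF bigO_scalar_tendsto[OF denom_near], of "D0 / 2"] pos by simp
  moreover from ObdE[OF numer_denom] obtain B where B: "B \<ge> 0"
    "\<forall>\<^sub>F \<tau> in at_right 0. \<forall>x\<in>K. \<bar>\<tau> * (\<tau> * denom \<tau> - numer \<tau>)\<bar> \<le> B * \<tau> ^ Suc p" .
  note B(2)
  ultimately have "\<forall>\<^sub>F \<tau> in at_right 0. \<forall>x\<in>K. \<bar>gam \<tau> - 1\<bar> \<le> (2 * B / D0) * \<tau> ^ (p - 1)"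
    using eventually_tau
  proof eventually_elim
    case (elim \<tau>)
    have D: "denom \<tau> > 0" using elim(1) pos by linarith
    have \<tau>: "\<tau> > 0" using elim(3) by simp
    have e: "\<tau> * \<tau> * denom \<tau> * (gam \<tau> - 1) = - (\<tau> * (\<tau> * denom \<tau> - numer \<tau>))"
      using D \<tau> by (simp add: gam_eq field_simps)
    have "\<tau> * \<tau> * (D0 / 2) * \<bar>gam \<tau> - 1\<bar> \<le> \<tau> * \<tau> * denom \<tau> * \<bar>gam \<tau> - 1\<bar>"
      using elim(1) \<tau> by (intro mult_right_mono mult_left_mono) auto
    also have "\<dots> = \<bar>\<tau> * \<tau> * denom \<tau> * (gam \<tau> - 1)\<bar>" using D \<tau> by (simp add: abs_mult)
    also have "\<dots> = \<bar>\<tau> * (\<tau> * denom \<tau> - numer \<tau>)\<bar>" unfolding e by simp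
    also have "\<dots> \<le> B * \<tau> ^ Suc p" using elim(2) lo_K by blast
    also have "\<tau> ^ Suc p = \<tau> * \<tau> * \<tau> ^ (p - 1)"
      using p_ge_2 by (cases p) (auto simp: mult.assoc)
    finally have "(\<tau> * \<tau>) * ((D0 / 2) * \<bar>gam \<tau> - 1\<bar>) \<le> (\<tau> * \<tau>) * (B * \<tau> ^ (p - 1))" by (simp add: mult_ac)
    hence "(D0 / 2) * \<bar>gam \<tau> - 1\<bar> \<le> B * \<tau> ^ (p - 1)" using \<tau> by simp
    hence "\<bar>gam \<tau> - 1\<bar> \<le> (2 * B / D0) * \<tau> ^ (p - 1)" using pos by (simp add: field_simps)
    thus ?case by simp
  qed
  thus ?thesis unfolding bigO_def by blast
qed

text \<open>Stated for a general \<open>f\<close> so as to cover \<open>u\<close> and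
  \<open>r\<close>. For the first claim, relaxation changes the step by
  \<open>\<tau> * (gam \<tau> - 1) * \<delta> \<tau> x\<close>, of order \<open>p\<close>. For the
  second, the change of \<open>f\<close> between the two candidate times compensates this up to
  terms containing one more factor \<open>\<tau>\<close>.\<close>

lemma relaxed_step:
  assumes f: "\<And>t x. t \<in> {t0..T} \<Longrightarrow> x \<in> K \<Longrightarrow> ((\<lambda>s. f s x) has_real_derivative g t x) (at t within {t0..T})"
    and g: "\<And>t x. t \<in> {t0..T} \<Longrightarrow> x \<in> K \<Longrightarrow> ((\<lambda>s. g s x) has_real_derivative h t x) (at t within {t0..T})"
    and h: "\<And>t x. t \<in> {t0..T} \<Longrightarrow> x \<in> K \<Longrightarrow> \<bar>h t x\<bar> \<le> B"
    and step: "bigO (Suc p) (\<lambda>\<tau> x. f (t0 + \<tau>) x - (f t0 x + \<tau> * \<delta> \<tau> x))"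
    and near: "bigO 1 (\<lambda>\<tau> x. \<delta> \<tau> x - g t0 x)" and bd: "bigO 0 (\<lambda>_. g t0)"
  shows "bigO p (\<lambda>\<tau> x. f (t0 + \<tau>) x - (f t0 x + gam \<tau> * \<tau> * \<delta> \<tau> x))"
    and "bigO (Suc p) (\<lambda>\<tau> x. f (t0 + gam \<tau> * \<tau>) x - (f t0 x + gam \<tau> * \<tau> * \<delta> \<tau> x))"
proof -
  have p1: "Suc (p - 1) = p" using p_ge_2 by simp
  have "bigO 0 (\<lambda>\<tau> x. (\<delta> \<tau> x - g t0 x) + g t0 x)" by (rule bigO_add[OF bigO_mono[OF near] bd]) simp
  hence "bigO 0 \<delta>" by simp
  from bigO_tau_times[OF bigO_mult[OF gam_near this]]
  have "bigO p (\<lambda>\<tau> x. \<tau> * ((gam \<tau> - 1) * \<delta> \<tau> x))" by (simp only: p1 add_0_right)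
  from bigO_diff[OF bigO_mono[OF step, of p] this]
  show "bigO p (\<lambda>\<tau> x. f (t0 + \<tau>) x - (f t0 x + gam \<tau> * \<tau> * \<delta> \<tau> x))" by (simp add: algebra_simps)
  have B0: "B \<ge> 0" using h[OF t0_mem lo_K] by linarith
  have "bigO 1 (\<lambda>\<tau> _. gam \<tau> - 1)" using p_ge_2 by (intro bigO_mono[OF gam_near]) simp
  from bigO_scalar_tendsto[OF this] have gt: "(gam \<longlongrightarrow> 1) (at_right 0)" .
  \<comment> \<open>The bound 2 keeps both candidate times within
    \<open>{t0..t0 + 2 * \<tau>}\<close>, and by \<open>evT\<close> within the life span of the
    solution.\<close>
  have evg: "\<forall>\<^sub>F \<tau> in at_right 0. 0 < gam \<tau> \<and> gam \<tau> < 2"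
    using order_tendstoD[OF gt, of 0] order_tendstoD[OF gt, of 2] by (simp add: eventually_conj)
  have evT: "\<forall>\<^sub>F \<tau> in at_right 0. 0 < \<tau> \<and> t0 + 2 * \<tau> \<le> T"
    using eventually_at_right_real[of 0 "(T - t0) / 2"] t0_less_T by (auto elim!: eventually_mono simp: field_simps)
  \<comment> \<open>The linear part with slope \<open>g t0 x\<close> is subtracted, so that the
    derivative of the remaining function is \<open>g s x - g t0 x\<close>, of size
    \<open>\<tau>\<close>, and its change over a distance
    \<open>\<tau> * \<bar>gam \<tau> - 1\<bar>\<close> is of order \<open>p + 1\<close>.\<close>
  let ?m = "\<lambda>\<tau> x. (f (t0 + gam \<tau> * \<tau>) x - (t0 + gam \<tau> * \<tau>) * g t0 x) - (f (t0 + \<tau>) x - (t0 + \<tau>) * g t0 x)"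
  have m: "bigO (Suc p) ?m"
  proof (rule bigO_le)
    show "bigO (Suc p) (\<lambda>\<tau> _. \<tau> * (\<tau> * (gam \<tau> - 1)))"
      using bigO_tau_times[OF bigO_tau_times[OF gam_near]] by (simp only: p1)
    show "\<forall>\<^sub>F \<tau> in at_right 0. \<forall>x\<in>K. \<bar>?m \<tau> x\<bar> \<le> 2 * B * \<bar>\<tau> * (\<tau> * (gam \<tau> - 1))\<bar>"
      using evg evT
    proof eventually_elim
      case (elim \<tau>)
      show ?case
      proof
        fix x assume x: "x \<in> K"
        let ?I = "{t0..t0 + 2 * \<tau>}"
        have sub: "?I \<subseteq> {t0..T}" using elim(2) by auto
        have gb: "\<bar>g s x - g t0 x\<bar> \<le> 2 * B * \<tau>" if s: "s \<in> ?I" for s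
        proof -
          have "norm (g s x - g t0 x) \<le> B * norm (s - t0)"
            by (rule field_differentiable_bound[of ?I "\<lambda>s. g s x" "\<lambda>s. h s x"])
              (use sub x s elim(2) in \<open>auto intro: DERIV_subset[OF g] h\<close>)
          also have "\<dots> \<le> B * (2 * \<tau>)" using s B0 by (intro mult_left_mono) auto
          finally show ?thesis by (simp add: mult_ac)
        qed
        have "norm ((f (t0 + gam \<tau> * \<tau>) x - (t0 + gam \<tau> * \<tau>) * g t0 x) - (f (t0 + \<tau>) x - (t0 + \<tau>) * g t0 x))
           \<le> 2 * B * \<tau> * norm ((t0 + gam \<tau> * \<tau>) - (t0 + \<tau>))"
        proof (rule field_differentiable_bound[of ?I "\<lambda>s. f s x - s * g t0 x" "\<lambda>s. g s x - g t0 x"])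
          fix s assume s: "s \<in> ?I"
          have "((\<lambda>s. f s x) has_real_derivative g s x) (at s within ?I)"
            using s sub x by (intro DERIV_subset[OF f]) auto
          thus "((\<lambda>s. f s x - s * g t0 x) has_real_derivative g s x - g t0 x) (at s within ?I)"
            by (auto intro!: derivative_eq_intros)
          show "norm (g s x - g t0 x) \<le> 2 * B * \<tau>" using gb[OF s] by simp
        next
          have "gam \<tau> * \<tau> \<le> 2 * \<tau>" using elim by (intro mult_right_mono) auto
          thus "t0 + gam \<tau> * \<tau> \<in> ?I" using elim by simp
        qed (use elim in auto)
        also have "(t0 + gam \<tau> * \<tau>) - (t0 + \<tau>) = \<tau> * (gam \<tau> - 1)" by (simp add: algebra_simps)
        finally show "\<bar>?m \<tau> x\<bar> \<le> 2 * B * \<bar>\<tau> * (\<tau> * (gam \<tau> - 1))\<bar>"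
          using elim(2) by (simp add: abs_mult mult.assoc)
      qed
    qed
  qed
  \<comment> \<open>The mismatch of the two linear parts: orders 1, \<open>p - 1\<close> and 1 of
    the three factors add up to \<open>p + 1\<close>.\<close>
  have "bigO (Suc p) (\<lambda>\<tau> x. \<tau> * ((gam \<tau> - 1) * (\<delta> \<tau> x - g t0 x)))"
    using bigO_tau_times[OF bigO_mult[OF gam_near near]] p_ge_2 by simp
  from bigO_diff[OF bigO_add[OF m step] this] have "bigO (Suc p) (\<lambda>\<tau> x. ?m \<tau> x + (f (t0 + \<tau>) x - (f t0 x + \<tau> * \<delta> \<tau> x)) - \<tau> * ((gam \<tau> - 1) * (\<delta> \<tau> x - g t0 x)))" .
  thus "bigO (Suc p) (\<lambda>\<tau> x. f (t0 + gam \<tau> * \<tau>) x - (f t0 x + gam \<tau> * \<tau> * \<delta> \<tau> x))"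
    by (simp add: algebra_simps)
qed

lemma u_relaxed:
  "bigO p (\<lambda>\<tau> x. u (t0 + \<tau>) x - (u t0 x + gam \<tau> * \<tau> * incr_u \<tau> x))"
  "bigO (Suc p) (\<lambda>\<tau> x. u (t0 + gam \<tau> * \<tau>) x - (u t0 x + gam \<tau> * \<tau> * incr_u \<tau> x))"
proof -
  obtain B where B: "\<forall>t\<in>{t0..T}. \<forall>x\<in>K. \<bar>iter_pd [] (utt t) x\<bar> \<le> B"
    using slab_bounded[OF smooth_Wtt, of "[]" "lo P" "hi P"] by (auto simp: utt_def[abs_def])
  note r = relaxed_step[where f = u and g = ut and h = utt and B = B and \<delta> = incr_u, OF _ _ _ u_order incr_u_near
      bigO_continuous[OF good_continuous[OF good_ut]]]
  show "bigO p (\<lambda>\<tau> x. u (t0 + \<tau>) x - (u t0 x + gam \<tau> * \<tau> * incr_u \<tau> x))"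
    by (rule r(1)) (use u_evolution[of "[]"] ut_evolution[of "[]"] B in \<open>auto simp: iter_partial_def\<close>)
  show "bigO (Suc p) (\<lambda>\<tau> x. u (t0 + gam \<tau> * \<tau>) x - (u t0 x + gam \<tau> * \<tau> * incr_u \<tau> x))"
    by (rule r(2)) (use u_evolution[of "[]"] ut_evolution[of "[]"] B in \<open>auto simp: iter_partial_def\<close>)
qed

lemma r_relaxed:
  "bigO p (\<lambda>\<tau> _. r (t0 + \<tau>) - (r t0 + gam \<tau> * \<tau> * incr_r \<tau>))"
  "bigO (Suc p) (\<lambda>\<tau> _. r (t0 + gam \<tau> * \<tau>) - (r t0 + gam \<tau> * \<tau> * incr_r \<tau>))"
proof -
  let ?r'' = "partial_deriv {t0..T} 1 (partial_deriv {t0..T} 1 r)"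
  have "smooth_on {t0..T} ?r''" by (intro smooth_on_partial_deriv r_smooth) simp_all
  then obtain B where B: "\<forall>t\<in>{t0..T}. \<bar>?r'' t\<bar> \<le> B" using smooth_real_bounded by blast
  note s = relaxed_step[where f = "\<lambda>t _. r t" and g = "\<lambda>t _. sav_Nt P (u t) (r t)" and h = "\<lambda>t _. ?r'' t"
      and B = B and \<delta> = "\<lambda>\<tau> _. incr_r \<tau>", OF r_evolution Nt_evolution _ r_order incr_r_near bigO_const]
  show "bigO p (\<lambda>\<tau> _. r (t0 + \<tau>) - (r t0 + gam \<tau> * \<tau> * incr_r \<tau>))"
    by (rule s(1)) (use B in auto)
  show "bigO (Suc p) (\<lambda>\<tau> _. r (t0 + gam \<tau> * \<tau>) - (r t0 + gam \<tau> * \<tau> * incr_r \<tau>))"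
    by (rule s(2)) (use B in auto)
qed

end

theorem theorem3p2:
  fixes P :: "'a::euclidean_space sav" and M :: imex and p :: nat
    and t0 T \<tau>0 :: real and u :: "real \<Rightarrow> 'a \<Rightarrow> real" and r :: "real \<Rightarrow> real"
    and U :: "real \<Rightarrow> nat \<Rightarrow> 'a \<Rightarrow> real" and R :: "real \<Rightarrow> nat \<Rightarrow> real"
  assumes domain: "\<forall>e\<in>Basis. lo P \<bullet> e < hi P \<bullet> e"
    and eps: "eps P > 0" and C0: "C0 P \<ge> 0"
    and potential: "smooth_on UNIV (pot P)"
    and mobility: "mob P = (\<lambda>v x. - v x) \<or> mob P = laplacian"
    and tableau: "imex_tableau M"
    and order: "imex_order M p" "p \<ge> 2"
    and exact: "t0 < T" "sav_solution P t0 T u r"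
    and stages: "\<tau>0 > 0" "smooth_stage_family P M \<tau>0 U"
      "\<forall>\<tau>\<in>{0<..\<tau>0}. rrk_stages P M \<tau> (u t0) (r t0) (U \<tau>) (R \<tau>)"
    and nondegenerate:
      "(\<exists>x. sav_L P (u t0) x + sav_N P (u t0) (r t0) x \<noteq> 0) \<or>
       (\<forall>\<^sub>F \<tau> in at_right 0. rrk_D P M (U \<tau>) (R \<tau>) = 0)"
  defines "\<gamma> \<equiv> \<lambda>\<tau>. rrk_gamma P M \<tau> (u t0) (r t0) (U \<tau>) (R \<tau>)"
    and "u1 \<equiv> \<lambda>\<tau>. rrk_step_u P M \<tau> (u t0) (r t0) (U \<tau>) (R \<tau>)"
    and "r1 \<equiv> \<lambda>\<tau>. rrk_step_r P M \<tau> (u t0) (r t0) (U \<tau>) (R \<tau>)"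
  shows "((\<lambda>\<tau>. l2_norm (lo P) (hi P) (\<lambda>x. u (t0 + \<tau>) x - u1 \<tau> x)) \<in> O[at_right 0](\<lambda>\<tau>. \<tau> ^ p) \<and>
          (\<lambda>\<tau>. r (t0 + \<tau>) - r1 \<tau>) \<in> O[at_right 0](\<lambda>\<tau>. \<tau> ^ p)) \<and>
         ((\<lambda>\<tau>. l2_norm (lo P) (hi P) (\<lambda>x. u (t0 + \<gamma> \<tau> * \<tau>) x - u1 \<tau> x)) \<in> O[at_right 0](\<lambda>\<tau>. \<tau> ^ (p + 1)) \<and>
          (\<lambda>\<tau>. r (t0 + \<gamma> \<tau> * \<tau>) - r1 \<tau>) \<in> O[at_right 0](\<lambda>\<tau>. \<tau> ^ (p + 1)))"
proof -
  interpret sav_order P M t0 T u r \<tau>0 U R p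
    by unfold_locales (fact domain potential mobility exact eps tableau stages order nondegenerate)+
  have "u1 = (\<lambda>\<tau> x. u t0 x + \<gamma> \<tau> * \<tau> * incr_u \<tau> x)" "r1 = (\<lambda>\<tau>. r t0 + \<gamma> \<tau> * \<tau> * incr_r \<tau>)" "\<gamma> = gam"
    by (simp_all add: u1_def r1_def \<gamma>_def gam_def incr_u_def incr_r_def rrk_step_u_def rrk_step_r_def fun_eq_iff)
  with l2_norm_bigo[OF u_relaxed(1)] l2_norm_bigo[OF u_relaxed(2)]
    bigO_scalar_bigo[OF r_relaxed(1)] bigO_scalar_bigo[OF r_relaxed(2)]
  show ?thesis by simp
qed

end
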